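(* Let $V=\mathbb{O}^2$ and let $dx,dy\in\mathbb{O}\otimes\bigwedge^1V^*$ be the octonionic coordinate $1$-forms. Put $$\Psi_{40}:=((\overline{dx}\wedge dx)\wedge\overline{dx})\wedge dx,\qquad \Psi_{31}:=((\overline{dy}\wedge dx)\wedge\overline{dx})\wedge dx,$$ $$\Psi_{13}:=((\overline{dx}\wedge dy)\wedge\overline{dy})\wedge dy,\qquad \Psi_{04}:=((\overline{dy}\wedge dy)\wedge\overline{dy})\wedge dy.$$ Then the form $$\Psi_8:=\Psi_{40}\wedge\overline{\Psi_{40}}+4\,\Psi_{31}\wedge\overline{\Psi_{31}}-5\left(\Psi_{31}\wedge\Psi_{13}+\overline{\Psi_{13}}\wedge\overline{\Psi_{31}}\right)+4\,\Psi_{13}\wedge\overline{\Psi_{13}}+\Psi_{04}\wedge\overline{\Psi_{04}}$$ is a non-trivial (i.e. non-zero) real multiple of the $Spin(9)$-invariant $8$-form $\Psi$ on $\mathbb{O}^2$.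
   Context: Octonions: $\mathbb{O}=\mathbb{R}^8$ with standard basis $e_0=1,e_1,\dots,e_7$; it is the alternative (non-associative) unital real algebra with $e_i^2=-1$, $e_ie_j=-e_je_i$ for $i\neq j$ in $\{1,\dots,7\}$, and $e_{1+i}e_{2+i}=e_{4+i}$ for $1\le i\le 7$, with indices reduced modulo $7$ to $\{1,\dots,7\}$. The involution is $\overline{1}=1$, $\overline{e_j}=-e_j$; $\langle u,v\rangle=\mathrm{Re}(u\overline v)$ with $\mathrm{Re}(u)=\tfrac12(u+\overline u)$ is the standard Euclidean inner product. $R_u:\mathbb{O}\to\mathbb{O}$, $R_u(x)=xu$, denotes right multiplication by $u$. Octonion-valued forms: for a finite-dimensional real vector space $V$, $\mathbb{O}\otimes\bigwedge^\bullet V^*$ (tensor product over $\mathbb{R}$) carries the (non-associative) product $(u\otimes\varphi)\wedge(v\otimes\psi):=(uv)\otimes(\varphi\wedge\psi)$. The involution is extended by $\overline{u\otimes\varphi}=\overline u\otimes\varphi$. Real forms are identified with elements of $\mathbb{R}1\otimes\bigwedge^\bullet V^*$. For $V=\mathbb{O}^2$, the coordinate forms are $dx\binom{u_1}{u_2}=u_1$, $dy\binom{u_1}{u_2}=u_2$, i.e. $dx=\sum_{i=0}^7e_i\otimes dx^i$, $dy=\sum_{i=0}^7e_i\otimes dy^i$, where $dx^0,\dots,dx^7,dy^0,\dots,dy^7$ is the basis of $V^*$ dual to the standard basis of $\mathbb{O}^2=\mathbb{O}\oplus\mathbb{O}$. The group $Spin(9)$: the subgroup of $SO(16)=SO(\mathbb{O}^2)$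 generated by the matrices $\begin{pmatrix}R_r&R_u\\R_{\overline u}&-R_r\end{pmatrix}$ with $r\in\mathbb{R}$, $u\in\mathbb{O}$, $r^2+\langle u,u\rangle=1$, acting on column vectors in $\mathbb{O}^2$; it acts on $\bigwedge^8(\mathbb{O}^2)^*$ by pullback. The form $\Psi$: it is a known fact (Brown–Gray) that the space of $Spin(9)$-invariant elements of the real vector space $\bigwedge^8(\mathbb{O}^2)^*$ is one-dimensional; "the $Spin(9)$-invariant $8$-form" $\Psi$ is a non-zero element of this space, unique up to a real scalar factor. *)

theory Defs
  imports "HOL-Analysis.Analysis" "HOL-Combinatorics.Permutations"
begin

section \<open>Octonions\<close>

text \<open>
  Octonions are the Euclidean space \<open>real ^ 8\<close>, so addition, scaling, norm and the standard inner
  product come from the library.  The library also puts the componentwise product \<open>(*)\<close> and its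
  unit \<open>1\<close> on vectors; these are not the octonionic operations, which are \<open>\<odot>\<close> and \<open>oct_e 0\<close>.
\<close>

type_synonym octonion = "real ^ 8"

text \<open>The standard basis \<open>e\<^sub>0, \<dots>, e\<^sub>7\<close>.  In the index type \<open>8\<close>, arithmetic is modulo 8.\<close>

definition oct_e :: "nat \<Rightarrow> octonion" where
  "oct_e k = axis (of_nat k) 1"

text \<open>Reduction modulo 7 to the representatives \<open>1, \<dots>, 7\<close>.\<close>

definition red7 :: "nat \<Rightarrow> nat" where
  "red7 k = (k + 6) mod 7 + 1"

text \<open>
  The products \<open>e\<^sub>i e\<^sub>j\<close> for \<open>i, j \<le> 7\<close>.  In an alternative algebra the relations
  \<open>e\<^sub>i\<^sup>2 = - e\<^sub>0\<close>, anticommutativity and \<open>e\<^sub>a e\<^sub>b = e\<^sub>c\<close> for \<open>(a, b, c) = (1+i, 2+i, 4+i)\<close> entail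
  \<open>e\<^sub>b e\<^sub>c = e\<^sub>a\<close> and \<open>e\<^sub>c e\<^sub>a = e\<^sub>b\<close>.  These three products have \<open>j - i = 1, 2, 4\<close> modulo 7, and
  the reversed ones have \<open>j - i = 6, 5, 3\<close>.
\<close>

definition oct_e_mult :: "nat \<Rightarrow> nat \<Rightarrow> octonion" where
  "oct_e_mult i j =
    (if i = 0 then oct_e j
     else if j = 0 then oct_e i
     else if i = j then - oct_e 0
     else let d = (j + 7 - i) mod 7 in
       if d = 1 then oct_e (red7 (i + 3))
       else if d = 2 then oct_e (red7 (i + 6))
       else if d = 4 then oct_e (red7 (i + 5))
       else if d = 6 then - oct_e (red7 (j + 3))
       else if d = 5 then - oct_e (red7 (j + 6))
       else - oct_e (red7 (j + 5)))"

definition oct_mult :: "octonion \<Rightarrow> octonion \<Rightarrow> octonion"  (infixl "\<odot>" 70) where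
  "x \<odot> y = (\<Sum>i<8. \<Sum>j<8. (x $ of_nat i * y $ of_nat j) *\<^sub>R oct_e_mult i j)"

definition oct_cnj :: "octonion \<Rightarrow> octonion" where
  "oct_cnj x = (\<chi> i. if i = 0 then x $ i else - x $ i)"


subsection \<open>The defining relations\<close>

lemma lessThan_8: "{..<8::nat} = {0, 1, 2, 3, 4, 5, 6, 7}"
  by auto

lemma UNIV_8: "(UNIV :: 8 set) = {0, 1, 2, 3, 4, 5, 6, 7}"
  by (rule card_subset_eq[symmetric]) simp_all

lemma oct_eq_iff:
  "x = y \<longleftrightarrow> x $ 0 = y $ 0 \<and> x $ 1 = y $ 1 \<and> x $ 2 = y $ 2 \<and> x $ 3 = y $ 3 \<and>
     x $ 4 = y $ 4 \<and> x $ 5 = y $ 5 \<and> x $ 6 = y $ 6 \<and> x $ 7 = y $ 7" for x y :: octonion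
proof -
  have "x = y \<longleftrightarrow> (\<forall>i\<in>UNIV. x $ i = y $ i)"
    by (simp add: vec_eq_iff)
  then show ?thesis
    unfolding UNIV_8 by simp
qed

lemma oct_mult_nth:
  fixes x y :: octonion
  shows
    "(x \<odot> y) $ 0 = x$0*y$0 - x$1*y$1 - x$2*y$2 - x$3*y$3 - x$4*y$4 - x$5*y$5 - x$6*y$6 - x$7*y$7"
    "(x \<odot> y) $ 1 = x$0*y$1 + x$1*y$0 + x$2*y$4 + x$3*y$7 - x$4*y$2 + x$5*y$6 - x$6*y$5 - x$7*y$3"
    "(x \<odot> y) $ 2 = x$0*y$2 - x$1*y$4 + x$2*y$0 + x$3*y$5 + x$4*y$1 - x$5*y$3 + x$6*y$7 - x$7*y$6"
    "(x \<odot> y) $ 3 = x$0*y$3 - x$1*y$7 - x$2*y$5 + x$3*y$0 + x$4*y$6 + x$5*y$2 - x$6*y$4 + x$7*y$1"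
    "(x \<odot> y) $ 4 = x$0*y$4 + x$1*y$2 - x$2*y$1 - x$3*y$6 + x$4*y$0 + x$5*y$7 + x$6*y$3 - x$7*y$5"
    "(x \<odot> y) $ 5 = x$0*y$5 - x$1*y$6 + x$2*y$3 - x$3*y$2 - x$4*y$7 + x$5*y$0 + x$6*y$1 + x$7*y$4"
    "(x \<odot> y) $ 6 = x$0*y$6 + x$1*y$5 - x$2*y$7 + x$3*y$4 - x$4*y$3 - x$5*y$1 + x$6*y$0 + x$7*y$2"
    "(x \<odot> y) $ 7 = x$0*y$7 + x$1*y$3 + x$2*y$6 - x$3*y$1 + x$4*y$5 - x$5*y$4 - x$6*y$2 + x$7*y$0"
  unfolding oct_mult_def lessThan_8
  by (simp_all add: oct_e_mult_def oct_e_def red7_def Let_def axis_def)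

lemma oct_cnj_nth:
  "oct_cnj x $ 0 = x $ 0" "i \<noteq> 0 \<Longrightarrow> oct_cnj x $ i = - x $ i"
  by (simp_all add: oct_cnj_def)

lemma oct_mult_oct_e:
  assumes "i < 8" "j < 8"
  shows "oct_e i \<odot> oct_e j = oct_e_mult i j"
proof -
  have e: "oct_e l $ of_nat k = (if k = l then 1 else 0)" if "k < 8" "l < 8" for k l
  proof -
    have "(\<forall>k\<in>{..<8}. \<forall>l\<in>{..<8}. oct_e l $ of_nat k = (if k = l then 1 else 0))"
      unfolding lessThan_8 by (simp add: oct_e_def axis_def)
    with that show ?thesis by simp
  qed
  have "oct_e i \<odot> oct_e j =
      (\<Sum>k<8. \<Sum>l<8. if l = j then if k = i then oct_e_mult k l else 0 else 0)"
    unfolding oct_mult_def by (intro sum.cong) (use assms in \<open>auto simp: e\<close>)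
  also have "\<dots> = oct_e_mult i j"
    using assms by simp
  finally show ?thesis .
qed

lemma oct_mult_unit: "oct_e 0 \<odot> x = x" "x \<odot> oct_e 0 = x"
  by (simp_all add: oct_eq_iff oct_mult_nth oct_e_def axis_def)

lemma oct_e_square: "i \<in> {1..7} \<Longrightarrow> oct_e i \<odot> oct_e i = - oct_e 0"
  by (simp add: oct_mult_oct_e oct_e_mult_def)

lemma oct_e_anticommute:
  assumes "i \<in> {1..7}" "j \<in> {1..7}" "i \<noteq> j"
  shows "oct_e i \<odot> oct_e j = - (oct_e j \<odot> oct_e i)"
proof -
  have *: "oct_e_mult i j = - oct_e_mult j i" if "i < j" "0 < i" "j < 8" for i j
  proof -
    define d where "d = j - i"
    have j: "j = i + d" using that by (simp add: d_def)
    have "d \<in> {1,2,3,4,5,6}" using that by (auto simp: d_def)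
    moreover have "(j + 7 - i) mod 7 = d mod 7" "(i + 7 - j) mod 7 = (7 - d) mod 7"
      by (simp_all add: j)
    ultimately show ?thesis
      using \<open>0 < i\<close> unfolding oct_e_mult_def Let_def
      by (elim insertE emptyE; simp add: j)
  qed
  have "oct_e_mult i j = - oct_e_mult j i"
  proof (cases "i < j")
    case True
    show ?thesis by (rule *) (use True assms in auto)
  next
    case False
    have "oct_e_mult j i = - oct_e_mult i j" by (rule *) (use False assms in auto)
    then show ?thesis by (simp only: minus_minus)
  qed
  moreover have "i < 8" "j < 8" using assms by auto
  ultimately show ?thesis by (simp only: oct_mult_oct_e)
qed

lemma oct_e_cycle:
  assumes "i \<in> {1..7}"
  shows "oct_e (red7 (1 + i)) \<odot> oct_e (red7 (2 + i)) = oct_e (red7 (4 + i))"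
proof -
  have "i \<in> {1,2,3,4,5,6,7}" using assms by auto
  then show ?thesis
    by (auto simp: oct_mult_oct_e oct_e_mult_def red7_def Let_def)
qed

lemma oct_alternative:
  "(x \<odot> x) \<odot> y = x \<odot> (x \<odot> y)"
  "(y \<odot> x) \<odot> x = y \<odot> (x \<odot> x)"
  unfolding oct_eq_iff oct_mult_nth by (intro conjI; simp only: algebra_simps)+

lemma bilinear_oct_mult: "bilinear (\<odot>)"
  unfolding bilinear_def oct_mult_def
  by (auto intro!: linearI simp: algebra_simps sum.distrib scaleR_sum_right)

lemma inner_oct_nth:
  fixes u v :: octonion
  shows "u \<bullet> v = u$0 * v$0 + u$1 * v$1 + u$2 * v$2 + u$3 * v$3 + u$4 * v$4 + u$5 * v$5 + u$6 * v$6 + u$7 * v$7"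
  unfolding inner_vec_def UNIV_8 by simp

lemma inner_oct: "(u \<bullet> v) *\<^sub>R oct_e 0 = (1/2) *\<^sub>R (u \<odot> oct_cnj v + oct_cnj (u \<odot> oct_cnj v))"
  unfolding inner_oct_nth oct_eq_iff
  by (simp add: oct_mult_nth oct_cnj_nth oct_e_def axis_def)

lemma norm_oct_mult: "(x \<odot> y) \<bullet> (x \<odot> y) = (x \<bullet> x) * (y \<bullet> y)"
  unfolding inner_oct_nth oct_mult_nth by (simp only: algebra_simps)

lemma inner_oct_mult_cnj: "(x \<odot> oct_cnj u) \<bullet> y = x \<bullet> (y \<odot> u)"
  unfolding inner_oct_nth by (simp add: oct_mult_nth oct_cnj_nth algebra_simps)

lemma inner_oct_cnj: "oct_cnj u \<bullet> oct_cnj u = u \<bullet> u"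
  unfolding inner_oct_nth by (simp add: oct_cnj_nth)


section \<open>Alternating forms\<close>

text \<open>
  A \<open>k\<close>-form on \<open>'a\<close> with values in \<open>'b\<close> is a map of sequences \<open>v\<^sub>0, v\<^sub>1, \<dots>\<close> of vectors that
  depends on \<open>v\<^sub>0, \<dots>, v\<^sub>k\<^sub>-\<^sub>1\<close> only and is multilinear and alternating in these.  With values in
  \<open>real\<close> this is \<open>\<And>\<^sup>k V\<^sup>*\<close>, and with values in \<open>octonion\<close> it is \<open>\<O> \<otimes> \<And>\<^sup>k V\<^sup>*\<close>, where \<open>u \<otimes> \<phi>\<close>
  is the map \<open>\<lambda>v. \<phi> v *\<^sub>R u\<close>.
\<close>

definition alt_form ::
    "nat \<Rightarrow> ((nat \<Rightarrow> 'a::real_vector) \<Rightarrow> 'b::real_vector) \<Rightarrow> bool" where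
  "alt_form k \<phi> \<longleftrightarrow>
     (\<forall>v w. (\<forall>i<k. v i = w i) \<longrightarrow> \<phi> v = \<phi> w) \<and>
     (\<forall>v. \<forall>i<k. linear (\<lambda>x. \<phi> (v(i := x)))) \<and>
     (\<forall>v. \<forall>i<k. \<forall>j<k. i \<noteq> j \<and> v i = v j \<longrightarrow> \<phi> v = 0)"

text \<open>
  The exterior product of a \<open>p\<close>-form and a \<open>q\<close>-form whose values are multiplied by \<open>m\<close>, normalised
  such that \<open>(\<phi> \<and> \<psi>) (v, w) = \<phi> v * \<psi> w - \<phi> w * \<psi> v\<close> for real 1-forms.
\<close>

definition wedge_by ::
    "('b \<Rightarrow> 'c \<Rightarrow> 'd::real_vector) \<Rightarrow> nat \<Rightarrow> nat \<Rightarrow>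
     ((nat \<Rightarrow> 'a) \<Rightarrow> 'b) \<Rightarrow> ((nat \<Rightarrow> 'a) \<Rightarrow> 'c) \<Rightarrow> (nat \<Rightarrow> 'a) \<Rightarrow> 'd" where
  "wedge_by m p q \<phi> \<psi> v =
     (1 / (fact p * fact q)) *\<^sub>R
       (\<Sum>\<sigma> | \<sigma> permutes {..<p + q}.
          of_int (sign \<sigma>) *\<^sub>R m (\<phi> (\<lambda>i. v (\<sigma> i))) (\<psi> (\<lambda>i. v (\<sigma> (p + i)))))"

abbreviation rwedge ::
    "nat \<Rightarrow> nat \<Rightarrow> ((nat \<Rightarrow> 'a) \<Rightarrow> real) \<Rightarrow> ((nat \<Rightarrow> 'a) \<Rightarrow> real) \<Rightarrow> (nat \<Rightarrow> 'a) \<Rightarrow> real" where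
  "rwedge \<equiv> wedge_by (*)"

abbreviation owedge ::
    "nat \<Rightarrow> nat \<Rightarrow> ((nat \<Rightarrow> 'a) \<Rightarrow> octonion) \<Rightarrow> ((nat \<Rightarrow> 'a) \<Rightarrow> octonion) \<Rightarrow> (nat \<Rightarrow> 'a) \<Rightarrow> octonion" where
  "owedge \<equiv> wedge_by (\<odot>)"

lemma owedge_tensor:
  "owedge p q (\<lambda>v. \<phi> v *\<^sub>R a) (\<lambda>v. \<psi> v *\<^sub>R b) = (\<lambda>v. rwedge p q \<phi> \<psi> v *\<^sub>R (a \<odot> b))"
  by (auto simp: wedge_by_def fun_eq_iff bilinear_lmul[OF bilinear_oct_mult]
      bilinear_rmul[OF bilinear_oct_mult] scaleR_sum_left scaleR_sum_right sum_divide_distrib mult_ac intro!: sum.cong)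

definition form_cnj :: "((nat \<Rightarrow> 'a) \<Rightarrow> octonion) \<Rightarrow> (nat \<Rightarrow> 'a) \<Rightarrow> octonion" where
  "form_cnj \<phi> v = oct_cnj (\<phi> v)"

text \<open>The identification of real forms with elements of \<open>\<real>1 \<otimes> \<And>V\<^sup>*\<close>.\<close>

definition real_form :: "((nat \<Rightarrow> 'a) \<Rightarrow> real) \<Rightarrow> (nat \<Rightarrow> 'a) \<Rightarrow> octonion" where
  "real_form \<phi> v = \<phi> v *\<^sub>R oct_e 0"

definition pullback :: "('a \<Rightarrow> 'c) \<Rightarrow> ((nat \<Rightarrow> 'c) \<Rightarrow> 'b) \<Rightarrow> (nat \<Rightarrow> 'a) \<Rightarrow> 'b" where
  "pullback g \<phi> v = \<phi> (\<lambda>i. g (v i))"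


section \<open>The group \<open>Spin(9)\<close> and its invariant forms\<close>

type_synonym oct2 = "octonion \<times> octonion"

text \<open>
  The matrix with rows \<open>(R\<^sub>r, R\<^sub>u)\<close> and \<open>(R\<^bsub>cnj u\<^esub>, - R\<^sub>r)\<close> acting on columns,
  where \<open>R\<^sub>u x = x \<odot> u\<close>.
\<close>

definition spin9_gen :: "real \<Rightarrow> octonion \<Rightarrow> oct2 \<Rightarrow> oct2" where
  "spin9_gen r u = (\<lambda>(x, y). (r *\<^sub>R x + y \<odot> u, x \<odot> oct_cnj u - r *\<^sub>R y))"

inductive_set spin9 :: "(oct2 \<Rightarrow> oct2) set" where
  gen: "r\<^sup>2 + u \<bullet> u = 1 \<Longrightarrow> spin9_gen r u \<in> spin9"
| one: "id \<in> spin9"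
| mult: "g \<in> spin9 \<Longrightarrow> h \<in> spin9 \<Longrightarrow> g \<circ> h \<in> spin9"
| inverse: "g \<in> spin9 \<Longrightarrow> inv g \<in> spin9"

lemma spin9_gen_orthogonal:
  assumes "r\<^sup>2 + u \<bullet> u = 1"
  shows "orthogonal_transformation (spin9_gen r u)"
proof -
  have lin: "linear (spin9_gen r u)"
    by (auto intro!: linearI simp: spin9_gen_def algebra_simps bilinear_ladd[OF bilinear_oct_mult]
        bilinear_lmul[OF bilinear_oct_mult])
  have "spin9_gen r u z \<bullet> spin9_gen r u z = (r\<^sup>2 + u \<bullet> u) * (z \<bullet> z)" for z
  proof (cases z)
    case (Pair x y)
    define p q where "p = y \<odot> u" and "q = x \<odot> oct_cnj u"
    have pq: "p \<bullet> p = (y \<bullet> y) * (u \<bullet> u)" "q \<bullet> q = (x \<bullet> x) * (u \<bullet> u)" "q \<bullet> y = x \<bullet> p"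
      by (simp_all only: p_def q_def norm_oct_mult inner_oct_cnj inner_oct_mult_cnj)
    have "spin9_gen r u z \<bullet> spin9_gen r u z =
        (r *\<^sub>R x + p) \<bullet> (r *\<^sub>R x + p) + (q - r *\<^sub>R y) \<bullet> (q - r *\<^sub>R y)"
      by (simp add: Pair spin9_gen_def p_def q_def)
    also have "\<dots> = r\<^sup>2 * (x \<bullet> x) + 2 * r * (x \<bullet> p) + p \<bullet> p + q \<bullet> q - 2 * r * (q \<bullet> y) + r\<^sup>2 * (y \<bullet> y)"
      by (simp add: inner_left_distrib inner_right_distrib inner_diff_left inner_diff_right
          inner_commute[of p x] inner_commute[of y q] power2_eq_square
          right_diff_distrib distrib_left)
    also have "\<dots> = (r\<^sup>2 + u \<bullet> u) * (x \<bullet> x + y \<bullet> y)"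
      unfolding pq by (simp add: distrib_left distrib_right mult_ac)
    finally show ?thesis by (simp add: Pair)
  qed
  then show ?thesis
    using lin assms by (simp add: orthogonal_transformation norm_eq_sqrt_inner)
qed

lemma spin9_orthogonal: "g \<in> spin9 \<Longrightarrow> orthogonal_transformation g"
proof (induction rule: spin9.induct)
  case one
  show ?case by (simp add: id_def orthogonal_transformation_id)
next
  case (gen r u)
  then show ?case by (rule spin9_gen_orthogonal)
next
  case (mult g h)
  then show ?case by (intro orthogonal_transformation_compose)
next
  case (inverse g)
  then show ?case by (intro orthogonal_transformation_inv)
qed

definition spin9_invariant_forms :: "nat \<Rightarrow> ((nat \<Rightarrow> oct2) \<Rightarrow> real) set" where
  "spin9_invariant_forms k = {\<phi>. alt_form k \<phi> \<and> (\<forall>g\<in>spin9. pullback g \<phi> = \<phi>)}"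


section \<open>The coordinate forms and the form \<open>\<Psi>\<^sub>8\<close>\<close>

definition dx :: "(nat \<Rightarrow> oct2) \<Rightarrow> octonion" where
  "dx v = fst (v 0)"

definition dy :: "(nat \<Rightarrow> oct2) \<Rightarrow> octonion" where
  "dy v = snd (v 0)"

lemma dx_dy_expand:
  "dx v = (\<Sum>i<8. (fst (v 0) $ of_nat i) *\<^sub>R oct_e i)"
  "dy v = (\<Sum>i<8. (snd (v 0) $ of_nat i) *\<^sub>R oct_e i)"
  unfolding dx_def dy_def lessThan_8 by (simp_all add: oct_eq_iff oct_e_def axis_def)

definition Psi40 :: "(nat \<Rightarrow> oct2) \<Rightarrow> octonion" where
  "Psi40 = owedge 3 1 (owedge 2 1 (owedge 1 1 (form_cnj dx) dx) (form_cnj dx)) dx"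

definition Psi31 :: "(nat \<Rightarrow> oct2) \<Rightarrow> octonion" where
  "Psi31 = owedge 3 1 (owedge 2 1 (owedge 1 1 (form_cnj dy) dx) (form_cnj dx)) dx"

definition Psi13 :: "(nat \<Rightarrow> oct2) \<Rightarrow> octonion" where
  "Psi13 = owedge 3 1 (owedge 2 1 (owedge 1 1 (form_cnj dx) dy) (form_cnj dy)) dy"

definition Psi04 :: "(nat \<Rightarrow> oct2) \<Rightarrow> octonion" where
  "Psi04 = owedge 3 1 (owedge 2 1 (owedge 1 1 (form_cnj dy) dy) (form_cnj dy)) dy"

definition Psi8 :: "(nat \<Rightarrow> oct2) \<Rightarrow> octonion" where
  "Psi8 v =
     owedge 4 4 Psi40 (form_cnj Psi40) v
     + 4 *\<^sub>R owedge 4 4 Psi31 (form_cnj Psi31) v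
     - 5 *\<^sub>R (owedge 4 4 Psi31 Psi13 v + owedge 4 4 (form_cnj Psi13) (form_cnj Psi31) v)
     + 4 *\<^sub>R owedge 4 4 Psi13 (form_cnj Psi13) v
     + owedge 4 4 Psi04 (form_cnj Psi04) v"

end

theory Submission
  imports Defs
begin

text \<open>
  The form \<open>Psi8\<close> is real, and its real part is visibly invariant under the group generated by
  \<open>diag(R\<^sub>u, R\<^sub>u)\<close> for imaginary units \<open>u\<close> (a copy of \<open>Spin(7)\<close>), by \<open>diag(1, -1)\<close> and by the
  exchange of \<open>x\<close> and \<open>y\<close>: by the Moufang identities each \<open>\<Psi>\<^sub>p\<^sub>q\<close> is merely conjugated by \<open>u\<close>.
  The group contains enough signed permutations of the standard basis that an invariant 8-form is
  determined by nine of its coefficients.  For a \<open>Spin(9)\<close>-invariant form, differentiating along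
  two of the remaining one-parameter subgroups yields eight linear relations, which leave the nine
  coefficients proportional to \<open>14, 2, -2, 2, -2, 0, 1, 1, 1\<close>.  Those of \<open>Psi8\<close> are 2880 times
  these numbers.
\<close>

section \<open>Alternating forms and shuffles\<close>

text \<open>A non-zero invariant \<open>\<Psi>\<close> is given, so invariance of
  \<open>Psi8\<close> under all of \<open>spin9\<close> never has to be verified, only enough
  symmetry to compare it with \<open>\<Psi>\<close>. This matters because no single summand of
  \<open>Psi8\<close> is invariant: each is homogeneous in \<open>dx\<close> and in
  \<open>dy\<close>, whereas the rotations mixing \<open>x\<close> and \<open>y\<close> change these
  degrees. The size of the comparison shapes the rest. An 8-form on a 16-dimensional space has 12870
  coefficients, and the exterior product is defined by a sum over 8! permutations. Against the
  first, only maps that send basis vectors to signed basis vectors are used, because they turn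
  invariance into relations between single coefficients with integer factors. Against the second,
  products are expanded over the 70 shuffles, and values are kept as integer combinations of the
  \<open>oct_e k\<close>. The same relations show that invariant forms are unique up to
  scale.\<close>

lemma alt_form_cong: "alt_form k \<phi> \<Longrightarrow> (\<And>i. i < k \<Longrightarrow> v i = w i) \<Longrightarrow> \<phi> v = \<phi> w"
  by (simp add: alt_form_def)

lemma alt_form_linear: "alt_form k \<phi> \<Longrightarrow> i < k \<Longrightarrow> linear (\<lambda>x. \<phi> (v(i := x)))"
  by (simp add: alt_form_def)

lemma alt_form_zero: "alt_form k \<phi> \<Longrightarrow> i < k \<Longrightarrow> j < k \<Longrightarrow> i \<noteq> j \<Longrightarrow> v i = v j \<Longrightarrow> \<phi> v = 0"
  unfolding alt_form_def by blast

lemma alt_form_transpose: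
  assumes \<phi>: "alt_form k \<phi>" and ij: "i < k" "j < k" "i \<noteq> j"
  shows "\<phi> (v \<circ> Transposition.transpose i j) = - \<phi> v"
proof -
  define F where "F x y = \<phi> (v(i := x, j := y))" for x y
  have z: "F x x = 0" for x
    unfolding F_def by (rule alt_form_zero[OF \<phi> ij]) (use ij in auto)
  have l: "linear (\<lambda>x. F x y)" "linear (\<lambda>y. F x y)" for x y
    using alt_form_linear[OF \<phi> ij(1), of "v(j := y)"] alt_form_linear[OF \<phi> ij(2), of "v(i := x)"]
    unfolding F_def by (simp_all only: fun_upd_twist[OF ij(3)])
  have "F (v i + v j) (v i + v j) = F (v i) (v i) + F (v i) (v j) + F (v j) (v i) + F (v j) (v j)"
    by (simp add: linear_add[OF l(1)] linear_add[OF l(2)])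
  then have "F (v j) (v i) = - F (v i) (v j)"
    unfolding z by (simp add: eq_neg_iff_add_eq_0 add.commute)
  moreover have "v(i := v j, j := v i) = v \<circ> Transposition.transpose i j" "v(i := v i, j := v j) = v"
    by (auto simp: fun_eq_iff Transposition.transpose_def)
  ultimately show ?thesis by (simp add: F_def)
qed

lemma alt_form_permute:
  assumes \<phi>: "alt_form k \<phi>" and "\<sigma> permutes {..<k}"
  shows "\<phi> (v \<circ> \<sigma>) = of_int (sign \<sigma>) *\<^sub>R \<phi> v"
  using assms(2) finite_lessThan
proof (induction arbitrary: v rule: permutes_induct)
  case id
  then show ?case by (simp add: sign_id)
next
  case (swap a b p)
  have "permutation p" using swap by (auto simp: permutation_permutes)
  have "\<phi> (v \<circ> (Transposition.transpose a b \<circ> p)) = of_int (sign p) *\<^sub>R \<phi> (v \<circ> Transposition.transpose a b)"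
    using swap.IH[of "v \<circ> Transposition.transpose a b"] by (simp only: comp_assoc)
  also have "\<phi> (v \<circ> Transposition.transpose a b) = - \<phi> v"
    using swap by (intro alt_form_transpose[OF \<phi>]) auto
  also have "of_int (sign p) *\<^sub>R - \<phi> v = of_int (sign (Transposition.transpose a b \<circ> p)) *\<^sub>R \<phi> v"
    using swap.hyps \<open>permutation p\<close>
    by (subst sign_compose) (simp_all add: sign_swap_id permutation_swap_id)
  finally show ?case .
qed

text \<open>In each summand the argument \<open>v i\<close> sits at the single position
  \<open>inv \<sigma> i\<close>, so only one factor varies with it, and linearly. If
  \<open>v i = v j\<close>, composing \<open>\<sigma>\<close> with the transposition of
  \<open>i\<close> and \<open>j\<close> reverses the sign of the summand and leaves its factors
  alone, so the sum is its own negative.\<close>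

lemma alt_form_wedge_by:
  fixes \<phi> :: "(nat \<Rightarrow> 'a::real_vector) \<Rightarrow> 'b::real_vector" and \<psi> :: "(nat \<Rightarrow> 'a) \<Rightarrow> 'c::real_vector"
  assumes m: "bilinear m" and \<phi>: "alt_form p \<phi>" and \<psi>: "alt_form q \<psi>"
  shows "alt_form (p + q) (wedge_by m p q \<phi> \<psi>)"
  unfolding alt_form_def
proof (intro conjI allI impI)
  fix v w :: "nat \<Rightarrow> 'a"
  assume vw: "\<forall>i<p + q. v i = w i"
  show "wedge_by m p q \<phi> \<psi> v = wedge_by m p q \<phi> \<psi> w"
    unfolding wedge_by_def
  proof (intro arg_cong2[where f = "(*\<^sub>R)"] refl sum.cong, goal_cases)
    case (1 \<sigma>)
    then have s: "\<sigma> i < p + q" if "i < p + q" for i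
      using permutes_in_image[of \<sigma> "{..<p+q}" i] that by auto
    have "\<phi> (\<lambda>i. v (\<sigma> i)) = \<phi> (\<lambda>i. w (\<sigma> i))"
      by (rule alt_form_cong[OF \<phi>]) (use s vw in auto)
    moreover have "\<psi> (\<lambda>i. v (\<sigma> (p + i))) = \<psi> (\<lambda>i. w (\<sigma> (p + i)))"
      by (rule alt_form_cong[OF \<psi>]) (use s vw in auto)
    ultimately show ?case by simp
  qed
next
  fix v :: "nat \<Rightarrow> 'a" and i
  assume i: "i < p + q"
  have "linear (\<lambda>x. m (\<phi> (\<lambda>j. (v(i := x)) (\<sigma> j))) (\<psi> (\<lambda>j. (v(i := x)) (\<sigma> (p + j)))))"
    if "\<sigma> permutes {..<p + q}" for \<sigma>
  proof -
    define j where "j = inv \<sigma> i"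
    have j: "\<sigma> j = i" "j < p + q" "\<And>l. \<sigma> l = i \<longleftrightarrow> l = j"
      using that i permutes_in_image[of "inv \<sigma>" "{..<p+q}" i]
      by (auto simp: j_def permutes_inverses permutes_inv)
    show ?thesis
    proof (cases "j < p")
      case True
      have "(\<lambda>l. (v(i := x)) (\<sigma> l)) = (\<lambda>l. v (\<sigma> l))(j := x)" for x
        by (auto simp: j fun_eq_iff)
      moreover have "(\<lambda>l. (v(i := x)) (\<sigma> (p + l))) = (\<lambda>l. v (\<sigma> (p + l)))" for x
        using True by (auto simp: j fun_eq_iff)
      moreover have "linear (\<lambda>x. m (\<phi> ((\<lambda>l. v (\<sigma> l))(j := x))) b)" for b
        using linear_compose[OF alt_form_linear[OF \<phi> True, of "\<lambda>l. v (\<sigma> l)"], of "\<lambda>y. m y b"] m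
        by (simp add: bilinear_def o_def)
      ultimately show ?thesis by (simp del: fun_upd_apply)
    next
      case False
      then have jp: "j = p + (j - p)" "j - p < q" using j by auto
      have "(\<lambda>l. (v(i := x)) (\<sigma> (p + l))) = (\<lambda>l. v (\<sigma> (p + l)))(j - p := x)" for x
        using jp by (auto simp: j fun_eq_iff)
      moreover have "\<phi> (\<lambda>l. (v(i := x)) (\<sigma> l)) = \<phi> (\<lambda>l. v (\<sigma> l))" for x
        using False by (intro alt_form_cong[OF \<phi>]) (auto simp: j)
      moreover have "linear (\<lambda>x. m b (\<psi> ((\<lambda>l. v (\<sigma> (p + l)))(j - p := x))))" for b
        using linear_compose[OF alt_form_linear[OF \<psi> jp(2), of "\<lambda>l. v (\<sigma> (p + l))"], of "m b"] m
        by (simp add: bilinear_def o_def)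
      ultimately show ?thesis by (simp del: fun_upd_apply)
    qed
  qed
  then show "linear (\<lambda>x. wedge_by m p q \<phi> \<psi> (v(i := x)))"
    unfolding wedge_by_def
    by (intro linear_compose_scale_right linear_compose_sum ballI) auto
next
  fix v :: "nat \<Rightarrow> 'a" and i j
  assume i: "i < p + q" and j: "j < p + q" and ij: "i \<noteq> j \<and> v i = v j"
  let ?f = "\<lambda>\<sigma>. of_int (sign \<sigma>) *\<^sub>R m (\<phi> (\<lambda>i. v (\<sigma> i))) (\<psi> (\<lambda>i. v (\<sigma> (p + i))))"
  have t: "Transposition.transpose i j permutes {..<p + q}" using i j by (simp add: permutes_swap_id)
  have vt: "v (Transposition.transpose i j l) = v l" for l using ij by (auto simp: Transposition.transpose_def)
  have "sum ?f {\<sigma>. \<sigma> permutes {..<p + q}} = (\<Sum>\<sigma> | \<sigma> permutes {..<p + q}. ?f (Transposition.transpose i j \<circ> \<sigma>))"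
    by (rule setum_permutations_compose_left[OF t])
  also have "\<dots> = (\<Sum>\<sigma> | \<sigma> permutes {..<p + q}. - ?f \<sigma>)"
  proof (intro sum.cong refl)
    fix \<sigma> assume "\<sigma> \<in> {\<sigma>. \<sigma> permutes {..<p + q}}"
    then have "permutation \<sigma>" by (auto simp: permutation_permutes)
    then show "?f (Transposition.transpose i j \<circ> \<sigma>) = - ?f \<sigma>"
      using ij by (simp add: sign_compose permutation_swap_id sign_swap_id vt)
  qed
  finally have "sum ?f {\<sigma>. \<sigma> permutes {..<p + q}} = - sum ?f {\<sigma>. \<sigma> permutes {..<p + q}}"
    by (simp only: sum_negf)
  then have "sum ?f {\<sigma>. \<sigma> permutes {..<p + q}} = 0"
    by (simp only: eq_neg_iff_add_eq_0 scaleR_2[symmetric]) simp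
  then show "wedge_by m p q \<phi> \<psi> v = 0" by (simp add: wedge_by_def)
qed

text \<open>Carries a symmetry through one product at a time: \<open>f\<close> and \<open>h\<close>
  describe how the factors change, \<open>l\<close> how the product changes in consequence. Repeated
  use treats the fourfold products.\<close>

lemma wedge_by_equivariant:
  assumes "\<And>v. \<phi> (\<lambda>i. g (v i)) = f (\<phi>' v)" "\<And>v. \<psi> (\<lambda>i. g (v i)) = h (\<psi>' v)"
    and "\<And>a b. m (f a) (h b) = l (m' a b)" and l: "linear l"
  shows "wedge_by m p q \<phi> \<psi> (\<lambda>i. g (v i)) = l (wedge_by m' p q \<phi>' \<psi>' v)"
  by (simp add: wedge_by_def assms linear_scale[OF l] linear_sum[OF l])

text \<open>The sign of the block exchange is \<open>(- 1)\<^sup>p\<^sup>q = 1\<close> for \<open>p = q = 4\<close>.\<close>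

lemma wedge_by_commute_4_4:
  fixes \<phi> :: "(nat \<Rightarrow> 'a::real_vector) \<Rightarrow> 'b::real_vector" and \<psi> :: "(nat \<Rightarrow> 'a) \<Rightarrow> 'c::real_vector"
  assumes "alt_form 4 \<phi>" "alt_form 4 \<psi>"
  shows "wedge_by m 4 4 \<phi> \<psi> = wedge_by (\<lambda>a b. m b a) 4 4 \<psi> \<phi>"
proof
  fix v :: "nat \<Rightarrow> 'a"
  define \<tau> :: "nat \<Rightarrow> nat" where
    "\<tau> = Transposition.transpose 0 4 \<circ> Transposition.transpose 1 5 \<circ> Transposition.transpose 2 6 \<circ> Transposition.transpose 3 7"
  have \<tau>: "\<tau> permutes {..<4 + 4}"
    unfolding \<tau>_def by (intro permutes_compose permutes_swap_id) auto
  have sg: "sign \<tau> = 1"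
    unfolding \<tau>_def by (simp add: sign_compose sign_swap_id permutation_swap_id permutation_compose)
  have t: "\<tau> i = 4 + i" "\<tau> (4 + i) = i" if "i < 4" for i
  proof -
    have "i \<in> {0, 1, 2, 3}" using that by auto
    then show "\<tau> i = 4 + i" "\<tau> (4 + i) = i" by (auto simp: \<tau>_def Transposition.transpose_def)
  qed
  let ?f = "\<lambda>\<sigma>. of_int (sign \<sigma>) *\<^sub>R m (\<phi> (\<lambda>i. v (\<sigma> i))) (\<psi> (\<lambda>i. v (\<sigma> (4 + i))))"
  let ?g = "\<lambda>\<sigma>. of_int (sign \<sigma>) *\<^sub>R m (\<phi> (\<lambda>i. v (\<sigma> (4 + i)))) (\<psi> (\<lambda>i. v (\<sigma> i)))"
  have "sum ?f {\<sigma>. \<sigma> permutes {..<4 + 4}} = (\<Sum>\<sigma> | \<sigma> permutes {..<4 + 4}. ?f (\<sigma> \<circ> \<tau>))"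
    by (rule sum_permutations_compose_right[OF \<tau>])
  also have "\<dots> = sum ?g {\<sigma>. \<sigma> permutes {..<4 + 4}}"
  proof (intro sum.cong refl)
    fix \<sigma> :: "nat \<Rightarrow> nat" assume "\<sigma> \<in> {\<sigma>. \<sigma> permutes {..<4 + 4}}"
    then have "permutation \<sigma>" "permutation \<tau>" using \<tau> permutation_permutes by blast+
    moreover have "\<phi> (\<lambda>i. v ((\<sigma> \<circ> \<tau>) i)) = \<phi> (\<lambda>i. v (\<sigma> (4 + i)))"
      by (rule alt_form_cong[OF assms(1)]) (simp add: t)
    moreover have "\<psi> (\<lambda>i. v ((\<sigma> \<circ> \<tau>) (4 + i))) = \<psi> (\<lambda>i. v (\<sigma> i))"
      by (rule alt_form_cong[OF assms(2)]) (simp add: t)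
    ultimately show "?f (\<sigma> \<circ> \<tau>) = ?g \<sigma>"
      by (simp add: sign_compose sg)
  qed
  finally show "wedge_by m 4 4 \<phi> \<psi> v = wedge_by (\<lambda>a b. m b a) 4 4 \<psi> \<phi> v"
    by (simp add: wedge_by_def)
qed

section \<open>Shuffle expansion of the exterior product\<close>

definition cyc :: "nat \<Rightarrow> nat \<Rightarrow> nat \<Rightarrow> nat" where
  "cyc a r i = (if i = a + r then a else if a \<le> i \<and> i < a + r then Suc i else i)"

lemma cyc_Suc: "cyc a (Suc r) = Transposition.transpose a (a + Suc r) \<circ> cyc a r"
  by (auto simp: fun_eq_iff cyc_def Transposition.transpose_def)

lemma cyc_0: "cyc a 0 = id"
  by (auto simp: fun_eq_iff cyc_def)

lemma cyc_permutes: "cyc a r permutes {a..a + r}"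
proof (induction r)
  case 0
  then show ?case unfolding cyc_0 by (rule permutes_id)
next
  case (Suc r)
  have "cyc a r permutes {a..a + Suc r}"
    by (rule permutes_subset[OF Suc]) auto
  then show ?case
    unfolding cyc_Suc by (rule permutes_compose) (simp add: permutes_swap_id)
qed

lemma sign_cyc: "sign (cyc a r) = (- 1) ^ r"
proof (induction r)
  case (Suc r)
  have "permutation (cyc a r)"
    using cyc_permutes permutation_permutes by blast
  then show ?case
    unfolding cyc_Suc by (subst sign_compose) (simp_all add: permutation_swap_id sign_swap_id Suc)
qed (simp add: cyc_0 sign_id)

text \<open>Passing to inverses moves the transposition of
  \<open>sum_over_permutations_insert\<close> to the right. There it acts on positions:
  \<open>b\<close> is the position at which the new point \<open>a\<close> appears.\<close>

lemma sum_permutes_insert_right: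
  assumes "finite S" "a \<notin> S"
  shows "sum f {p. p permutes insert a S} =
    (\<Sum>b\<in>insert a S. \<Sum>q | q permutes S. f (q \<circ> Transposition.transpose a b))"
proof -
  have i: "inv (Transposition.transpose a b \<circ> p) = inv p \<circ> Transposition.transpose a b"
    if "p permutes S" for b p
    using permutes_bij[OF that] by (simp add: o_inv_distrib)
  have "sum f {p. p permutes insert a S} = (\<Sum>p | p permutes insert a S. f (inv p))"
    by (rule sum_permutations_inverse)
  also have "\<dots> = (\<Sum>b\<in>insert a S. \<Sum>q | q permutes S. f (inv (Transposition.transpose a b \<circ> q)))"
    by (rule sum_over_permutations_insert[OF assms])
  also have "\<dots> = (\<Sum>b\<in>insert a S. \<Sum>q | q permutes S. f (inv q \<circ> Transposition.transpose a b))"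
    by (intro sum.cong refl) (simp add: i)
  also have "\<dots> = (\<Sum>b\<in>insert a S. \<Sum>q | q permutes S. f (q \<circ> Transposition.transpose a b))"
    by (intro sum.cong refl sum_permutations_inverse[symmetric])
  finally show ?thesis .
qed

text \<open>
  The exterior product without its normalising factor, for which splitting off the last vector
  needs no division.
\<close>

definition wedge_sum where
  "wedge_sum m p q \<phi> \<psi> v =
     (\<Sum>\<sigma> | \<sigma> permutes {..<p + q :: nat}.
        real_of_int (sign \<sigma>) *\<^sub>R (m (\<phi> (\<lambda>i. v (\<sigma> i))) (\<psi> (\<lambda>i. v (\<sigma> (p + i)))) :: 'd::real_vector))"

lemma wedge_by_eq_wedge_sum:
  "wedge_by m p q \<phi> \<psi> v = (1 / (fact p * fact q)) *\<^sub>R wedge_sum m p q \<phi> \<psi> v"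
  by (simp add: wedge_by_def wedge_sum_def)

text \<open>Interior product with \<open>w\<close>, taken in the last slot so that the other
  arguments keep their positions.\<close>

definition insert_last :: "nat \<Rightarrow> 'a \<Rightarrow> ((nat \<Rightarrow> 'a) \<Rightarrow> 'b) \<Rightarrow> (nat \<Rightarrow> 'a) \<Rightarrow> 'b" where
  "insert_last k w \<phi> v = \<phi> (v(k := w))"

lemma alt_form_insert_last:
  assumes \<phi>: "alt_form (Suc k) \<phi>"
  shows "alt_form k (insert_last k w \<phi>)"
  unfolding alt_form_def insert_last_def
proof (intro conjI allI impI)
  show "\<phi> (v(k := w)) = \<phi> (v'(k := w))" if "\<forall>i<k. v i = v' i" for v v'
    by (rule alt_form_cong[OF \<phi>]) (use that in auto)
  show "linear (\<lambda>x. \<phi> (v(i := x, k := w)))" if "i < k" for v i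
  proof -
    have "v(i := x, k := w) = v(k := w, i := x)" for x
      using that by (auto simp: fun_eq_iff)
    then show ?thesis
      using alt_form_linear[OF \<phi>, of i "v(k := w)"] that by simp
  qed
  show "\<phi> (v(k := w)) = 0" if "i < k" "j < k" "i \<noteq> j \<and> v i = v j" for v i j
    by (rule alt_form_zero[OF \<phi>, of i j]) (use that in auto)
qed

text \<open>The permutations are sorted by the position at which the last argument
  \<open>v N\<close> appears. By alternation all \<open>q\<close> positions in the second block
  contribute equally, and so do all \<open>p\<close> positions in the first block; from the latter
  the argument passes the second block at the cost of \<open>(- 1) ^ q\<close>.\<close>

lemma wedge_sum_last:
  fixes \<phi> :: "(nat \<Rightarrow> 'a::real_vector) \<Rightarrow> 'b::real_vector" and \<psi> :: "(nat \<Rightarrow> 'a) \<Rightarrow> 'c::real_vector"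
  assumes m: "bilinear m" and \<phi>: "alt_form p \<phi>" and \<psi>: "alt_form q \<psi>" and pq: "p + q = Suc N"
  shows "wedge_sum m p q \<phi> \<psi> v =
    real q *\<^sub>R wedge_sum m p (q - 1) \<phi> (insert_last (q - 1) (v N) \<psi>) v +
    (real p * (- 1) ^ q) *\<^sub>R wedge_sum m (p - 1) q (insert_last (p - 1) (v N) \<phi>) \<psi> v"
proof -
  let ?t = "Transposition.transpose"
  define f where "f \<sigma> = real_of_int (sign \<sigma>) *\<^sub>R m (\<phi> (\<lambda>i. v (\<sigma> i))) (\<psi> (\<lambda>i. v (\<sigma> (p + i))))" for \<sigma>
  have m_minus: "m (- a) b = - m a b" "m a (- b) = - m a b" for a b
    using bilinear_lneg[OF m] bilinear_rneg[OF m] by auto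
  \<comment> \<open>Inside a block the sign of the transposition and that of the alternating factor
    cancel.\<close>
  have inv1: "f (\<sigma> \<circ> ?t i j) = f \<sigma>" if "permutation \<sigma>" "i < p" "j < p" "i \<noteq> j" for \<sigma> i j
  proof -
    have "\<phi> (\<lambda>l. v ((\<sigma> \<circ> ?t i j) l)) = - \<phi> (\<lambda>l. v (\<sigma> l))"
      using alt_form_transpose[OF \<phi> that(2-4), of "\<lambda>l. v (\<sigma> l)"] by (simp add: o_def)
    moreover have "\<psi> (\<lambda>l. v ((\<sigma> \<circ> ?t i j) (p + l))) = \<psi> (\<lambda>l. v (\<sigma> (p + l)))"
      using that by (simp add: Transposition.transpose_def)
    ultimately show ?thesis
      using that by (simp add: f_def sign_compose permutation_swap_id sign_swap_id m_minus)
  qed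
  have inv2: "f (\<sigma> \<circ> ?t (p + i) (p + j)) = f \<sigma>" if "permutation \<sigma>" "i < q" "j < q" "i \<noteq> j" for \<sigma> i j
  proof -
    have "(\<lambda>l. v ((\<sigma> \<circ> ?t (p + i) (p + j)) (p + l))) = (\<lambda>l. v (\<sigma> (p + l))) \<circ> ?t i j"
      by (auto simp: Transposition.transpose_def fun_eq_iff)
    then have "\<psi> (\<lambda>l. v ((\<sigma> \<circ> ?t (p + i) (p + j)) (p + l))) = - \<psi> (\<lambda>l. v (\<sigma> (p + l)))"
      using alt_form_transpose[OF \<psi> that(2-4), of "\<lambda>l. v (\<sigma> (p + l))"] by simp
    moreover have "\<phi> (\<lambda>l. v ((\<sigma> \<circ> ?t (p + i) (p + j)) l)) = \<phi> (\<lambda>l. v (\<sigma> l))"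
      by (rule alt_form_cong[OF \<phi>]) (auto simp: Transposition.transpose_def)
    ultimately show ?thesis
      using that by (simp add: f_def sign_compose permutation_swap_id sign_swap_id m_minus)
  qed
  let ?P = "{\<sigma>. \<sigma> permutes {..<N}}"
  have perm: "permutation \<sigma>" "\<sigma> N = N" if "\<sigma> \<in> ?P" for \<sigma>
    using that permutation_permutes[of \<sigma>] by (auto simp: permutes_def)
  have right: "(\<Sum>\<sigma>\<in>?P. f (\<sigma> \<circ> ?t N j)) = wedge_sum m p (q - 1) \<phi> (insert_last (q - 1) (v N) \<psi>) v"
    if j: "j \<in> {p..<p + q}" for j
  proof -
    obtain r where q: "q = Suc r" using j by (cases q) auto
    then have N: "N = p + r" using pq by simp
    have "f (\<sigma> \<circ> ?t N j) = real_of_int (sign \<sigma>) *\<^sub>R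
        m (\<phi> (\<lambda>i. v (\<sigma> i))) (insert_last r (v N) \<psi> (\<lambda>i. v (\<sigma> (p + i))))" if "\<sigma> \<in> ?P" for \<sigma>
    proof -
      have "f (\<sigma> \<circ> ?t N j) = f \<sigma>"
        using inv2[OF perm(1)[OF that], of r "j - p"] j by (cases "j = N") (auto simp: N q)
      moreover have "\<psi> (\<lambda>i. v (\<sigma> (p + i))) = insert_last r (v N) \<psi> (\<lambda>i. v (\<sigma> (p + i)))"
        unfolding insert_last_def
        by (rule alt_form_cong[OF \<psi>]) (use perm(2)[OF that] N in auto)
      ultimately show ?thesis by (simp add: f_def)
    qed
    then show ?thesis
      by (simp add: wedge_sum_def q N)
  qed
  have left: "(\<Sum>\<sigma>\<in>?P. f (\<sigma> \<circ> ?t N j)) =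
      ((- 1) ^ q) *\<^sub>R wedge_sum m (p - 1) q (insert_last (p - 1) (v N) \<phi>) \<psi> v"
    if j: "j < p" for j
  proof -
    obtain a where p: "p = Suc a" using j by (cases p) auto
    then have N: "N = a + q" using pq by simp
    \<comment> \<open>Every position of the first block is equivalent to its last one,
      \<open>a\<close>. For \<open>q = 0\<close> the position \<open>N\<close> is \<open>a\<close>
      itself, so that the exchange of \<open>N\<close> and \<open>j\<close> stays inside the
      block.\<close>
    have "(\<Sum>\<sigma>\<in>?P. f (\<sigma> \<circ> ?t N j)) = (\<Sum>\<sigma>\<in>?P. f (\<sigma> \<circ> ?t N a))"
    proof (cases "j = a")
      case False
      show ?thesis
      proof (cases "q = 0")
        case True
        then show ?thesis
          using inv1[OF perm(1), of _ N j] j p N False by simp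
      next
        case q0: False
        have jN: "j < N" "a < N" using j p N q0 by auto
        have "f (\<sigma> \<circ> ?t j a \<circ> ?t N j) = f (\<sigma> \<circ> ?t N a)" if "\<sigma> \<in> ?P" for \<sigma>
        proof -
          have "\<sigma> \<circ> ?t j a \<circ> ?t N j = \<sigma> \<circ> ?t N a \<circ> ?t j a"
            using jN False by (auto simp: fun_eq_iff Transposition.transpose_def)
          moreover have "permutation (\<sigma> \<circ> ?t N a)"
            using perm(1)[OF that] by (intro permutation_compose permutation_swap_id)
          ultimately show ?thesis
            using inv1[of "\<sigma> \<circ> ?t N a" j a] j p False by simp
        qed
        moreover have "?t j a permutes {..<N}"
          using jN by (simp add: permutes_swap_id)
        ultimately show ?thesis
          using sum_permutations_compose_right[of "?t j a" "{..<N}" "\<lambda>\<sigma>. f (\<sigma> \<circ> ?t N j)"] by simp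
      qed
    qed simp
    also have "\<dots> = ((- 1) ^ q) *\<^sub>R wedge_sum m a q (insert_last a (v N) \<phi>) \<psi> v"
    proof -
      define g where "g \<rho> = real_of_int (sign \<rho>) *\<^sub>R
        m (insert_last a (v N) \<phi> (\<lambda>i. v (\<rho> i))) (\<psi> (\<lambda>i. v (\<rho> (a + i))))" for \<rho>
      \<comment> \<open>With \<open>v N\<close> at position \<open>a\<close>, the second block reads
        the positions \<open>a + 1, ..., N - 1\<close> and then \<open>a\<close>. The cycle
        \<open>\<kappa>\<close> lists them in this order from \<open>a\<close> on; its sign
        \<open>(- 1) ^ (q - 1)\<close> and that of the transposition give \<open>(- 1) ^ q\<close>.
        For \<open>q = 0\<close> both permutations are trivial.\<close>
      obtain \<kappa> where \<kappa>: "\<kappa> permutes {..<N}" "sign (?t N a) * sign \<kappa> = (- 1) ^ q"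
        "\<And>i. i < a \<Longrightarrow> \<kappa> i = i" "\<And>i. i < q \<Longrightarrow> \<kappa> (a + i) = ?t N a (p + i)"
      proof (cases q)
        case 0
        then show thesis using N by (intro that[of id]) (auto simp: permutes_id sign_id)
      next
        case (Suc r)
        show thesis
        proof (rule that[of "cyc a r"])
          show "cyc a r permutes {..<N}"
            by (rule permutes_subset[OF cyc_permutes]) (use N Suc in auto)
          show "sign (?t N a) * sign (cyc a r) = (- 1) ^ q"
            using N Suc by (simp add: sign_cyc sign_swap_id)
          show "cyc a r i = i" if "i < a" for i
            using that by (simp add: cyc_def)
          show "cyc a r (a + i) = ?t N a (p + i)" if "i < q" for i
            using that N Suc p by (auto simp: cyc_def Transposition.transpose_def)
        qed
      qed
      have "f (\<sigma> \<circ> ?t N a) = (- 1) ^ q *\<^sub>R g (\<sigma> \<circ> \<kappa>)" if "\<sigma> \<in> ?P" for \<sigma>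
      proof -
        have "permutation \<kappa>" using \<kappa>(1) permutation_permutes by blast
        then have "sign (\<sigma> \<circ> ?t N a) = (- 1) ^ q * sign (\<sigma> \<circ> \<kappa>)"
          using perm(1)[OF that] arg_cong[OF \<kappa>(2), of "\<lambda>s. s * sign \<kappa>"]
          by (simp add: sign_compose permutation_swap_id mult.assoc mult.commute mult.left_commute)
        moreover have "\<phi> (\<lambda>i. v ((\<sigma> \<circ> ?t N a) i)) = insert_last a (v N) \<phi> (\<lambda>i. v ((\<sigma> \<circ> \<kappa>) i))"
          unfolding insert_last_def
          by (rule alt_form_cong[OF \<phi>])
            (use perm(2)[OF that] p N \<kappa>(3) in \<open>auto simp: Transposition.transpose_def\<close>)
        moreover have "\<psi> (\<lambda>i. v ((\<sigma> \<circ> ?t N a) (p + i))) = \<psi> (\<lambda>i. v ((\<sigma> \<circ> \<kappa>) (a + i)))"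
          by (rule alt_form_cong[OF \<psi>]) (simp add: \<kappa>(4))
        ultimately show ?thesis by (simp add: f_def g_def)
      qed
      then have "(\<Sum>\<sigma>\<in>?P. f (\<sigma> \<circ> ?t N a)) = (\<Sum>\<sigma>\<in>?P. (- 1) ^ q *\<^sub>R g (\<sigma> \<circ> \<kappa>))"
        by simp
      also have "\<dots> = (- 1) ^ q *\<^sub>R sum g ?P"
        using sum_permutations_compose_right[OF \<kappa>(1), of g] by (simp add: scaleR_sum_right)
      finally show ?thesis by (simp add: wedge_sum_def g_def N)
    qed
    finally show ?thesis by (simp add: p)
  qed
  have "wedge_sum m p q \<phi> \<psi> v = sum f {\<sigma>. \<sigma> permutes insert N {..<N}}"
    by (simp add: wedge_sum_def f_def pq lessThan_Suc)
  also have "\<dots> = (\<Sum>j<p + q. \<Sum>\<sigma>\<in>?P. f (\<sigma> \<circ> ?t N j))"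
    by (subst sum_permutes_insert_right) (simp_all add: pq lessThan_Suc)
  also have "{..<p + q} = {..<p} \<union> {p..<p + q}" by auto
  also have "(\<Sum>j\<in>{..<p} \<union> {p..<p + q}. \<Sum>\<sigma>\<in>?P. f (\<sigma> \<circ> ?t N j)) =
      (\<Sum>j<p. \<Sum>\<sigma>\<in>?P. f (\<sigma> \<circ> ?t N j)) + (\<Sum>j\<in>{p..<p + q}. \<Sum>\<sigma>\<in>?P. f (\<sigma> \<circ> ?t N j))"
    by (rule sum.union_disjoint) auto
  also have "\<dots> = (\<Sum>j<p. ((- 1) ^ q) *\<^sub>R wedge_sum m (p - 1) q (insert_last (p - 1) (v N) \<phi>) \<psi> v) +
      (\<Sum>j\<in>{p..<p + q}. wedge_sum m p (q - 1) \<phi> (insert_last (q - 1) (v N) \<psi>) v)"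
    by (intro arg_cong2[where f = "(+)"] sum.cong refl) (use left right in auto)
  finally show ?thesis
    by (simp add: sum_constant_scaleR add.commute)
qed

text \<open>Contraction with the last argument is an antiderivation up to order. The factorials
  absorb the multiplicities \<open>p\<close> and \<open>q\<close> of
  \<open>wedge_sum_last\<close>.\<close>

lemma wedge_by_last:
  fixes \<phi> :: "(nat \<Rightarrow> 'a::real_vector) \<Rightarrow> 'b::real_vector" and \<psi> :: "(nat \<Rightarrow> 'a) \<Rightarrow> 'c::real_vector"
  assumes m: "bilinear m" and \<phi>: "alt_form p \<phi>" and \<psi>: "alt_form q \<psi>" and pq: "p + q = Suc N"
  shows "wedge_by m p q \<phi> \<psi> v =
    (if q = 0 then 0 else wedge_by m p (q - 1) \<phi> (insert_last (q - 1) (v N) \<psi>) v) +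
    (if p = 0 then 0 else (- 1) ^ q *\<^sub>R wedge_by m (p - 1) q (insert_last (p - 1) (v N) \<phi>) \<psi> v)"
proof -
  have f: "fact k = real k * fact (k - 1)" if "k \<noteq> 0" for k
    using that by (simp add: fact_reduce)
  show ?thesis
    unfolding wedge_by_eq_wedge_sum wedge_sum_last[OF assms] scaleR_add_right scaleR_scaleR
    by (rule arg_cong2[where f = "(+)"]) (auto simp: f)
qed

lemma insert_last_nth:
  assumes "alt_form (Suc k) \<phi>" "length I = k"
  shows "insert_last k (v N) \<phi> (\<lambda>i. v (I ! i)) = \<phi> (\<lambda>i. v ((I @ [N]) ! i))"
  unfolding insert_last_def
  by (rule alt_form_cong[OF assms(1)]) (use assms(2) in \<open>auto simp: nth_append\<close>)

text \<open>
  The index splittings \<open>{0, \<dots>, p + q - 1} = I \<union> J\<close> with \<open>|I| = p\<close>, \<open>|J| = q\<close>, both listed in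
  increasing order, together with the signs of the permutations \<open>I J\<close>.
\<close>

fun shuffle_signs :: "nat \<Rightarrow> nat \<Rightarrow> (int \<times> nat list \<times> nat list) list" where
  "shuffle_signs 0 0 = [(1, [], [])]"
| "shuffle_signs (Suc p) 0 = map (\<lambda>(s, I, J). (s, I @ [p], J)) (shuffle_signs p 0)"
| "shuffle_signs 0 (Suc q) = map (\<lambda>(s, I, J). (s, I, J @ [q])) (shuffle_signs 0 q)"
| "shuffle_signs (Suc p) (Suc q) =
     map (\<lambda>(s, I, J). (s, I, J @ [Suc (p + q)])) (shuffle_signs (Suc p) q) @
     map (\<lambda>(s, I, J). (if even q then - s else s, I @ [Suc (p + q)], J)) (shuffle_signs p (Suc q))"

lemma shuffle_signs_length:
  "(s, I, J) \<in> set (shuffle_signs p q) \<Longrightarrow> length I = p \<and> length J = q \<and> set I \<subseteq> {..<p + q} \<and> set J \<subseteq> {..<p + q}"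
  by (induction p q arbitrary: s I J rule: shuffle_signs.induct) (fastforce simp: less_Suc_eq)+

lemma scaleR_sum_list: "a *\<^sub>R sum_list xs = (\<Sum>x\<leftarrow>xs. a *\<^sub>R x)"
  for a :: real and xs :: "'a::real_vector list"
  by (induction xs) (simp_all add: scaleR_right_distrib)

text \<open>The recursion of \<open>shuffle_signs\<close> mirrors \<open>wedge_by_last\<close>: the
  largest index goes to the end of \<open>J\<close> or, with the sign of passing the second block,
  to the end of \<open>I\<close>. For \<open>p = q = 4\<close> this leaves 70 terms instead of
  8!.\<close>

lemma wedge_by_shuffle_signs:
  assumes m: "bilinear m" and \<phi>: "alt_form p \<phi>" and \<psi>: "alt_form q \<psi>"
  shows "wedge_by m p q \<phi> \<psi> v =
    (\<Sum>(s, I, J)\<leftarrow>shuffle_signs p q. of_int s *\<^sub>R m (\<phi> (\<lambda>i. v (I ! i))) (\<psi> (\<lambda>i. v (J ! i))))"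
  using \<phi> \<psi>
proof (induction p q arbitrary: \<phi> \<psi> rule: shuffle_signs.induct)
  case 1
  show ?case
    using alt_form_cong[OF 1(1), of "\<lambda>i. v i" "\<lambda>i. v ([] ! i)"]
      alt_form_cong[OF 1(2), of "\<lambda>i. v i" "\<lambda>i. v ([] ! i)"]
    by (simp add: wedge_by_def sign_id)
next
  case (2 p)
  have "wedge_by m (Suc p) 0 \<phi> \<psi> v = wedge_by m p 0 (insert_last p (v p) \<phi>) \<psi> v"
    using wedge_by_last[OF m 2(2,3), of p v] by simp
  also have "\<dots> = (\<Sum>(s, I, J)\<leftarrow>shuffle_signs p 0.
      of_int s *\<^sub>R m (insert_last p (v p) \<phi> (\<lambda>i. v (I ! i))) (\<psi> (\<lambda>i. v (J ! i))))"
    by (rule 2(1)[OF alt_form_insert_last[OF 2(2)] 2(3)])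
  also have "\<dots> = (\<Sum>(s, I, J)\<leftarrow>shuffle_signs p 0.
      of_int s *\<^sub>R m (\<phi> (\<lambda>i. v ((I @ [p]) ! i))) (\<psi> (\<lambda>i. v (J ! i))))"
    by (intro arg_cong[where f = sum_list] map_cong refl)
      (use insert_last_nth[OF 2(2)] shuffle_signs_length in fastforce)
  finally show ?case by (simp add: o_def case_prod_unfold)
next
  case (3 q)
  have "wedge_by m 0 (Suc q) \<phi> \<psi> v = wedge_by m 0 q \<phi> (insert_last q (v q) \<psi>) v"
    using wedge_by_last[OF m 3(2,3), of q v] by simp
  also have "\<dots> = (\<Sum>(s, I, J)\<leftarrow>shuffle_signs 0 q.
      of_int s *\<^sub>R m (\<phi> (\<lambda>i. v (I ! i))) (insert_last q (v q) \<psi> (\<lambda>i. v (J ! i))))"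
    by (rule 3(1)[OF 3(2) alt_form_insert_last[OF 3(3)]])
  also have "\<dots> = (\<Sum>(s, I, J)\<leftarrow>shuffle_signs 0 q.
      of_int s *\<^sub>R m (\<phi> (\<lambda>i. v (I ! i))) (\<psi> (\<lambda>i. v ((J @ [q]) ! i))))"
    by (intro arg_cong[where f = sum_list] map_cong refl)
      (use insert_last_nth[OF 3(3)] shuffle_signs_length in fastforce)
  finally show ?case by (simp add: o_def case_prod_unfold)
next
  case (4 p q)
  let ?N = "Suc (p + q)"
  have "wedge_by m (Suc p) (Suc q) \<phi> \<psi> v =
      wedge_by m (Suc p) q \<phi> (insert_last q (v ?N) \<psi>) v +
      (- 1) ^ Suc q *\<^sub>R wedge_by m p (Suc q) (insert_last p (v ?N) \<phi>) \<psi> v"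
    using wedge_by_last[OF m 4(3,4), of ?N v] by simp
  also have "wedge_by m (Suc p) q \<phi> (insert_last q (v ?N) \<psi>) v =
      (\<Sum>(s, I, J)\<leftarrow>shuffle_signs (Suc p) q.
        of_int s *\<^sub>R m (\<phi> (\<lambda>i. v (I ! i))) (insert_last q (v ?N) \<psi> (\<lambda>i. v (J ! i))))"
    by (rule 4(1)[OF 4(3) alt_form_insert_last[OF 4(4)]])
  also have "\<dots> = (\<Sum>(s, I, J)\<leftarrow>shuffle_signs (Suc p) q.
        of_int s *\<^sub>R m (\<phi> (\<lambda>i. v (I ! i))) (\<psi> (\<lambda>i. v ((J @ [?N]) ! i))))"
    by (intro arg_cong[where f = sum_list] map_cong refl)
      (use insert_last_nth[OF 4(4)] shuffle_signs_length in fastforce)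
  also have "wedge_by m p (Suc q) (insert_last p (v ?N) \<phi>) \<psi> v =
      (\<Sum>(s, I, J)\<leftarrow>shuffle_signs p (Suc q).
        of_int s *\<^sub>R m (insert_last p (v ?N) \<phi> (\<lambda>i. v (I ! i))) (\<psi> (\<lambda>i. v (J ! i))))"
    by (rule 4(2)[OF alt_form_insert_last[OF 4(3)] 4(4)])
  also have "\<dots> = (\<Sum>(s, I, J)\<leftarrow>shuffle_signs p (Suc q).
        of_int s *\<^sub>R m (\<phi> (\<lambda>i. v ((I @ [?N]) ! i))) (\<psi> (\<lambda>i. v (J ! i))))"
    by (intro arg_cong[where f = sum_list] map_cong refl)
      (use insert_last_nth[OF 4(3)] shuffle_signs_length in fastforce)
  also have "(- 1) ^ Suc q *\<^sub>R \<dots> = (\<Sum>(s, I, J)\<leftarrow>shuffle_signs p (Suc q).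
        of_int (if even q then - s else s) *\<^sub>R
        m (\<phi> (\<lambda>i. v ((I @ [?N]) ! i))) (\<psi> (\<lambda>i. v (J ! i))))"
    unfolding scaleR_sum_list by (simp add: o_def case_prod_unfold if_distrib cong: if_cong)
      (intro arg_cong[where f = sum_list] map_cong refl, auto)
  finally show ?case by (simp add: o_def case_prod_unfold)
qed

section \<open>Octonion identities\<close>

lemmas oct_add_left = bilinear_ladd[OF bilinear_oct_mult]
  and oct_add_right = bilinear_radd[OF bilinear_oct_mult]
  and oct_minus_left = bilinear_lneg[OF bilinear_oct_mult]
  and oct_minus_right = bilinear_rneg[OF bilinear_oct_mult]
  and oct_diff_left = bilinear_lsub[OF bilinear_oct_mult]
  and oct_diff_right = bilinear_rsub[OF bilinear_oct_mult]
  and oct_scale_left = bilinear_lmul[OF bilinear_oct_mult]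
  and oct_scale_right = bilinear_rmul[OF bilinear_oct_mult]

definition oct_assoc :: "octonion \<Rightarrow> octonion \<Rightarrow> octonion \<Rightarrow> octonion" where
  "oct_assoc x y z = (x \<odot> y) \<odot> z - x \<odot> (y \<odot> z)"

text \<open>Polarisation of the two alternative laws.\<close>

lemma oct_assoc_swap:
  "oct_assoc x y z = - oct_assoc y x z" "oct_assoc x y z = - oct_assoc x z y"
proof -
  have 0: "oct_assoc x x z = 0" "oct_assoc z x x = 0" for x z
    by (simp_all add: oct_assoc_def oct_alternative)
  have "oct_assoc (x + y) (x + y) z = oct_assoc x x z + oct_assoc x y z + oct_assoc y x z + oct_assoc y y z"
    "oct_assoc x (y + z) (y + z) = oct_assoc x y y + oct_assoc x y z + oct_assoc x z y + oct_assoc x z z"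
    by (simp_all add: oct_assoc_def oct_add_left oct_add_right)
  then show "oct_assoc x y z = - oct_assoc y x z" "oct_assoc x y z = - oct_assoc x z y"
    unfolding 0 by (simp_all add: eq_neg_iff_add_eq_0)
qed

lemma oct_right_linearised: "(z \<odot> x) \<odot> y + (z \<odot> y) \<odot> x = z \<odot> (x \<odot> y) + z \<odot> (y \<odot> x)"
  using oct_assoc_swap(2)[of z x y] by (simp add: oct_assoc_def algebra_simps)

lemma oct_flexible: "(u \<odot> x) \<odot> u = u \<odot> (x \<odot> u)"
proof -
  have "oct_assoc u x u = - oct_assoc u u x" by (rule oct_assoc_swap(2))
  then show ?thesis by (simp add: oct_assoc_def oct_alternative)
qed

text \<open>The defect is a sum of two associators. Alternation brings \<open>u\<close> to the front
  of both; then \<open>u \<odot> u\<close> can be split off, and the linearised right alternative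
  law cancels the rest.\<close>

lemma oct_moufang_left: "((u \<odot> x) \<odot> u) \<odot> y = u \<odot> (x \<odot> (u \<odot> y))"
proof -
  have "((u \<odot> x) \<odot> u) \<odot> y - u \<odot> (x \<odot> (u \<odot> y)) = oct_assoc (u \<odot> x) u y + oct_assoc u x (u \<odot> y)"
    by (simp add: oct_assoc_def)
  also have "\<dots> = - oct_assoc u (u \<odot> x) y - oct_assoc u (u \<odot> y) x"
    using oct_assoc_swap(1)[of "u \<odot> x" u y] oct_assoc_swap(2)[of u x "u \<odot> y"] by simp
  also have "\<dots> = u \<odot> ((u \<odot> x) \<odot> y + (u \<odot> y) \<odot> x) - (((u \<odot> u) \<odot> x) \<odot> y + ((u \<odot> u) \<odot> y) \<odot> x)"
    by (simp add: oct_assoc_def oct_add_right oct_alternative)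
  also have "\<dots> = 0"
    unfolding oct_right_linearised by (simp add: oct_add_right oct_alternative)
  finally show ?thesis by simp
qed

lemma oct_moufang_middle: "(u \<odot> x) \<odot> (y \<odot> u) = (u \<odot> (x \<odot> y)) \<odot> u"
proof -
  have "oct_assoc u x (y \<odot> u) = - oct_assoc u (y \<odot> u) x" by (rule oct_assoc_swap(2))
  also have "\<dots> = u \<odot> ((y \<odot> u) \<odot> x) - ((u \<odot> y) \<odot> u) \<odot> x"
    by (simp add: oct_assoc_def oct_flexible)
  also have "\<dots> = u \<odot> oct_assoc y u x"
    by (simp add: oct_moufang_left oct_assoc_def oct_diff_right)
  also have "oct_assoc y u x = oct_assoc x y u"
    using oct_assoc_swap(2)[of y u x] oct_assoc_swap(1)[of x y u] by simp
  finally show ?thesis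
    by (simp add: oct_assoc_def oct_diff_right oct_flexible)
qed

lemma oct_cnj_mult: "oct_cnj (x \<odot> y) = oct_cnj y \<odot> oct_cnj x"
  unfolding oct_eq_iff by (simp add: oct_mult_nth oct_cnj_nth)

lemma linear_oct_cnj: "linear oct_cnj"
  by (rule linearI) (simp_all add: oct_eq_iff oct_cnj_nth)

lemma oct_cnj_cnj [simp]: "oct_cnj (oct_cnj x) = x"
  by (simp add: oct_eq_iff oct_cnj_nth)

definition imag_unit :: "octonion \<Rightarrow> bool" where
  "imag_unit u \<longleftrightarrow> u $ 0 = 0 \<and> u \<bullet> u = 1"

lemma
  assumes "imag_unit u"
  shows oct_cnj_imag: "oct_cnj u = - u" and oct_square_imag: "u \<odot> u = - oct_e 0"
proof -
  show *: "oct_cnj u = - u"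
    using assms by (simp add: oct_eq_iff oct_cnj_nth imag_unit_def)
  then show "u \<odot> u = - oct_e 0"
    using inner_oct[of u u] assms
    by (simp add: imag_unit_def oct_minus_right oct_cnj_mult oct_minus_left linear_neg[OF linear_oct_cnj] scaleR_2[symmetric])
qed

text \<open>For an imaginary unit \<open>u\<close> the inverse is \<open>- u\<close>, so this is
  conjugation by \<open>u\<close>.\<close>

definition oct_conj :: "octonion \<Rightarrow> octonion \<Rightarrow> octonion" where
  "oct_conj u x = - ((u \<odot> x) \<odot> u)"

lemma linear_oct_conj: "linear (oct_conj u)"
  by (rule linearI) (simp_all add: oct_conj_def oct_add_left oct_add_right oct_scale_left oct_scale_right)

lemma linear_oct_left: "linear (\<lambda>x. - (u \<odot> x))"
  by (rule linearI) (simp_all add: oct_add_right oct_scale_right)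

text \<open>The effect of right multiplication by \<open>u\<close> on a fourfold product built up
  from the left: the partial products are first conjugated by \<open>u\<close>, then multiplied by
  \<open>- u\<close> on the left, then conjugated again. The outer two steps are the middle Moufang
  identity, the second is the left one together with
  \<open>u \<odot> (u \<odot> z) = - z\<close>.\<close>

lemma
  assumes u: "imag_unit u"
  shows mult_right_imag_1: "oct_cnj (x \<odot> u) \<odot> (y \<odot> u) = oct_conj u (oct_cnj x \<odot> y)"
    and mult_right_imag_2: "oct_conj u x \<odot> oct_cnj (y \<odot> u) = - (u \<odot> (x \<odot> oct_cnj y))"
    and mult_right_imag_3: "- (u \<odot> x) \<odot> (y \<odot> u) = oct_conj u (x \<odot> y)"
proof -
  show "oct_cnj (x \<odot> u) \<odot> (y \<odot> u) = oct_conj u (oct_cnj x \<odot> y)"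
    by (simp add: oct_cnj_mult oct_cnj_imag[OF u] oct_conj_def oct_minus_left oct_moufang_middle)
  show "- (u \<odot> x) \<odot> (y \<odot> u) = oct_conj u (x \<odot> y)"
    by (simp add: oct_conj_def oct_minus_left oct_moufang_middle)
  have "u \<odot> (u \<odot> z) = - z" for z
    by (simp add: oct_alternative[symmetric] oct_square_imag[OF u] oct_minus_left oct_mult_unit)
  then show "oct_conj u x \<odot> oct_cnj (y \<odot> u) = - (u \<odot> (x \<odot> oct_cnj y))"
    by (simp add: oct_cnj_mult oct_cnj_imag[OF u] oct_conj_def oct_minus_left oct_minus_right oct_moufang_left)
qed

lemma oct_cnj_conj:
  assumes u: "imag_unit u"
  shows "oct_cnj (oct_conj u x) = oct_conj u (oct_cnj x)"
  by (simp add: oct_conj_def oct_cnj_mult oct_cnj_imag[OF u] oct_minus_left oct_minus_right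
      linear_neg[OF linear_oct_cnj] oct_flexible)

lemma oct_mult_nth_0: "(x \<odot> y) $ 0 = x \<bullet> oct_cnj y"
  unfolding inner_oct_nth by (simp add: oct_mult_nth oct_cnj_nth)

text \<open>Multiplicativity of the norm makes \<open>oct_conj u\<close> an isometry, by
  polarisation; it commutes with \<open>oct_cnj\<close>, and the real part of a product is an inner
  product.\<close>

lemma oct_conj_mult_nth_0:
  assumes u: "imag_unit u"
  shows "(oct_conj u x \<odot> oct_conj u y) $ 0 = (x \<odot> y) $ 0"
proof -
  have n: "oct_conj u x \<bullet> oct_conj u x = x \<bullet> x" for x
    using u by (simp add: oct_conj_def norm_oct_mult imag_unit_def)
  have "oct_conj u x \<bullet> oct_conj u y = x \<bullet> y" for x y
    using n[of "x + y"] n[of x] n[of y]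
    by (simp add: linear_add[OF linear_oct_conj] inner_add_left inner_add_right inner_commute)
  then show ?thesis
    by (simp add: oct_mult_nth_0 oct_cnj_conj[OF u])
qed

section \<open>The invariance of the real part\<close>

lemma alt_form_compose_linear:
  assumes \<phi>: "alt_form k \<phi>" and f: "linear f"
  shows "alt_form k (\<lambda>v. f (\<phi> v))"
  unfolding alt_form_def
proof (intro conjI allI impI)
  show "f (\<phi> v) = f (\<phi> w)" if "\<forall>i<k. v i = w i" for v w
    using alt_form_cong[OF \<phi>, of v w] that by simp
  show "linear (\<lambda>x. f (\<phi> (v(i := x))))" if "i < k" for v i
    using linear_compose[OF alt_form_linear[OF \<phi> that] f] by (simp add: o_def)
  show "f (\<phi> v) = 0" if "i < k" "j < k" "i \<noteq> j \<and> v i = v j" for v i j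
    using alt_form_zero[OF \<phi>, of i j v] that linear_0[OF f] by simp
qed

lemma alt_form_add:
  assumes \<phi>: "alt_form k \<phi>" and \<psi>: "alt_form k \<psi>"
  shows "alt_form k (\<lambda>v. \<phi> v + \<psi> v)"
  unfolding alt_form_def
proof (intro conjI allI impI)
  show "\<phi> v + \<psi> v = \<phi> w + \<psi> w" if "\<forall>i<k. v i = w i" for v w
    using alt_form_cong[OF \<phi>, of v w] alt_form_cong[OF \<psi>, of v w] that by simp
  show "linear (\<lambda>x. \<phi> (v(i := x)) + \<psi> (v(i := x)))" if "i < k" for v i
    by (intro linear_compose_add alt_form_linear[OF \<phi> that] alt_form_linear[OF \<psi> that])
  show "\<phi> v + \<psi> v = 0" if "i < k" "j < k" "i \<noteq> j \<and> v i = v j" for v i j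
    using alt_form_zero[OF \<phi>, of i j v] alt_form_zero[OF \<psi>, of i j v] that by simp
qed

lemma alt_form_scale: "alt_form k \<phi> \<Longrightarrow> alt_form k (\<lambda>v. c * \<phi> v)" for \<phi> :: "_ \<Rightarrow> real"
  by (rule alt_form_compose_linear) (auto simp: linear_iff algebra_simps)

lemma alt_form_dx: "alt_form 1 dx" and alt_form_dy: "alt_form 1 dy"
  unfolding alt_form_def dx_def dy_def by (auto intro!: linearI)

lemma alt_form_cnj: "alt_form k \<phi> \<Longrightarrow> alt_form k (form_cnj \<phi>)"
  unfolding form_cnj_def[abs_def] by (rule alt_form_compose_linear[OF _ linear_oct_cnj])

definition quad_form where
  "quad_form a b c d = owedge 3 1 (owedge 2 1 (owedge 1 1 (form_cnj a) b) (form_cnj c)) d"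

lemma Psi_eq_quad_form:
  "Psi40 = quad_form dx dx dx dx" "Psi31 = quad_form dy dx dx dx"
  "Psi13 = quad_form dx dy dy dy" "Psi04 = quad_form dy dy dy dy"
  by (simp_all add: quad_form_def Psi40_def Psi31_def Psi13_def Psi04_def)

lemma alt_form_quad_parts:
  assumes "alt_form 1 a" "alt_form 1 b" "alt_form 1 c" "alt_form 1 d"
  shows "alt_form 2 (owedge 1 1 (form_cnj a) b)"
    and "alt_form 3 (owedge 2 1 (owedge 1 1 (form_cnj a) b) (form_cnj c))"
    and "alt_form 4 (quad_form a b c d)"
proof -
  show 1: "alt_form 2 (owedge 1 1 (form_cnj a) b)"
    using alt_form_wedge_by[OF bilinear_oct_mult alt_form_cnj[OF assms(1)] assms(2)]
    by (simp only: one_add_one)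
  show 2: "alt_form 3 (owedge 2 1 (owedge 1 1 (form_cnj a) b) (form_cnj c))"
    using alt_form_wedge_by[OF bilinear_oct_mult 1 alt_form_cnj[OF assms(3)]] by simp
  show "alt_form 4 (quad_form a b c d)"
    unfolding quad_form_def
    using alt_form_wedge_by[OF bilinear_oct_mult 2 assms(4)] by simp
qed

lemma alt_form_Psi: "alt_form 4 Psi40" "alt_form 4 Psi31" "alt_form 4 Psi13" "alt_form 4 Psi04"
  unfolding Psi_eq_quad_form by (intro alt_form_quad_parts(3) alt_form_dx alt_form_dy)+

lemma quad_form_mult_right:
  assumes u: "imag_unit u"
    and "\<And>v. a (\<lambda>i. g (v i)) = a v \<odot> u" "\<And>v. b (\<lambda>i. g (v i)) = b v \<odot> u"
      "\<And>v. c (\<lambda>i. g (v i)) = c v \<odot> u" "\<And>v. d (\<lambda>i. g (v i)) = d v \<odot> u"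
  shows "quad_form a b c d (\<lambda>i. g (v i)) = oct_conj u (quad_form a b c d v)"
proof -
  have cnj: "form_cnj a (\<lambda>i. g (v i)) = oct_cnj (a v \<odot> u)" "form_cnj c (\<lambda>i. g (v i)) = oct_cnj (c v \<odot> u)" for v
    by (simp_all add: form_cnj_def assms)
  have "owedge 1 1 (form_cnj a) b (\<lambda>i. g (v i)) = oct_conj u (owedge 1 1 (form_cnj a) b v)" for v
    unfolding form_cnj_def
    by (simp add: wedge_by_def assms mult_right_imag_1[OF u] linear_sum[OF linear_oct_conj] linear_scale[OF linear_oct_conj])
  then have "owedge 2 1 (owedge 1 1 (form_cnj a) b) (form_cnj c) (\<lambda>i. g (v i)) =
      - (u \<odot> owedge 2 1 (owedge 1 1 (form_cnj a) b) (form_cnj c) v)" for v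
    \<comment> \<open>The new factor carries a conjugation, so \<open>h\<close> undoes it,
      multiplies by \<open>u\<close> and conjugates again.\<close>
    by (rule wedge_by_equivariant[where f = "oct_conj u" and h = "\<lambda>x. oct_cnj (oct_cnj x \<odot> u)"])
      (use mult_right_imag_2[OF u] linear_oct_left in \<open>auto simp: assms form_cnj_def\<close>)
  then show ?thesis
    unfolding quad_form_def
    by (rule wedge_by_equivariant[where f = "\<lambda>x. - (u \<odot> x)" and h = "\<lambda>x. x \<odot> u"])
      (use mult_right_imag_3[OF u] linear_oct_conj assms in auto)
qed

text \<open>The primed forms may differ from the original ones in order to cover the exchange of
  \<open>dx\<close> and \<open>dy\<close>. The other uses are the sign change of \<open>y\<close>
  and the detection of degrees by scaling.\<close>

lemma quad_form_scale:
  fixes r s t w :: real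
  assumes "\<And>v. a (\<lambda>i. g (v i)) = r *\<^sub>R a' v" "\<And>v. b (\<lambda>i. g (v i)) = s *\<^sub>R b' v"
      "\<And>v. c (\<lambda>i. g (v i)) = t *\<^sub>R c' v" "\<And>v. d (\<lambda>i. g (v i)) = w *\<^sub>R d' v"
  shows "quad_form a b c d (\<lambda>i. g (v i)) = (r * s * t * w) *\<^sub>R quad_form a' b' c' d' v"
proof -
  have cnj: "form_cnj a (\<lambda>i. g (v i)) = r *\<^sub>R form_cnj a' v" "form_cnj c (\<lambda>i. g (v i)) = t *\<^sub>R form_cnj c' v" for v
    by (simp_all add: form_cnj_def assms linear_scale[OF linear_oct_cnj])
  have m: "(x *\<^sub>R a) \<odot> (y *\<^sub>R b) = (x * y) *\<^sub>R (a \<odot> b)" for x y a b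
    by (simp add: oct_scale_left oct_scale_right mult.commute)
  have l: "linear (\<lambda>a :: octonion. x *\<^sub>R a)" for x
    by (rule linear_scaleR)
  show ?thesis
    unfolding quad_form_def
    by (intro wedge_by_equivariant[where f = "\<lambda>a. (r * s * t) *\<^sub>R a" and h = "\<lambda>a. w *\<^sub>R a"]
        wedge_by_equivariant[where f = "\<lambda>a. (r * s) *\<^sub>R a" and h = "\<lambda>a. t *\<^sub>R a"]
        wedge_by_equivariant[where f = "\<lambda>a. r *\<^sub>R a" and h = "\<lambda>a. s *\<^sub>R a"] m l cnj assms)
qed

definition rmul2 :: "octonion \<Rightarrow> oct2 \<Rightarrow> oct2" where
  "rmul2 u = (\<lambda>(x, y). (x \<odot> u, y \<odot> u))"

definition flip2 :: "oct2 \<Rightarrow> oct2" where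
  "flip2 = (\<lambda>(x, y). (y, x))"

definition neg2 :: "oct2 \<Rightarrow> oct2" where
  "neg2 = (\<lambda>(x, y). (x, - y))"

text \<open>
  Invariance under the subgroup of \<open>Spin(9)\<close> generated by the copy of \<open>Spin(7)\<close> acting diagonally
  on \<open>\<O> \<oplus> \<O>\<close> by right multiplications, by \<open>diag(1, -1)\<close> and by the exchange of the summands.
\<close>

definition spin7_form :: "((nat \<Rightarrow> oct2) \<Rightarrow> real) \<Rightarrow> bool" where
  "spin7_form \<phi> \<longleftrightarrow> alt_form 8 \<phi> \<and> (\<forall>u. imag_unit u \<longrightarrow> pullback (rmul2 u) \<phi> = \<phi>) \<and>
     pullback flip2 \<phi> = \<phi> \<and> pullback neg2 \<phi> = \<phi>"

lemma oct_mult_0: "0 \<odot> x = 0" "x \<odot> 0 = 0"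
  by (simp_all add: bilinear_lzero[OF bilinear_oct_mult] bilinear_rzero[OF bilinear_oct_mult])

text \<open>\<open>flip2\<close> and \<open>neg2\<close> are the generators with
  \<open>(r, u)\<close> equal to \<open>(0, oct_e 0)\<close> and \<open>(1, 0)\<close>. Following
  \<open>flip2\<close> by the generator of \<open>(0, u)\<close> multiplies the summands by
  \<open>u\<close> and \<open>oct_cnj u = - u\<close>; \<open>neg2\<close> repairs the sign.\<close>

lemma spin7_form_of_spin9:
  assumes "\<Psi> \<in> spin9_invariant_forms 8"
  shows "spin7_form \<Psi>"
proof -
  have "oct_cnj (oct_e 0) = oct_e 0" "oct_e 0 \<bullet> oct_e 0 = 1"
    unfolding inner_oct_nth oct_eq_iff by (simp_all add: oct_cnj_nth oct_e_def axis_def)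
  then have f: "flip2 \<in> spin9"
    using spin9.gen[of 0 "oct_e 0"] by (simp add: spin9_gen_def flip2_def oct_mult_unit)
  have "oct_cnj 0 = 0" by (rule linear_0[OF linear_oct_cnj])
  then have n: "neg2 \<in> spin9"
    using spin9.gen[of 1 0] by (simp add: spin9_gen_def neg2_def oct_mult_0)
  have "rmul2 u \<in> spin9" if u: "imag_unit u" for u
  proof -
    have "neg2 \<circ> (spin9_gen 0 u \<circ> flip2) = rmul2 u"
      by (auto simp: fun_eq_iff neg2_def flip2_def rmul2_def spin9_gen_def oct_cnj_imag[OF u] oct_minus_right)
    moreover have "neg2 \<circ> (spin9_gen 0 u \<circ> flip2) \<in> spin9"
      using u by (intro spin9.mult spin9.gen f n) (simp add: imag_unit_def)
    ultimately show ?thesis by simp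
  qed
  with f n assms show ?thesis
    by (auto simp: spin7_form_def spin9_invariant_forms_def)
qed

abbreviation wedge_inner :: "((nat \<Rightarrow> oct2) \<Rightarrow> octonion) \<Rightarrow> ((nat \<Rightarrow> oct2) \<Rightarrow> octonion) \<Rightarrow> (nat \<Rightarrow> oct2) \<Rightarrow> real" where
  "wedge_inner \<equiv> wedge_by (\<bullet>) 4 4"

text \<open>The real part of \<open>x \<odot> y\<close> is the inner product of \<open>x\<close>
  with \<open>oct_cnj y\<close>; this removes the conjugations from the square terms and puts one on
  \<open>Psi13\<close> in the mixed term. The two mixed terms are conjugate to each other, whence
  the factor 10.\<close>

definition Psi8_re :: "(nat \<Rightarrow> oct2) \<Rightarrow> real" where
  "Psi8_re v = wedge_inner Psi40 Psi40 v + 4 * wedge_inner Psi31 Psi31 v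
     - 10 * wedge_inner Psi31 (form_cnj Psi13) v
     + 4 * wedge_inner Psi13 Psi13 v + wedge_inner Psi04 Psi04 v"

text \<open>Conjugation reverses products, and exchanging two 4-forms costs no sign.\<close>

lemma oct_cnj_owedge:
  assumes "alt_form 4 \<phi>" "alt_form 4 \<psi>"
  shows "oct_cnj (owedge 4 4 \<phi> \<psi> v) = owedge 4 4 (form_cnj \<psi>) (form_cnj \<phi>) v"
  unfolding wedge_by_commute_4_4[OF assms]
  by (simp add: wedge_by_def form_cnj_def linear_sum[OF linear_oct_cnj] linear_scale[OF linear_oct_cnj] oct_cnj_mult)

lemma owedge_nth_0: "owedge 4 4 \<phi> \<psi> v $ 0 = wedge_inner \<phi> (form_cnj \<psi>) v"
  by (simp add: wedge_by_def oct_mult_nth_0 form_cnj_def)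

lemma form_cnj_cnj [simp]: "form_cnj (form_cnj \<phi>) = \<phi>"
  by (simp add: form_cnj_def fun_eq_iff)

lemma Psi8_eq_real_form: "Psi8 = real_form Psi8_re"
proof
  fix v
  have c: "oct_cnj (x + y) = oct_cnj x + oct_cnj y" "oct_cnj (x - y) = oct_cnj x - oct_cnj y"
    "oct_cnj (r *\<^sub>R x) = r *\<^sub>R oct_cnj x" for x y r
    by (simp_all add: linear_add[OF linear_oct_cnj] linear_diff[OF linear_oct_cnj] linear_scale[OF linear_oct_cnj])
  have "oct_cnj (Psi8 v) = Psi8 v"
    unfolding Psi8_def c
    by (simp add: oct_cnj_owedge alt_form_Psi alt_form_cnj add.commute)
  moreover have "x = (x $ 0) *\<^sub>R oct_e 0" if "oct_cnj x = x" for x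
    using that unfolding oct_eq_iff by (simp add: oct_cnj_nth oct_e_def axis_def)
  ultimately have "Psi8 v = (Psi8 v $ 0) *\<^sub>R oct_e 0" by blast
  moreover have "owedge 4 4 (form_cnj Psi13) (form_cnj Psi31) v $ 0 = owedge 4 4 Psi31 Psi13 v $ 0"
    unfolding oct_cnj_owedge[OF alt_form_Psi(2,3), symmetric] by (simp add: oct_cnj_nth)
  then have "Psi8 v $ 0 = Psi8_re v"
    by (simp add: Psi8_def Psi8_re_def owedge_nth_0)
  ultimately show "Psi8 v = real_form Psi8_re v" by (simp add: real_form_def)
qed

lemma alt_form_wedge_inner:
  assumes "alt_form 4 \<phi>" "alt_form 4 \<psi>"
  shows "alt_form 8 (wedge_inner \<phi> \<psi>)"
  using alt_form_wedge_by[OF _ assms, of "(\<bullet>)"] bilinear_conv_bounded_bilinear bounded_bilinear_inner by auto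

lemma wedge_inner_pullback:
  assumes "\<And>v. \<phi> (\<lambda>i. g (v i)) = f (\<phi>' v)" "\<And>v. \<psi> (\<lambda>i. g (v i)) = f (\<psi>' v)"
    and "\<And>a b. f a \<bullet> f b = a \<bullet> b"
  shows "wedge_inner \<phi> \<psi> (\<lambda>i. g (v i)) = wedge_inner \<phi>' \<psi>' v"
  by (simp add: wedge_by_def assms)

lemma wedge_inner_cnj: 
  assumes "alt_form 4 \<phi>" "alt_form 4 \<psi>"
  shows "wedge_inner \<phi> (form_cnj \<psi>) = wedge_inner \<psi> (form_cnj \<phi>)"
proof -
  have *: "b \<bullet> oct_cnj a = a \<bullet> oct_cnj b" for a b
    unfolding inner_oct_nth by (simp add: oct_cnj_nth)
  show ?thesis
    unfolding wedge_by_commute_4_4[OF assms(1) alt_form_cnj[OF assms(2)]]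
    unfolding wedge_by_def form_cnj_def
    by (intro ext arg_cong2[where f = "(*\<^sub>R)"] sum.cong refl *)
qed

lemma oct_conj_inner: "imag_unit u \<Longrightarrow> oct_conj u x \<bullet> oct_conj u y = x \<bullet> y"
  using oct_conj_mult_nth_0[of u x "oct_cnj y"] by (simp add: oct_mult_nth_0 oct_cnj_conj)

lemma spin7_form_Psi8_re: "spin7_form Psi8_re"
  unfolding spin7_form_def
proof (intro conjI allI impI ext)
  note alt = alt_form_wedge_inner[OF alt_form_Psi(1) alt_form_Psi(1)]
    alt_form_wedge_inner[OF alt_form_Psi(2) alt_form_Psi(2)]
    alt_form_wedge_inner[OF alt_form_Psi(3) alt_form_Psi(3)]
    alt_form_wedge_inner[OF alt_form_Psi(4) alt_form_Psi(4)]
    alt_form_wedge_inner[OF alt_form_Psi(2) alt_form_cnj[OF alt_form_Psi(3)]]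
  have "alt_form 8 (\<lambda>v. wedge_inner Psi40 Psi40 v + 4 * wedge_inner Psi31 Psi31 v
     + (- 10) * wedge_inner Psi31 (form_cnj Psi13) v
     + 4 * wedge_inner Psi13 Psi13 v + wedge_inner Psi04 Psi04 v)"
    by (intro alt_form_add alt_form_scale alt)
  then show "alt_form 8 Psi8_re"
    unfolding Psi8_re_def[abs_def] by simp
next
  fix u v assume u: "imag_unit u"
  have d: "dx (\<lambda>i. rmul2 u (v i)) = dx v \<odot> u" "dy (\<lambda>i. rmul2 u (v i)) = dy v \<odot> u" for v
    by (simp_all add: dx_def dy_def rmul2_def case_prod_unfold)
  have P: "P (\<lambda>i. rmul2 u (v i)) = oct_conj u (P v)" if "P \<in> {Psi40, Psi31, Psi13, Psi04}" for P v
    using that by (auto simp: Psi_eq_quad_form intro!: quad_form_mult_right[OF u] d)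
  have "form_cnj Psi13 (\<lambda>i. rmul2 u (v i)) = oct_conj u (form_cnj Psi13 v)" for v
    by (simp add: form_cnj_def oct_cnj_conj[OF u] P)
  with P have "wedge_inner P Q (\<lambda>i. rmul2 u (v i)) = wedge_inner P Q v"
    if "P \<in> {Psi40, Psi31, Psi13, Psi04}" "Q \<in> {Psi40, Psi31, Psi13, Psi04, form_cnj Psi13}" for P Q
    using that by (intro wedge_inner_pullback[where f = "oct_conj u"] oct_conj_inner[OF u]) auto
  then show "pullback (rmul2 u) Psi8_re v = Psi8_re v"
    by (simp add: pullback_def Psi8_re_def)
next
  fix v
  have d: "dx (\<lambda>i. flip2 (v i)) = 1 *\<^sub>R dy v" "dy (\<lambda>i. flip2 (v i)) = 1 *\<^sub>R dx v" for v
    by (simp_all add: dx_def dy_def flip2_def case_prod_unfold)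
  have "Psi40 (\<lambda>i. flip2 (v i)) = (1 * 1 * 1 * 1) *\<^sub>R Psi04 v"
    "Psi31 (\<lambda>i. flip2 (v i)) = (1 * 1 * 1 * 1) *\<^sub>R Psi13 v"
    "Psi13 (\<lambda>i. flip2 (v i)) = (1 * 1 * 1 * 1) *\<^sub>R Psi31 v"
    "Psi04 (\<lambda>i. flip2 (v i)) = (1 * 1 * 1 * 1) *\<^sub>R Psi40 v" for v
    unfolding Psi_eq_quad_form by (intro quad_form_scale d)+
  then have P: "Psi40 (\<lambda>i. flip2 (v i)) = Psi04 v" "Psi31 (\<lambda>i. flip2 (v i)) = Psi13 v"
    "Psi13 (\<lambda>i. flip2 (v i)) = Psi31 v" "Psi04 (\<lambda>i. flip2 (v i)) = Psi40 v" for v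
    by simp_all
  \<comment> \<open>The exchange turns the mixed term into the one with \<open>Psi31\<close> and
    \<open>Psi13\<close> interchanged, which is the same form by
    \<open>wedge_inner_cnj\<close>.\<close>
  have W: "wedge_inner Psi31 (form_cnj Psi13) (\<lambda>i. flip2 (v i)) = wedge_inner Psi31 (form_cnj Psi13) v"
    unfolding wedge_inner_cnj[OF alt_form_Psi(2,3)]
    by (subst wedge_inner_cnj[OF alt_form_Psi(3,2)]) (rule wedge_inner_pullback[where f = id], simp_all add: P form_cnj_def)
  show "pullback flip2 Psi8_re v = Psi8_re v"
    unfolding pullback_def Psi8_re_def W
    by (simp add: wedge_inner_pullback[where f = id and g = flip2] P)
next
  fix v
  have d: "dx (\<lambda>i. neg2 (v i)) = 1 *\<^sub>R dx v" "dy (\<lambda>i. neg2 (v i)) = (- 1) *\<^sub>R dy v" for v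
    by (simp_all add: dx_def dy_def neg2_def case_prod_unfold)
  \<comment> \<open>\<open>Psi31\<close> and \<open>Psi13\<close> are odd in \<open>dy\<close> and
    change sign, but every term of \<open>Psi8_re\<close> contains an even number of them.\<close>
  have "Psi40 (\<lambda>i. neg2 (v i)) = (1 * 1 * 1 * 1) *\<^sub>R Psi40 v"
    "Psi31 (\<lambda>i. neg2 (v i)) = (- 1 * 1 * 1 * 1) *\<^sub>R Psi31 v"
    "Psi13 (\<lambda>i. neg2 (v i)) = (1 * - 1 * - 1 * - 1) *\<^sub>R Psi13 v"
    "Psi04 (\<lambda>i. neg2 (v i)) = (- 1 * - 1 * - 1 * - 1) *\<^sub>R Psi04 v" for v
    unfolding Psi_eq_quad_form by (intro quad_form_scale d)+
  then show "pullback neg2 Psi8_re v = Psi8_re v"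
    by (simp add: pullback_def Psi8_re_def wedge_by_def form_cnj_def linear_neg[OF linear_oct_cnj])
qed

section \<open>Coefficients with respect to the standard basis\<close>

definition basis2 :: "nat \<Rightarrow> oct2" where
  "basis2 k = (if k < 8 then (oct_e k, 0) else (0, oct_e (k - 8)))"

definition coef :: "((nat \<Rightarrow> oct2) \<Rightarrow> 'b) \<Rightarrow> nat list \<Rightarrow> 'b" where
  "coef \<phi> ks = \<phi> (\<lambda>i. basis2 (ks ! i))"

lemma basis2_expand:
  "x = (\<Sum>k<8. (fst x $ of_nat k) *\<^sub>R basis2 k) + (\<Sum>k<8. (snd x $ of_nat k) *\<^sub>R basis2 (8 + k))"
proof -
  have "fst x = (\<Sum>k<8. (fst x $ of_nat k) *\<^sub>R oct_e k)" "snd x = (\<Sum>k<8. (snd x $ of_nat k) *\<^sub>R oct_e k)"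
    using dx_dy_expand[of "\<lambda>_. x"] by (simp_all add: dx_def dy_def)
  moreover have "(\<Sum>k<8. c k *\<^sub>R basis2 k) = (\<Sum>k<8. c k *\<^sub>R oct_e k, 0)"
    "(\<Sum>k<8. c k *\<^sub>R basis2 (8 + k)) = (0, \<Sum>k<8. c k *\<^sub>R oct_e k)" for c
    by (simp_all add: basis2_def prod_eq_iff fst_sum snd_sum)
  ultimately show ?thesis by (simp add: prod_eq_iff)
qed

lemma alt_form_coef_distinct:
  assumes "alt_form n \<phi>" "length ks = n" "\<not> distinct ks"
  shows "coef \<phi> ks = 0"
proof -
  obtain i j where "i < n" "j < n" "i \<noteq> j" "ks ! i = ks ! j"
    using assms by (auto simp: distinct_conv_nth)
  then show ?thesis
    unfolding coef_def by (intro alt_form_zero[OF assms(1), of i j]) auto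
qed

lemma alt_form_eq_0I:
  fixes \<phi> :: "(nat \<Rightarrow> oct2) \<Rightarrow> 'b::real_vector"
  assumes \<phi>: "alt_form n \<phi>"
    and 0: "\<And>ks. length ks = n \<Longrightarrow> distinct ks \<Longrightarrow> set ks \<subseteq> {..<16} \<Longrightarrow> coef \<phi> ks = 0"
  shows "\<phi> v = 0"
proof -
  \<comment> \<open>Induction on the number \<open>m\<close> of leading arguments that need not be
    basis vectors; each step expands one of them by linearity.\<close>
  have "\<phi> v = 0" if "m \<le> n" "\<forall>i\<in>{m..<n}. v i \<in> basis2 ` {..<16}" for m v
    using that
  proof (induction m arbitrary: v)
    case 0
    then obtain k where k: "\<And>i. i < n \<Longrightarrow> v i = basis2 (k i)" "\<And>i. i < n \<Longrightarrow> k i < 16"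
      by (fastforce simp: image_iff Bex_def dest!: bchoice)
    have "\<phi> v = coef \<phi> (map k [0..<n])"
      unfolding coef_def by (rule alt_form_cong[OF \<phi>]) (simp add: k)
    also have "\<dots> = 0"
    proof (cases "distinct (map k [0..<n])")
      case True
      then show ?thesis by (intro assms(2)) (auto simp: k)
    next
      case False
      then show ?thesis by (intro alt_form_coef_distinct[OF \<phi>]) auto
    qed
    finally show ?case .
  next
    case (Suc m)
    have l: "linear (\<lambda>x. \<phi> (v(m := x)))"
      using alt_form_linear[OF \<phi>] Suc.prems by simp
    have z: "\<phi> (v(m := basis2 k)) = 0" if "k < 16" for k
      by (rule Suc.IH) (use Suc.prems that in auto)
    have "\<phi> v = \<phi> (v(m := v m))" by simp
    also have "\<dots> = 0"
      by (subst basis2_expand[of "v m"])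
        (simp add: linear_add[OF l] linear_sum[OF l] linear_scale[OF l] z del: fun_upd_apply)
    finally show ?case .
  qed
  from this[of n v] show ?thesis by simp
qed

section \<open>Signed permutations of the standard basis\<close>

lemma alt_form_scale_args:
  fixes \<phi> :: "(nat \<Rightarrow> 'a::real_vector) \<Rightarrow> 'b::real_vector"
  assumes \<phi>: "alt_form n \<phi>"
  shows "\<phi> (\<lambda>i. c i *\<^sub>R v i) = (\<Prod>i<n. c i) *\<^sub>R \<phi> v"
proof -
  have "\<phi> (\<lambda>i. if i < m then c i *\<^sub>R v i else v i) = (\<Prod>i<m. c i) *\<^sub>R \<phi> v" if "m \<le> n" for m
    using that
  proof (induction m)
    case (Suc m)
    let ?w = "\<lambda>i. if i < m then c i *\<^sub>R v i else v i"
    have l: "linear (\<lambda>x. \<phi> (?w(m := x)))"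
      using alt_form_linear[OF \<phi>] Suc.prems by simp
    have "\<phi> (\<lambda>i. if i < Suc m then c i *\<^sub>R v i else v i) = \<phi> (?w(m := c m *\<^sub>R v m))"
      by (intro arg_cong[where f = \<phi>]) (auto simp: fun_eq_iff)
    also have "\<dots> = c m *\<^sub>R \<phi> (?w(m := v m))" by (rule linear_scale[OF l])
    also have "?w(m := v m) = ?w" by auto
    finally show ?case using Suc by simp
  qed simp
  from this[of n] have "\<phi> (\<lambda>i. if i < n then c i *\<^sub>R v i else v i) = (\<Prod>i<n. c i) *\<^sub>R \<phi> v" by simp
  moreover have "\<phi> (\<lambda>i. if i < n then c i *\<^sub>R v i else v i) = \<phi> (\<lambda>i. c i *\<^sub>R v i)"
    by (rule alt_form_cong[OF \<phi>]) simp
  ultimately show ?thesis by simp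
qed

text \<open>
  Row \<open>g\<close> lists the sign and the index of the images of \<open>e\<^sub>0, \<dots>, e\<^sub>7\<close> under a signed permutation
  of the basis: the right multiplication by \<open>e\<^sub>g\<close> for \<open>g \<le> 7\<close>, and for \<open>g = 8, 9, 10\<close> the map
  \<open>x \<mapsto> ((x \<odot> (e\<^sub>a - e\<^sub>b)) \<odot> (e\<^sub>c - e\<^sub>d)) / 2\<close> with \<open>abcd = 1236, 1527, 1345\<close>.  The three maps and the
  multiplications generate \<open>AGL(3, 2)\<close> modulo signs.
\<close>

definition sperms :: "(int \<times> nat) list list" where
  "sperms =
    [[(1,0),(1,1),(1,2),(1,3),(1,4),(1,5),(1,6),(1,7)],
     [(1,1),(-1,0),(-1,4),(-1,7),(1,2),(-1,6),(1,5),(1,3)],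
     [(1,2),(1,4),(-1,0),(-1,5),(-1,1),(1,3),(-1,7),(1,6)],
     [(1,3),(1,7),(1,5),(-1,0),(-1,6),(-1,2),(1,4),(-1,1)],
     [(1,4),(-1,2),(1,1),(1,6),(-1,0),(-1,7),(-1,3),(1,5)],
     [(1,5),(1,6),(-1,3),(1,2),(1,7),(-1,0),(-1,1),(-1,4)],
     [(1,6),(-1,5),(1,7),(-1,4),(1,3),(1,1),(-1,0),(-1,2)],
     [(1,7),(-1,3),(-1,6),(1,1),(-1,5),(1,4),(1,2),(-1,0)],
     [(1,7),(1,6),(1,3),(-1,2),(1,5),(-1,4),(-1,1),(-1,0)],
     [(1,4),(1,7),(-1,5),(-1,6),(-1,0),(1,2),(1,3),(-1,1)],
     [(-1,6),(-1,4),(1,7),(-1,5),(1,1),(1,3),(1,0),(-1,2)]]"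

definition sperm :: "nat \<Rightarrow> nat \<Rightarrow> int \<times> nat" where
  "sperm g k = sperms ! g ! k"

text \<open>
  For the evaluation by rewriting, a lookup by pattern matching on numbers in successor form is much
  faster than one that unfolds the table.
\<close>

abbreviation (input) "i1 \<equiv> Suc 0"
abbreviation (input) "i2 \<equiv> Suc i1"
abbreviation (input) "i3 \<equiv> Suc i2"
abbreviation (input) "i4 \<equiv> Suc i3"
abbreviation (input) "i5 \<equiv> Suc i4"
abbreviation (input) "i6 \<equiv> Suc i5"
abbreviation (input) "i7 \<equiv> Suc i6"
abbreviation (input) "i8 \<equiv> Suc i7"
abbreviation (input) "i9 \<equiv> Suc i8"
abbreviation (input) "i10 \<equiv> Suc i9"

lemma sperm_code [code]:
  "sperm 0 0 = (1, 0)" "sperm 0 i1 = (1, i1)" "sperm 0 i2 = (1, i2)" "sperm 0 i3 = (1, i3)"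
  "sperm 0 i4 = (1, i4)" "sperm 0 i5 = (1, i5)" "sperm 0 i6 = (1, i6)" "sperm 0 i7 = (1, i7)"
  "sperm i1 0 = (1, i1)" "sperm i1 i1 = (-1, 0)" "sperm i1 i2 = (-1, i4)" "sperm i1 i3 = (-1, i7)"
  "sperm i1 i4 = (1, i2)" "sperm i1 i5 = (-1, i6)" "sperm i1 i6 = (1, i5)" "sperm i1 i7 = (1, i3)"
  "sperm i2 0 = (1, i2)" "sperm i2 i1 = (1, i4)" "sperm i2 i2 = (-1, 0)" "sperm i2 i3 = (-1, i5)"
  "sperm i2 i4 = (-1, i1)" "sperm i2 i5 = (1, i3)" "sperm i2 i6 = (-1, i7)" "sperm i2 i7 = (1, i6)"
  "sperm i3 0 = (1, i3)" "sperm i3 i1 = (1, i7)" "sperm i3 i2 = (1, i5)" "sperm i3 i3 = (-1, 0)"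
  "sperm i3 i4 = (-1, i6)" "sperm i3 i5 = (-1, i2)" "sperm i3 i6 = (1, i4)" "sperm i3 i7 = (-1, i1)"
  "sperm i4 0 = (1, i4)" "sperm i4 i1 = (-1, i2)" "sperm i4 i2 = (1, i1)" "sperm i4 i3 = (1, i6)"
  "sperm i4 i4 = (-1, 0)" "sperm i4 i5 = (-1, i7)" "sperm i4 i6 = (-1, i3)" "sperm i4 i7 = (1, i5)"
  "sperm i5 0 = (1, i5)" "sperm i5 i1 = (1, i6)" "sperm i5 i2 = (-1, i3)" "sperm i5 i3 = (1, i2)"
  "sperm i5 i4 = (1, i7)" "sperm i5 i5 = (-1, 0)" "sperm i5 i6 = (-1, i1)" "sperm i5 i7 = (-1, i4)"
  "sperm i6 0 = (1, i6)" "sperm i6 i1 = (-1, i5)" "sperm i6 i2 = (1, i7)" "sperm i6 i3 = (-1, i4)"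
  "sperm i6 i4 = (1, i3)" "sperm i6 i5 = (1, i1)" "sperm i6 i6 = (-1, 0)" "sperm i6 i7 = (-1, i2)"
  "sperm i7 0 = (1, i7)" "sperm i7 i1 = (-1, i3)" "sperm i7 i2 = (-1, i6)" "sperm i7 i3 = (1, i1)"
  "sperm i7 i4 = (-1, i5)" "sperm i7 i5 = (1, i4)" "sperm i7 i6 = (1, i2)" "sperm i7 i7 = (-1, 0)"
  "sperm i8 0 = (1, i7)" "sperm i8 i1 = (1, i6)" "sperm i8 i2 = (1, i3)" "sperm i8 i3 = (-1, i2)"
  "sperm i8 i4 = (1, i5)" "sperm i8 i5 = (-1, i4)" "sperm i8 i6 = (-1, i1)" "sperm i8 i7 = (-1, 0)"
  "sperm i9 0 = (1, i4)" "sperm i9 i1 = (1, i7)" "sperm i9 i2 = (-1, i5)" "sperm i9 i3 = (-1, i6)"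
  "sperm i9 i4 = (-1, 0)" "sperm i9 i5 = (1, i2)" "sperm i9 i6 = (1, i3)" "sperm i9 i7 = (-1, i1)"
  "sperm i10 0 = (-1, i6)" "sperm i10 i1 = (-1, i4)" "sperm i10 i2 = (1, i7)" "sperm i10 i3 = (-1, i5)"
  "sperm i10 i4 = (1, i1)" "sperm i10 i5 = (1, i3)" "sperm i10 i6 = (1, 0)" "sperm i10 i7 = (-1, i2)"
  by (simp_all add: sperm_def sperms_def)

definition sp_quad :: "nat \<Rightarrow> nat \<times> nat \<times> nat \<times> nat" where
  "sp_quad g = (if g = 8 then (1, 2, 3, 6) else if g = 9 then (1, 5, 2, 7) else (1, 3, 4, 5))"

text \<open>For \<open>g \<ge> 8\<close> the imaginary units
  \<open>(oct_e a - oct_e b) / sqrt 2\<close> and \<open>(oct_e c - oct_e d) / sqrt 2\<close> act in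
  turn. One alone spreads a basis vector over two; both together permute the basis up to signs, and
  the square roots combine to \<open>1/2\<close>.\<close>

definition sp_fun :: "nat \<Rightarrow> octonion \<Rightarrow> octonion" where
  "sp_fun g x = (if g < 8 then x \<odot> oct_e g
     else case sp_quad g of (a, b, c, d) \<Rightarrow>
       (1/2) *\<^sub>R ((x \<odot> (oct_e a - oct_e b)) \<odot> (oct_e c - oct_e d)))"

definition signed_e :: "int \<times> nat \<Rightarrow> octonion" where
  "signed_e p = of_int (fst p) *\<^sub>R oct_e (snd p)"

text \<open>The multiplication table as sign and index, so that it can be compared with
  \<open>sperm\<close> by evaluation.\<close>

definition smult :: "nat \<Rightarrow> nat \<Rightarrow> int \<times> nat" where
  "smult i j =
    (if i = 0 then (1, j) else if j = 0 then (1, i) else if i = j then (- 1, 0)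
     else let d = (j + 7 - i) mod 7 in
       if d = 1 then (1, red7 (i + 3)) else if d = 2 then (1, red7 (i + 6))
       else if d = 4 then (1, red7 (i + 5)) else if d = 6 then (- 1, red7 (j + 3))
       else if d = 5 then (- 1, red7 (j + 6)) else (- 1, red7 (j + 5)))"

lemma oct_e_mult_smult: "oct_e_mult i j = signed_e (smult i j)"
  by (simp add: oct_e_mult_def smult_def signed_e_def Let_def)

lemma oct_e_mult_sperms:
  assumes "g < 8" "k < 8"
  shows "oct_e k \<odot> oct_e g = signed_e (sperm g k)"
proof -
  have "\<forall>g\<in>{..<8}. \<forall>k\<in>{..<8}. sperm g k = smult k g" by code_simp
  then show ?thesis
    using assms by (simp add: oct_mult_oct_e oct_e_mult_smult)
qed

lemma signed_e_mult:
  assumes "snd p < 8" "g < 8"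
  shows "signed_e p \<odot> oct_e g = of_int (fst p) *\<^sub>R signed_e (sperm g (snd p))"
  using assms by (simp add: signed_e_def[of p] oct_scale_left oct_e_mult_sperms)

definition sp_mult2 :: "nat \<Rightarrow> nat \<Rightarrow> nat \<Rightarrow> int \<times> nat" where
  "sp_mult2 k a c = (let p = sperm a k; q = sperm c (snd p) in (fst p * fst q, snd q))"

text \<open>Of the four products in \<open>sp_fun g (oct_e k)\<close> two cancel and the other two agree.\<close>

definition sp_check :: "nat \<Rightarrow> nat \<Rightarrow> bool" where
  "sp_check g k = (case sp_quad g of (a, b, c, d) \<Rightarrow>
      let r = sperm g k; r' = (- fst r, snd r); ac = sp_mult2 k a c; ad = sp_mult2 k a d;
        bc = sp_mult2 k b c; bd = sp_mult2 k b d
      in a < 8 \<and> b < 8 \<and> c < 8 \<and> d < 8 \<and> snd (sperm a k) < 8 \<and> snd (sperm b k) < 8 \<and>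
        (ac = r \<and> bd = r \<and> bc = (- fst ad, snd ad) \<or>
         ad = r' \<and> bc = r' \<and> bd = (- fst ac, snd ac)))"

lemma sp_fun_sperms:
  assumes "g < 11" "k < 8"
  shows "sp_fun g (oct_e k) = signed_e (sperm g k)"
proof (cases "g < 8")
  case True
  then show ?thesis using assms by (simp add: sp_fun_def oct_e_mult_sperms)
next
  case False
  obtain a b c d where q: "sp_quad g = (a, b, c, d)" by (metis prod_cases4)
  let ?r = "sperm g k"
  have "\<forall>g\<in>{8, 9, 10}. \<forall>k\<in>{..<8}. sp_check g k" by code_simp
  moreover have "g \<in> {8, 9, 10}" "k \<in> {..<8}" using assms False by auto
  ultimately have *: "sp_check g k" by blast
  have m: "(oct_e k \<odot> oct_e x) \<odot> oct_e y = signed_e (sp_mult2 k x y)"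
    if "x < 8" "y < 8" "snd (sperm x k) < 8" for x y
    using that assms
    by (simp add: oct_e_mult_sperms signed_e_mult sp_mult2_def Let_def) (simp add: signed_e_def)
  have n: "signed_e (- s, t) = - signed_e (s, t)" for s t
    by (simp add: signed_e_def)
  have "sp_fun g (oct_e k) = (1/2) *\<^sub>R (signed_e (sp_mult2 k a c) - signed_e (sp_mult2 k a d)
      - signed_e (sp_mult2 k b c) + signed_e (sp_mult2 k b d))"
    using * False by (simp add: sp_check_def sp_fun_def q Let_def oct_diff_left oct_diff_right m)
  also have "\<dots> = signed_e ?r"
    using * by (auto simp: sp_check_def q Let_def n scaleR_2[symmetric])
  finally show ?thesis .
qed

lemma snd_sperms: "g < 11 \<Longrightarrow> k < 8 \<Longrightarrow> snd (sperm g k) < 8"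
proof -
  have "\<forall>g\<in>{..<11}. \<forall>k\<in>{..<8}. snd (sperm g k) < 8" by code_simp
  then show "g < 11 \<Longrightarrow> k < 8 \<Longrightarrow> snd (sperm g k) < 8" by blast
qed

lemma spin7_form_sp_fun:
  assumes \<phi>: "spin7_form \<phi>" and "g < 11"
  shows "\<phi> (\<lambda>i. map_prod (sp_fun g) (sp_fun g) (v i)) = \<phi> v"
proof -
  have R: "\<phi> (\<lambda>i. rmul2 u (w i)) = \<phi> w" if "imag_unit u" for u w
  proof -
    have "pullback (rmul2 u) \<phi> = \<phi>" using \<phi> that by (simp add: spin7_form_def)
    from fun_cong[OF this, of w] show ?thesis by (simp add: pullback_def)
  qed
  consider "g = 0" | "g \<in> {1..7}" | "g \<in> {8, 9, 10}" using assms(2) by fastforce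
  then show ?thesis
  proof cases
    case 1
    then show ?thesis by (simp add: sp_fun_def oct_mult_unit map_prod_def)
  next
    case 2
    then have "g \<in> {1, 2, 3, 4, 5, 6, 7}" by auto
    then have "imag_unit (oct_e g)"
      unfolding imag_unit_def inner_oct_nth by (auto simp: oct_e_def axis_def)
    moreover have "map_prod (sp_fun g) (sp_fun g) = rmul2 (oct_e g)"
      using 2 by (auto simp: sp_fun_def rmul2_def)
    ultimately show ?thesis using R by simp
  next
    case 3
    obtain a b c d where abcd: "sp_quad g = (a, b, c, d)"
      by (metis prod_cases4)
    define h where "h a b = (1 / sqrt 2) *\<^sub>R (oct_e a - oct_e b)" for a b
    have h: "imag_unit (h a b)" "imag_unit (h c d)"
      using 3 abcd unfolding imag_unit_def inner_oct_nth h_def sp_quad_def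
      by (auto simp: oct_e_def axis_def)
    have "map_prod (sp_fun g) (sp_fun g) = rmul2 (h c d) \<circ> rmul2 (h a b)"
      using 3 abcd unfolding sp_fun_def rmul2_def
      by (auto simp: fun_eq_iff h_def oct_scale_left oct_scale_right)
    then have "\<phi> (\<lambda>i. map_prod (sp_fun g) (sp_fun g) (v i)) = \<phi> (\<lambda>i. rmul2 (h c d) (rmul2 (h a b) (v i)))"
      by simp
    then show ?thesis using R[OF h(1)] R[OF h(2)] by simp
  qed
qed

section \<open>Transport of coefficients along words in the signed permutations\<close>

definition sp_act :: "nat \<Rightarrow> nat \<Rightarrow> int \<times> nat" where
  "sp_act g k = (if k < 8 then sperm g k
     else let p = sperm g (k - 8) in (fst p, 8 + snd p))"

fun word_act :: "nat list \<Rightarrow> int \<times> nat list \<Rightarrow> int \<times> nat list" where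
  "word_act [] p = p"
| "word_act (g # w) (s, ks) = word_act w
     (let ps = map (sp_act g) ks in (s * prod_list (map fst ps), map snd ps))"

fun insert_sign :: "nat \<Rightarrow> nat list \<Rightarrow> int \<times> nat list" where
  "insert_sign x [] = (1, [x])"
| "insert_sign x (y # ys) = (if x \<le> y then (1, x # y # ys)
     else let p = insert_sign x ys in (- fst p, y # snd p))"

fun sort_sign :: "nat list \<Rightarrow> int \<times> nat list" where
  "sort_sign [] = (1, [])"
| "sort_sign (x # xs) = (let p = sort_sign xs; q = insert_sign x (snd p) in (fst p * fst q, snd q))"

definition reduce :: "nat list \<Rightarrow> nat list \<Rightarrow> int \<times> nat list" where
  "reduce w ks = (let p = word_act w (1, ks); q = sort_sign (snd p) in (fst p * fst q, snd q))"

lemma sp_act_basis2: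
  assumes "g < 11" "k < 16"
  shows "map_prod (sp_fun g) (sp_fun g) (basis2 k) = of_int (fst (sp_act g k)) *\<^sub>R basis2 (snd (sp_act g k))"
proof -
  have z: "sp_fun g 0 = 0"
    by (simp add: sp_fun_def oct_mult_0 split: prod.split)
  show ?thesis
    using assms snd_sperms[OF assms(1), of k]
    by (auto simp: basis2_def sp_act_def z sp_fun_sperms signed_e_def Let_def)
qed

lemma sp_act_less: "g < 11 \<Longrightarrow> k < 16 \<Longrightarrow> snd (sp_act g k) < 16"
  using snd_sperms[of g k] snd_sperms[of g "k - 8"] by (auto simp: sp_act_def Let_def)

lemma alt_form_coef_scaleR:
  fixes \<phi> :: "(nat \<Rightarrow> oct2) \<Rightarrow> 'b::real_vector"
  assumes \<phi>: "alt_form n \<phi>" and n: "length ks = n"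
    and G: "\<And>k. k \<in> set ks \<Longrightarrow> G (basis2 k) = of_int (fst (f k)) *\<^sub>R basis2 (snd (f k))"
  shows "\<phi> (\<lambda>i. G (basis2 (ks ! i))) =
    of_int (prod_list (map fst (map f ks))) *\<^sub>R coef \<phi> (map snd (map f ks))"
proof -
  have "\<phi> (\<lambda>i. G (basis2 (ks ! i))) =
      \<phi> (\<lambda>i. of_int (fst (f (ks ! i))) *\<^sub>R basis2 (map snd (map f ks) ! i))"
    by (rule alt_form_cong[OF \<phi>]) (use n in \<open>simp add: G\<close>)
  also have "\<dots> = (\<Prod>i<n. real_of_int (fst (f (ks ! i)))) *\<^sub>R coef \<phi> (map snd (map f ks))"
    unfolding coef_def by (rule alt_form_scale_args[OF \<phi>])
  also have "(\<Prod>i<n. real_of_int (fst (f (ks ! i)))) = of_int (prod_list (map fst (map f ks)))"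
    using n by (simp add: prod.list_conv_set_nth atLeast0LessThan)
  finally show ?thesis by simp
qed

lemma alt_form_coef_scale:
  fixes \<phi> :: "(nat \<Rightarrow> oct2) \<Rightarrow> real"
  assumes "alt_form n \<phi>" "length ks = n"
    and "\<And>k. k \<in> set ks \<Longrightarrow> G (basis2 k) = of_int (fst (f k)) *\<^sub>R basis2 (snd (f k))"
  shows "\<phi> (\<lambda>i. G (basis2 (ks ! i))) =
    of_int (prod_list (map fst (map f ks))) * coef \<phi> (map snd (map f ks))"
  using alt_form_coef_scaleR[where G = G and f = f and ks = ks, OF assms] by simp

lemma coef_word_act:
  assumes \<phi>: "spin7_form \<phi>"
  shows "length ks = 8 \<Longrightarrow> set ks \<subseteq> {..<16} \<Longrightarrow> set w \<subseteq> {..<11} \<Longrightarrow>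
    of_int s * coef \<phi> ks = of_int (fst (word_act w (s, ks))) * coef \<phi> (snd (word_act w (s, ks))) \<and>
    length (snd (word_act w (s, ks))) = 8 \<and> set (snd (word_act w (s, ks))) \<subseteq> {..<16}"
proof (induction w arbitrary: s ks)
  case (Cons g w)
  have alt: "alt_form 8 \<phi>" using \<phi> by (simp add: spin7_form_def)
  have g: "g < 11" using Cons.prems by simp
  define P where "P = prod_list (map fst (map (sp_act g) ks))"
  define ks' where "ks' = map snd (map (sp_act g) ks)"
  have "coef \<phi> ks = \<phi> (\<lambda>i. map_prod (sp_fun g) (sp_fun g) (basis2 (ks ! i)))"
    unfolding coef_def by (rule spin7_form_sp_fun[OF \<phi> g, symmetric])
  also have "\<dots> = of_int P * coef \<phi> ks'"
    unfolding P_def ks'_def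
    using Cons.prems sp_act_basis2[OF g] by (intro alt_form_coef_scale[OF alt]) auto
  finally have 1: "of_int s * coef \<phi> ks = of_int (s * P) * coef \<phi> ks'"
    by simp
  have 2: "word_act (g # w) (s, ks) = word_act w (s * P, ks')"
    by (simp add: P_def ks'_def Let_def)
  have "set ks' \<subseteq> {..<16}" "length ks' = 8"
    using Cons.prems sp_act_less[OF g] by (auto simp: ks'_def)
  then show ?case
    unfolding 1 2 using Cons.prems by (intro Cons.IH) auto
qed simp

lemma coef_swap:
  fixes \<phi> :: "(nat \<Rightarrow> oct2) \<Rightarrow> real"
  assumes \<phi>: "alt_form n \<phi>" and "length us + length vs + 2 = n"
  shows "coef \<phi> (us @ x # y # vs) = - coef \<phi> (us @ y # x # vs)"
proof -
  let ?i = "length us"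
  have "(us @ x # y # vs) ! i = (us @ y # x # vs) ! Transposition.transpose ?i (Suc ?i) i" for i
  proof -
    consider "i < ?i" | "i = ?i" | "i = Suc ?i" | j where "i = ?i + Suc (Suc j)"
      by (metis add_Suc_right less_imp_Suc_add linorder_neqE_nat not_less_eq add.commute add_Suc)
    then show ?thesis
      by cases (simp_all add: nth_append Transposition.transpose_def)
  qed
  then have "coef \<phi> (us @ x # y # vs) = \<phi> ((\<lambda>i. basis2 ((us @ y # x # vs) ! i)) \<circ> Transposition.transpose ?i (Suc ?i))"
    unfolding coef_def by (simp add: o_def)
  also have "\<dots> = - coef \<phi> (us @ y # x # vs)"
    unfolding coef_def using assms(2) by (intro alt_form_transpose[OF \<phi>]) auto
  finally show ?thesis .
qed

lemma coef_insert_sign: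
  fixes \<phi> :: "(nat \<Rightarrow> oct2) \<Rightarrow> real"
  assumes \<phi>: "alt_form n \<phi>"
  shows "length us + length ys + 1 = n \<Longrightarrow>
    coef \<phi> (us @ x # ys) = of_int (fst (insert_sign x ys)) * coef \<phi> (us @ snd (insert_sign x ys)) \<and>
    length (snd (insert_sign x ys)) = Suc (length ys)"
proof (induction ys arbitrary: us)
  case (Cons y ys)
  have "coef \<phi> (us @ x # y # ys) = - coef \<phi> ((us @ [y]) @ x # ys)"
    using coef_swap[OF \<phi>, of us ys x y] Cons.prems by simp
  then show ?case
    using Cons.IH[of "us @ [y]"] Cons.prems by (simp add: Let_def)
qed simp

lemma coef_sort_sign:
  fixes \<phi> :: "(nat \<Rightarrow> oct2) \<Rightarrow> real"
  assumes \<phi>: "alt_form n \<phi>"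
  shows "length us + length xs = n \<Longrightarrow>
    coef \<phi> (us @ xs) = of_int (fst (sort_sign xs)) * coef \<phi> (us @ snd (sort_sign xs)) \<and>
    length (snd (sort_sign xs)) = length xs"
proof (induction xs arbitrary: us)
  case (Cons x xs)
  have "coef \<phi> (us @ x # xs) = of_int (fst (sort_sign xs)) * coef \<phi> (us @ x # snd (sort_sign xs))"
    "length (snd (sort_sign xs)) = length xs"
    using Cons.IH[of "us @ [x]"] Cons.prems by simp_all
  then show ?case
    using coef_insert_sign[OF \<phi>, of us "snd (sort_sign xs)" x] Cons.prems by (simp add: Let_def)
qed simp

lemma coef_reduce:
  assumes \<phi>: "spin7_form \<phi>" and "length ks = 8" "set ks \<subseteq> {..<16}" "set w \<subseteq> {..<11}"
  shows "coef \<phi> ks = of_int (fst (reduce w ks)) * coef \<phi> (snd (reduce w ks))"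
proof -
  have alt: "alt_form 8 \<phi>" using \<phi> by (simp add: spin7_form_def)
  obtain s ks' where w: "word_act w (1, ks) = (s, ks')" by fastforce
  have "coef \<phi> ks = of_int s * coef \<phi> ks'" "length ks' = 8"
    using coef_word_act[OF assms, of 1] by (simp_all add: w)
  moreover from this have "coef \<phi> ks' = of_int (fst (sort_sign ks')) * coef \<phi> (snd (sort_sign ks'))"
    using coef_sort_sign[OF alt, of "[]" ks'] by simp
  ultimately show ?thesis
    by (simp add: reduce_def w Let_def)
qed

text \<open>Reordering the indices changes only the sign, which is irrelevant for vanishing.\<close>

lemma coef_mset:
  fixes \<phi> :: "(nat \<Rightarrow> oct2) \<Rightarrow> real"
  assumes \<phi>: "alt_form n \<phi>" and n: "length ks = n" and "mset ks = mset ks'" and "coef \<phi> ks' = 0"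
  shows "coef \<phi> ks = 0"
proof -
  obtain \<sigma> where \<sigma>: "\<sigma> permutes {..<length ks'}" "permute_list \<sigma> ks' = ks"
    by (rule mset_eq_permutation[OF assms(3)])
  have l: "length ks' = n" using mset_eq_length[OF assms(3)] n by simp
  have nth: "ks ! i = ks' ! \<sigma> i" if "i < n" for i
    unfolding \<sigma>(2)[symmetric] using that l by (intro permute_list_nth[OF \<sigma>(1)]) simp
  have "coef \<phi> ks = \<phi> ((\<lambda>i. basis2 (ks' ! i)) \<circ> \<sigma>)"
    unfolding coef_def by (rule alt_form_cong[OF \<phi>]) (simp add: nth)
  also have "\<dots> = of_int (sign \<sigma>) *\<^sub>R coef \<phi> ks'"
    unfolding coef_def using \<sigma>(1) unfolding l by (rule alt_form_permute[OF \<phi>])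
  finally show ?thesis by (simp add: assms(4))
qed

text \<open>
  Representatives, up to the exchange of the summands, of the orbits of \<open>AGL(3, 2)\<close> on those index
  sets that are compatible with the diagonal sign changes.  The first three of the words below give
  such sign changes; each of the others maps some of the remaining index sets to representatives.
\<close>

definition reps :: "nat list list" where
  "reps = [[8,9,10,11,12,13,14,15], [0,1,10,11,12,13,14,15], [0,1,8,9,11,13,14,15],
     [0,1,2,4,8,9,10,12], [0,1,2,4,11,13,14,15], [0,1,2,4,8,9,11,15],
     [0,1,2,3,8,9,10,11], [0,1,2,3,12,13,14,15], [0,1,2,3,8,9,12,15]]"

definition rep_words :: "nat list list" where
  "rep_words = [[1,2,4], [2,3,5], [3,4,6], [], [2], [3,8], [6,8], [6,9], [6,10], [10,9], [9,8,9],
     [2,9,8,9], [3,8,10,8], [3,9,10,9], [4,8,9,8], [5,9,10,9], [5,10,9,10], [3,8,9,8,9],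
     [3,9,10,8,9], [5,9,10,8,9], [6,8,9,8,9]]"

text \<open>
  Conditionals instead of connectives keep the evaluation by rewriting lazy.
\<close>

fun reducible :: "nat list list \<Rightarrow> nat list \<Rightarrow> bool" where
  "reducible [] ks = False"
| "reducible (w # ws) ks = (let q = reduce w ks in
     if snd q = ks then (if fst q = - 1 then True else if ks \<in> set reps then True else reducible ws ks)
     else if snd q \<in> set reps then True else reducible ws ks)"

lemma reducibleD:
  "reducible ws ks \<Longrightarrow> \<exists>w\<in>set ws. (fst (reduce w ks) = - 1 \<and> snd (reduce w ks) = ks) \<or>
    snd (reduce w ks) \<in> set reps"
  by (induction ws) (auto simp: Let_def split: if_splits)

text \<open>The indices form the affine space over the field with two elements in which
  \<open>i + j = k\<close> when \<open>oct_e i \<odot> oct_e j\<close> is plus or minus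
  \<open>oct_e k\<close>. Its affine group has one orbit on pairs and two on 4-sets: the planes,
  such as \<open>{0,1,2,4}\<close> because of \<open>e1 e2 = e4\<close>, and the rest, such as
  \<open>{0,1,2,3}\<close>.\<close>

definition norm_lists :: "nat list list" where
  "norm_lists = [[], [0,1], [0,1,2,3], [0,1,2,4]]"

text \<open>Replaces the classification of orbits by a check of 1 + 28 + 70 + 70 index lists: either
  a sign change fixes the list and negates its coefficient, or some word leads to a
  representative.\<close>

lemma reducible_all:
  "list_all (\<lambda>xs. list_all (\<lambda>ys. reducible rep_words (xs @ map ((+) 8) ys))
    (filter (\<lambda>ys. length xs + length ys = 8) (subseqs [0..<8]))) norm_lists"
  by code_simp

text \<open>Row \<open>k\<close> holds, for each value of the entry number \<open>k\<close>, a word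
  that moves it into place and fixes the entries placed before. Empty words stand for values that
  are already in place or cannot occur; in the last row 3 and 4 are both in place, as a map fixing
  0, 1 and 2 also fixes 4.\<close>

definition norm_tables :: "nat list list list" where
  "norm_tables =
    [[[0], [1], [2], [3], [4], [5], [6], [7]],
     [[], [], [7,8], [6,10], [1,10,9], [4,9], [1,8,10], [1,9,8]],
     [[], [], [], [1,10,8,9,8,9,10], [6,10,8,9,8,10], [1,8,9,10,9,10,8], [3,8,10,8], [5,10,9,10]],
     [[], [], [], [], [], [1,9,8,10,8,10,9], [2,9,8,9], [4,9,10,8,10,9]]]"

text \<open>
  The successive words move the elements of \<open>xs\<close> to \<open>0, 1, 2\<close> one after the other, which is
  possible because \<open>AGL(3, 2)\<close> is triply transitive; a fourth element then goes to \<open>3\<close> or \<open>4\<close>.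
\<close>

fun norm_word :: "nat list list list \<Rightarrow> nat \<Rightarrow> nat list \<Rightarrow> nat list" where
  "norm_word [] k xs = []"
| "norm_word (t # ts) k xs = (if k < length xs
     then let w = t ! (xs ! k) in w @ norm_word ts (Suc k) (snd (reduce w xs)) else [])"

text \<open>Normalising the \<open>x\<close>-part by itself takes 99 checks. Together with the 169
  of \<open>reducible_all\<close> these replace the 5685 pairs of an \<open>x\<close>-part and a
  \<open>y\<close>-part.\<close>

lemma norm_word_all:
  "list_all (\<lambda>xs. let w = norm_word norm_tables 0 xs in
       list_all (\<lambda>g. g < 11) w \<and> snd (reduce w xs) \<in> set norm_lists)
     (filter (\<lambda>xs. length xs \<in> {0, 2, 4}) (subseqs [0..<8]))"
  by code_simp

section \<open>Vanishing of all coefficients from the representatives\<close>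

definition word_perm :: "nat list \<Rightarrow> nat \<Rightarrow> nat" where
  "word_perm w k = fold (\<lambda>g k. snd (sp_act g k)) w k"

lemma word_perm_simps: "word_perm [] = (\<lambda>k. k)" "word_perm (g # w) k = word_perm w (snd (sp_act g k))"
  by (auto simp: word_perm_def)

lemma snd_word_act: "snd (word_act w (s, ks)) = map (word_perm w) ks"
  by (induction w arbitrary: s ks) (auto simp: word_perm_simps Let_def)

lemma snd_sp_act:
  assumes "g < 11" "k < 8"
  shows "snd (sp_act g k) < 8" "snd (sp_act g (8 + k)) = 8 + snd (sp_act g k)"
  using snd_sperms[OF assms] assms(2) by (simp_all add: sp_act_def Let_def)

lemma word_perm_less_8: "set w \<subseteq> {..<11} \<Longrightarrow> k < 8 \<Longrightarrow> word_perm w k < 8"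
proof (induction w arbitrary: k)
  case (Cons g w)
  then show ?case using Cons.IH[of "snd (sp_act g k)"] snd_sp_act(1)[of g k] by (simp add: word_perm_simps)
qed (simp add: word_perm_simps)

lemma word_perm_add_8: "set w \<subseteq> {..<11} \<Longrightarrow> k < 8 \<Longrightarrow> word_perm w (8 + k) = 8 + word_perm w k"
proof (induction w arbitrary: k)
  case (Cons g w)
  then show ?case using Cons.IH[of "snd (sp_act g k)"] snd_sp_act[of g k] by (simp add: word_perm_simps)
qed (simp add: word_perm_simps)

lemma mset_insert_sign: "mset (snd (insert_sign x ys)) = add_mset x (mset ys)"
  by (induction ys) (auto simp: Let_def)

lemma mset_sort_sign: "mset (snd (sort_sign xs)) = mset xs"
  by (induction xs) (auto simp: Let_def mset_insert_sign)

lemma mset_reduce: "mset (snd (reduce w ks)) = mset (map (word_perm w) ks)"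
  by (simp add: reduce_def Let_def mset_sort_sign snd_word_act)

lemma subseqs_cover:
  assumes "distinct ys" "set ys \<subseteq> {..<8}"
  obtains zs where "zs \<in> set (subseqs [0..<8])" "mset zs = mset ys"
proof -
  have "set ys \<in> set ` set (subseqs [0..<8])"
    unfolding subseqs_powset using assms(2) by auto
  then obtain zs where zs: "zs \<in> set (subseqs [0..<8])" "set zs = set ys" by auto
  then have "distinct zs" using subseqs_distinctD[OF zs(1)] by simp
  then have "mset zs = mset ys"
    using set_eq_iff_mset_eq_distinct[OF _ assms(1), of zs] zs(2) by simp
  with zs(1) show thesis by (rule that)
qed

lemma reducible_norm_lists:
  assumes "us \<in> set norm_lists" "ys \<in> set (subseqs [0..<8])" "length us + length ys = 8"
  shows "reducible rep_words (us @ map ((+) 8) ys)"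
  using reducible_all assms unfolding list_all_iff by fastforce

lemma norm_word_props:
  assumes "xs \<in> set (subseqs [0..<8])" "length xs \<in> {0, 2, 4}"
  defines "w \<equiv> norm_word norm_tables 0 xs"
  shows "set w \<subseteq> {..<11}" "snd (reduce w xs) \<in> set norm_lists"
proof -
  have "xs \<in> set (filter (\<lambda>xs. length xs \<in> {0, 2, 4}) (subseqs [0..<8]))"
    using assms by simp
  then have "list_all (\<lambda>g. g < 11) w \<and> snd (reduce w xs) \<in> set norm_lists"
    using norm_word_all unfolding list_all_iff[of _ "filter _ _"] w_def Let_def by blast
  then show "set w \<subseteq> {..<11}" "snd (reduce w xs) \<in> set norm_lists"
    by (auto simp: list_all_iff)
qed

lemma spin7_form_coef_0:
  fixes \<phi> :: "(nat \<Rightarrow> oct2) \<Rightarrow> real"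
  assumes \<phi>: "spin7_form \<phi>" and reps: "\<And>ks. ks \<in> set reps \<Longrightarrow> coef \<phi> ks = 0"
    and ys: "distinct ys" "set ys \<subseteq> {..<8}" and xs: "distinct xs" "set xs \<subseteq> {..<8}"
    and len: "length xs + length ys = 8" "length xs \<in> {0, 2, 4}"
  shows "coef \<phi> (xs @ map ((+) 8) ys) = 0"
proof -
  have alt: "alt_form 8 \<phi>" using \<phi> by (simp add: spin7_form_def)
  \<comment> \<open>The case of a normalised \<open>x\<close>-part, settled by the finite check; a
    normalising word moves the general case to it.\<close>
  have 1: "coef \<phi> (us @ map ((+) 8) vs) = 0"
    if us: "us \<in> set norm_lists" and vs: "set vs \<subseteq> {..<8}" "length us + length vs = 8" for us vs
  proof (cases "distinct vs")
    case False
    then show ?thesis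
      using vs by (intro alt_form_coef_distinct[OF alt]) (auto simp: distinct_map)
  next
    case True
    then obtain zs where zs: "zs \<in> set (subseqs [0..<8])" "mset zs = mset vs"
      using subseqs_cover vs(1) by blast
    have len_zs: "length us + length zs = 8"
      using vs(2) mset_eq_length[OF zs(2)] by simp
    let ?ks = "us @ map ((+) 8) zs"
    have "reducible rep_words ?ks"
      by (rule reducible_norm_lists[OF us zs(1) len_zs])
    then obtain w where w: "w \<in> set rep_words"
      "(fst (reduce w ?ks) = - 1 \<and> snd (reduce w ?ks) = ?ks) \<or> snd (reduce w ?ks) \<in> set reps"
      using reducibleD by blast
    have "list_all (list_all (\<lambda>g. g < 11)) rep_words" by code_simp
    with w have "set w \<subseteq> {..<11}" by (auto simp: list_all_iff)
    moreover have "set ?ks \<subseteq> {..<16}"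
    proof -
      have "list_all (list_all (\<lambda>g. g < 8)) norm_lists" by code_simp
      with us have "set us \<subseteq> {..<8}" by (auto simp: list_all_iff)
      moreover have "set zs \<subseteq> {..<8}" using zs(2) vs(1) mset_eq_setD by blast
      ultimately show ?thesis by fastforce
    qed
    ultimately have red: "coef \<phi> ?ks = of_int (fst (reduce w ?ks)) * coef \<phi> (snd (reduce w ?ks))"
      using len_zs by (intro coef_reduce[OF \<phi>]) simp_all
    from w(2) have "coef \<phi> ?ks = 0"
    proof
      assume *: "fst (reduce w ?ks) = - 1 \<and> snd (reduce w ?ks) = ?ks"
      have "coef \<phi> ?ks = of_int (- 1) * coef \<phi> ?ks"
        using red unfolding conjunct1[OF *] conjunct2[OF *] .
      then show ?thesis by simp
    next
      assume "snd (reduce w ?ks) \<in> set reps"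
      then show ?thesis unfolding red by (simp add: reps)
    qed
    then show ?thesis
      by (rule coef_mset[OF alt, rotated 2]) (use vs zs in auto)
  qed
  obtain zs where zs: "zs \<in> set (subseqs [0..<8])" "mset zs = mset xs"
    using subseqs_cover xs by blast
  define w where "w = norm_word norm_tables 0 zs"
  have len_zs: "length zs = length xs" by (rule mset_eq_length[OF zs(2)])
  then have w: "set w \<subseteq> {..<11}" "snd (reduce w zs) \<in> set norm_lists"
    using norm_word_props[OF zs(1)] len(2) by (simp_all add: w_def)
  let ?us = "snd (reduce w zs)" and ?vs = "map (word_perm w) ys"
  have us: "mset ?us = mset (map (word_perm w) zs)" by (rule mset_reduce)
  have rep0: "coef \<phi> (?us @ map ((+) 8) ?vs) = 0"
    by (rule 1) (use w ys len len_zs mset_eq_length[OF us] word_perm_less_8 in auto)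
  \<comment> \<open>The group acts diagonally, so the word permutes both blocks in the same
    way.\<close>
  have m: "map (word_perm w) (zs @ map ((+) 8) ys) = map (word_perm w) zs @ map ((+) 8) ?vs"
    using ys(2) word_perm_add_8[OF w(1)] by auto
  have "coef \<phi> (map (word_perm w) (zs @ map ((+) 8) ys)) = 0"
  proof (rule coef_mset[OF alt])
    show "length (map (word_perm w) (zs @ map ((+) 8) ys)) = 8"
      using len len_zs by simp
    show "mset (map (word_perm w) (zs @ map ((+) 8) ys)) = mset (?us @ map ((+) 8) ?vs)"
      unfolding m mset_append us ..
    show "coef \<phi> (?us @ map ((+) 8) ?vs) = 0" by (rule rep0)
  qed
  moreover have "set zs \<subseteq> {..<8}" using zs(2) xs(2) mset_eq_setD by blast
  moreover have "length (zs @ map ((+) 8) ys) = 8" using len len_zs by simp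
  moreover have "set (zs @ map ((+) 8) ys) \<subseteq> {..<16}"
    using \<open>set zs \<subseteq> {..<8}\<close> ys(2) by fastforce
  ultimately have "coef \<phi> (zs @ map ((+) 8) ys) = 0"
    using coef_word_act[OF \<phi> _ _ w(1), of "zs @ map ((+) 8) ys" 1] unfolding snd_word_act by simp
  then show ?thesis
    by (rule coef_mset[OF alt, rotated 2]) (use len zs in auto)
qed

text \<open>An odd number of \<open>x\<close>-indices is excluded by \<open>neg2\<close>, which
  negates the coefficient; 6 or 8 of them become 2 or 0 under \<open>flip2\<close>.\<close>

lemma spin7_form_eq_0I:
  fixes \<phi> :: "(nat \<Rightarrow> oct2) \<Rightarrow> real"
  assumes \<phi>: "spin7_form \<phi>" and reps: "\<And>ks. ks \<in> set reps \<Longrightarrow> coef \<phi> ks = 0"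
  shows "\<phi> v = 0"
proof (rule alt_form_eq_0I)
  show alt: "alt_form 8 \<phi>" using \<phi> by (simp add: spin7_form_def)
  have split: "mset ks = mset (filter (\<lambda>k. k < 8) ks @ map ((+) 8) (map (\<lambda>k. k - 8) (filter (\<lambda>k. \<not> k < 8) ks)))"
    for ks :: "nat list"
    by (induction ks) auto
  have even: "coef \<phi> ks = 0"
    if ks: "length ks = 8" "distinct ks" "set ks \<subseteq> {..<16}" "length (filter (\<lambda>k. k < 8) ks) \<in> {0, 2, 4}" for ks
  proof -
    have "coef \<phi> (filter (\<lambda>k. k < 8) ks @ map ((+) 8) (map (\<lambda>k. k - 8) (filter (\<lambda>k. \<not> k < 8) ks))) = 0"
    proof (rule spin7_form_coef_0[OF \<phi> reps])
      show "distinct (map (\<lambda>k. k - 8) (filter (\<lambda>k. \<not> k < 8) ks))"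
        using ks(2) by (auto simp: distinct_map inj_on_def)
      show "length (filter (\<lambda>k. k < 8) ks) + length (map (\<lambda>k. k - 8) (filter (\<lambda>k. \<not> k < 8) ks)) = 8"
        using ks(1) sum_length_filter_compl[of "\<lambda>k. k < 8" ks] by simp
    qed (use ks in auto)
    then show ?thesis
      by (rule coef_mset[OF alt ks(1) split])
  qed
  fix ks :: "nat list"
  assume ks: "length ks = 8" "distinct ks" "set ks \<subseteq> {..<16}"
  have less: "k < 16" if "k \<in> set ks" for k using ks(3) that by auto
  let ?n = "length (filter (\<lambda>k. k < 8) ks)"
  have n: "?n + length (filter (\<lambda>k. \<not> k < 8) ks) = 8"
    using ks(1) sum_length_filter_compl[of "\<lambda>k. k < 8" ks] by simp
  then consider "odd ?n" | "?n \<in> {0, 2, 4}" | "?n \<in> {6, 8}"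
  proof -
    have "m \<le> 8 \<Longrightarrow> m \<in> {0, 1, 2, 3, 4, 5, 6, 7, 8}" for m :: nat by auto
    moreover have "?n \<le> 8" using n by linarith
    ultimately have "?n \<in> {0, 1, 2, 3, 4, 5, 6, 7, 8}" .
    then show ?thesis using that by (elim insertE emptyE) simp_all
  qed
  then show "coef \<phi> ks = 0"
  proof cases
    case 1
    define f :: "nat \<Rightarrow> int \<times> nat" where "f k = (if k < 8 then 1 else - 1, k)" for k
    have "pullback neg2 \<phi> = \<phi>" using \<phi> by (simp add: spin7_form_def)
    then have "coef \<phi> ks = \<phi> (\<lambda>i. neg2 (basis2 (ks ! i)))"
      unfolding coef_def pullback_def by metis
    also have "\<dots> = of_int (prod_list (map fst (map f ks))) * coef \<phi> (map snd (map f ks))"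
      by (rule alt_form_coef_scale[OF alt ks(1)]) (auto simp: f_def neg2_def basis2_def)
    also have "map snd (map f ks) = ks" by (simp add: f_def o_def)
    also have "prod_list (map fst (map f ks)) = (- 1) ^ length (filter (\<lambda>k. \<not> k < 8) ks)"
      by (induction ks) (auto simp: f_def)
    also have "\<dots> = - 1" using 1 n by (metis even_add even_numeral uminus_power_if one_eq_divide_iff power_one)
    finally show ?thesis by simp
  next
    case 2
    then show ?thesis using even ks by blast
  next
    case 3
    define f :: "nat \<Rightarrow> int \<times> nat" where "f k = (1, if k < 8 then 8 + k else k - 8)" for k
    have "pullback flip2 \<phi> = \<phi>" using \<phi> by (simp add: spin7_form_def)
    then have "coef \<phi> ks = \<phi> (\<lambda>i. flip2 (basis2 (ks ! i)))"
      unfolding coef_def pullback_def by metis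
    also have "\<dots> = of_int (prod_list (map fst (map f ks))) * coef \<phi> (map snd (map f ks))"
      by (rule alt_form_coef_scale[OF alt ks(1)]) (auto simp: f_def flip2_def basis2_def dest!: less)
    also have "coef \<phi> (map snd (map f ks)) = 0"
    proof (rule even)
      show "distinct (map snd (map f ks))"
        using ks(2,3) by (auto simp: distinct_map f_def inj_on_def)
      show "set (map snd (map f ks)) \<subseteq> {..<16}"
        using ks(3) by (auto simp: f_def)
      have "length (filter (\<lambda>k. k < 8) (map snd (map f ks))) = length (filter (\<lambda>k. \<not> k < 8) ks)"
        using ks(3) by (induction ks) (auto simp: f_def)
      then show "length (filter (\<lambda>k. k < 8) (map snd (map f ks))) \<in> {0, 2, 4}"
        using 3 n by auto
    qed (use ks in simp)
    finally show ?thesis by simp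
  qed
qed

section \<open>Relations from rotations\<close>

text \<open>The derivative of the constant function at \<open>t = 0\<close>, computed by the product
  rule in the slots of the form.\<close>

lemma alt_form_rotation:
  fixes \<phi> :: "(nat \<Rightarrow> 'a::real_vector) \<Rightarrow> real"
  assumes \<phi>: "alt_form n \<phi>" and inv: "\<And>t. \<phi> (\<lambda>i. cos t *\<^sub>R v i + sin t *\<^sub>R w i) = \<phi> v"
  shows "(\<Sum>i<n. \<phi> (v(i := w i))) = 0"
proof -
  \<comment> \<open>Only the first \<open>m\<close> arguments rotate, so each induction step adds
    one term of the sum.\<close>
  define F where "F m v t = \<phi> (\<lambda>i. if i < m then cos t *\<^sub>R v i + sin t *\<^sub>R w i else v i)" for m v t
  have D: "(F m v has_real_derivative (\<Sum>i<m. \<phi> (v(i := w i)))) (at 0)" if "m \<le> n" for m v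
    using that
  proof (induction m arbitrary: v)
    case 0
    then show ?case by (simp add: F_def[abs_def])
  next
    case (Suc m)
    have "F (Suc m) v t = cos t * F m v t + sin t * F m (v(m := w m)) t" for t
    proof -
      define b where "b = (\<lambda>i. if i < m then cos t *\<^sub>R v i + sin t *\<^sub>R w i else v i)"
      have l: "linear (\<lambda>x. \<phi> (b(m := x)))"
        using alt_form_linear[OF \<phi>] Suc.prems by simp
      have "F (Suc m) v t = \<phi> (b(m := cos t *\<^sub>R v m + sin t *\<^sub>R w m))"
        unfolding F_def b_def by (intro arg_cong[where f = \<phi>]) (auto simp: fun_eq_iff)
      also have "\<dots> = cos t * \<phi> (b(m := v m)) + sin t * \<phi> (b(m := w m))"
        by (simp only: linear_add[OF l] linear_scale[OF l] real_scaleR_def)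
      also have "b(m := v m) = b" by (auto simp: b_def)
      also have "\<phi> b = F m v t" by (simp add: F_def b_def)
      also have "\<phi> (b(m := w m)) = F m (v(m := w m)) t"
        unfolding F_def b_def by (intro arg_cong[where f = \<phi>]) (auto simp: fun_eq_iff)
      finally show ?thesis .
    qed
    then have "F (Suc m) v = (\<lambda>t. cos t * F m v t + sin t * F m (v(m := w m)) t)" by auto
    moreover have "F m u 0 = \<phi> u" for u
      unfolding F_def by (intro arg_cong[where f = \<phi>]) auto
    ultimately show ?case
      using Suc.prems by (auto intro!: derivative_eq_intros Suc.IH simp: fun_upd_def)
  qed
  have "F n v t = \<phi> v" for t
    unfolding F_def inv[of t, symmetric] by (rule alt_form_cong[OF \<phi>]) simp
  then have "F n v = (\<lambda>t. \<phi> v)" by auto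
  then have "(F n v has_real_derivative 0) (at 0)" by simp
  then show ?thesis using D[of n v] DERIV_unique by blast
qed

text \<open>For a unit \<open>u\<close>, the velocity at \<open>t = 0\<close> of the path
  \<open>spin9_gen (cos t) (sin t *\<^sub>R u) \<circ> neg2\<close>, which starts at the identity
  since \<open>spin9_gen 1 0\<close> is the involution \<open>neg2\<close>.\<close>

definition rot2 :: "octonion \<Rightarrow> oct2 \<Rightarrow> oct2" where
  "rot2 u = (\<lambda>(x, y). (- (y \<odot> u), x \<odot> oct_cnj u))"

lemma spin9_rotation:
  assumes \<Psi>: "\<Psi> \<in> spin9_invariant_forms 8" and u: "u \<bullet> u = 1"
  shows "(\<Sum>i<8. \<Psi> (v(i := rot2 u (v i)))) = 0"
proof (rule alt_form_rotation)
  show "alt_form 8 \<Psi>" using \<Psi> by (simp add: spin9_invariant_forms_def)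
  fix t
  have "oct_cnj 0 = 0" by (rule linear_0[OF linear_oct_cnj])
  then have "neg2 = spin9_gen 1 0"
    by (simp add: spin9_gen_def neg2_def oct_mult_0)
  then have "neg2 \<in> spin9"
    using spin9.gen[of 1 0] by simp
  moreover have "spin9_gen (cos t) (sin t *\<^sub>R u) \<in> spin9"
    by (rule spin9.gen) (simp add: u power2_eq_square[symmetric])
  ultimately have "spin9_gen (cos t) (sin t *\<^sub>R u) \<circ> neg2 \<in> spin9"
    by (intro spin9.mult)
  then have "pullback (spin9_gen (cos t) (sin t *\<^sub>R u) \<circ> neg2) \<Psi> v = \<Psi> v"
    using \<Psi> by (simp add: spin9_invariant_forms_def)
  moreover have "(spin9_gen (cos t) (sin t *\<^sub>R u) \<circ> neg2) z = cos t *\<^sub>R z + sin t *\<^sub>R rot2 u z" for z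
    by (cases z) (simp add: spin9_gen_def neg2_def rot2_def oct_scale_right oct_minus_left linear_scale[OF linear_oct_cnj])
  ultimately show "\<Psi> (\<lambda>i. cos t *\<^sub>R v i + sin t *\<^sub>R rot2 u (v i)) = \<Psi> v"
    by (simp add: pullback_def)
qed

definition rot_act :: "nat \<Rightarrow> nat \<Rightarrow> int \<times> nat" where
  "rot_act a k = (if k < 8 then let p = sperm a k in (if a = 0 then fst p else - fst p, 8 + snd p)
     else let p = sperm a (k - 8) in (- fst p, snd p))"

lemma less_8_cases: "k < 8 \<Longrightarrow> k \<in> {0, 1, 2, 3, 4, 5, 6, 7 :: nat}"
  by auto

lemma oct_cnj_oct_e:
  assumes "k < 8"
  shows "oct_cnj (oct_e k) = (if k = 0 then oct_e k else - oct_e k)"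
  using less_8_cases[OF assms] unfolding oct_eq_iff
  by (elim insertE emptyE) (simp_all add: oct_cnj_nth oct_e_def axis_def)

lemma rot2_basis2:
  assumes "a < 8" "k < 16"
  shows "rot2 (oct_e a) (basis2 k) = of_int (fst (rot_act a k)) *\<^sub>R basis2 (snd (rot_act a k))"
  using assms snd_sperms[of a k] snd_sperms[of a "k - 8"] oct_cnj_oct_e[OF assms(1)]
  by (auto simp: rot2_def basis2_def rot_act_def Let_def oct_e_mult_sperms signed_e_def
      oct_mult_0 oct_minus_right)

text \<open>The eight terms of the relation from rotating by \<open>oct_e a\<close> on the basis
  vectors \<open>ks\<close>; the word number \<open>i\<close> is the hint that brings the term
  number \<open>i\<close> to a representative.\<close>

definition rotation_terms :: "nat \<Rightarrow> nat list \<Rightarrow> nat list list \<Rightarrow> (int \<times> nat list) list" where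
  "rotation_terms a ks ws = map (\<lambda>(i, w). let p = rot_act a (ks ! i); q = reduce w (ks[i := snd p])
     in (fst p * fst q, snd q)) (zip [0..<8] ws)"

definition rep_coefs :: "(int \<times> nat list) list \<Rightarrow> int list" where
  "rep_coefs ps = map (\<lambda>r. sum_list (map fst (filter (\<lambda>p. snd p = r) ps))) reps"

lemma sum_list_rep_coefs:
  assumes "\<And>p. p \<in> set ps \<Longrightarrow> snd p \<notin> set reps \<Longrightarrow> f (snd p) = 0"
  shows "(\<Sum>p\<leftarrow>ps. of_int (fst p) * f (snd p)) = (\<Sum>(c, r)\<leftarrow>zip (rep_coefs ps) reps. of_int c * f r :: real)"
proof -
  have d: "distinct reps" by (simp add: reps_def)
  have "(\<Sum>p\<leftarrow>ps. of_int (fst p) * f (snd p)) =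
      (\<Sum>r\<in>set reps. of_int (sum_list (map fst (filter (\<lambda>p. snd p = r) ps))) * f r)"
    using assms
  proof (induction ps)
    case (Cons p ps)
    have "(\<Sum>r\<in>set reps. of_int (sum_list (map fst (filter (\<lambda>q. snd q = r) (p # ps)))) * f r) =
        (\<Sum>r\<in>set reps. (if r = snd p then of_int (fst p) * f (snd p) else 0) +
          of_int (sum_list (map fst (filter (\<lambda>q. snd q = r) ps))) * f r)"
      by (intro sum.cong refl) (auto simp: algebra_simps)
    also have "\<dots> = of_int (fst p) * f (snd p) + (\<Sum>p\<leftarrow>ps. of_int (fst p) * f (snd p))"
      using Cons by (auto simp: sum.distrib)
    finally show ?case by simp
  qed simp
  also have "\<dots> = (\<Sum>r\<leftarrow>reps. of_int (sum_list (map fst (filter (\<lambda>p. snd p = r) ps))) * f r)"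
    by (rule sum_list_distinct_conv_sum_set[OF d, symmetric])
  also have "\<dots> = (\<Sum>(c, r)\<leftarrow>zip (rep_coefs ps) reps. of_int c * f r)"
    by (simp add: rep_coefs_def zip_map1 o_def case_prod_unfold zip_same_conv_map)
  finally show ?thesis .
qed

definition relation_ok :: "nat \<Rightarrow> nat list \<Rightarrow> nat list list \<Rightarrow> int list \<Rightarrow> bool" where
  "relation_ok a ks ws cs = (if a < 8 \<and> length ks = 8 \<and> list_all (\<lambda>k. k < 16) ks \<and> length ws = 8 \<and>
       list_all (list_all (\<lambda>g. g < 11)) ws
     then let ps = rotation_terms a ks ws in
       if list_all (\<lambda>p. if distinct (snd p) then snd p \<in> set reps else True) ps then rep_coefs ps = cs else False
     else False)"

text \<open>A term that is not reduced to a representative has a repeated index and vanishes by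
  alternation; the others are collected by representative.\<close>

lemma relation_okD:
  assumes ok: "relation_ok a ks ws cs" and \<Psi>: "\<Psi> \<in> spin9_invariant_forms 8"
  shows "(\<Sum>(c, r)\<leftarrow>zip cs reps. of_int c * coef \<Psi> r) = 0"
proof -
  have s7: "spin7_form \<Psi>" by (rule spin7_form_of_spin9[OF \<Psi>])
  then have alt: "alt_form 8 \<Psi>" by (simp add: spin7_form_def)
  have a: "a < 8" and ks: "length ks = 8" "\<And>i. i < 8 \<Longrightarrow> ks ! i < 16" "set ks \<subseteq> {..<16}"
    and ws: "length ws = 8" "\<And>i. i < 8 \<Longrightarrow> set (ws ! i) \<subseteq> {..<11}"
    and reps: "\<And>p. p \<in> set (rotation_terms a ks ws) \<Longrightarrow> distinct (snd p) \<Longrightarrow> snd p \<in> set reps"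
    and cs: "rep_coefs (rotation_terms a ks ws) = cs"
    using ok unfolding relation_ok_def Let_def
    by (auto simp: list_all_iff nth_mem subset_iff split: if_splits)
  have red: "coef \<Psi> (ks[i := snd (rot_act a (ks ! i))]) =
      of_int (fst (reduce w (ks[i := snd (rot_act a (ks ! i))]))) * coef \<Psi> (snd (reduce w (ks[i := snd (rot_act a (ks ! i))])))"
    if "i < 8" "set w \<subseteq> {..<11}" for i w
  proof (rule coef_reduce[OF s7])
    have "ks ! i - 8 < 8" using ks(2)[OF that(1)] by linarith
    then have "snd (rot_act a (ks ! i)) < 16"
      using snd_sperms[of a "ks ! i"] snd_sperms[of a "ks ! i - 8"] a
      by (fastforce simp: rot_act_def Let_def)
    then show "set (ks[i := snd (rot_act a (ks ! i))]) \<subseteq> {..<16}"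
      using ks(3) set_update_subset_insert[of ks i] by fastforce
  qed (use ks that in auto)
  have "oct_e a \<bullet> oct_e a = 1"
    using less_8_cases[OF a] unfolding inner_oct_nth
    by (elim insertE emptyE) (simp_all add: oct_e_def axis_def)
  then have "0 = (\<Sum>i<8. \<Psi> ((\<lambda>i. basis2 (ks ! i))(i := rot2 (oct_e a) (basis2 (ks ! i)))))"
    by (rule spin9_rotation[OF \<Psi>, symmetric])
  also have "\<dots> = (\<Sum>i<8. of_int (fst (rot_act a (ks ! i))) * coef \<Psi> (ks[i := snd (rot_act a (ks ! i))]))"
  proof (intro sum.cong refl)
    fix i :: nat assume "i \<in> {..<8}"
    then have i: "i < 8" by simp
    have "\<Psi> ((\<lambda>i. basis2 (ks ! i))(i := rot2 (oct_e a) (basis2 (ks ! i)))) =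
        of_int (fst (rot_act a (ks ! i))) * \<Psi> ((\<lambda>i. basis2 (ks ! i))(i := basis2 (snd (rot_act a (ks ! i)))))"
      unfolding rot2_basis2[OF a ks(2)[OF i]]
      using linear_scale[OF alt_form_linear[OF alt i]] by simp
    also have "\<Psi> ((\<lambda>i. basis2 (ks ! i))(i := basis2 (snd (rot_act a (ks ! i))))) =
        coef \<Psi> (ks[i := snd (rot_act a (ks ! i))])"
      unfolding coef_def by (rule alt_form_cong[OF alt]) (use ks(1) i in \<open>auto simp: nth_list_update\<close>)
    finally show "\<Psi> ((\<lambda>i. basis2 (ks ! i))(i := rot2 (oct_e a) (basis2 (ks ! i)))) =
        of_int (fst (rot_act a (ks ! i))) * coef \<Psi> (ks[i := snd (rot_act a (ks ! i))])" .
  qed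
  also have "\<dots> = (\<Sum>i<8. of_int (fst (rot_act a (ks ! i))) *
      (of_int (fst (reduce (ws ! i) (ks[i := snd (rot_act a (ks ! i))]))) *
        coef \<Psi> (snd (reduce (ws ! i) (ks[i := snd (rot_act a (ks ! i))])))))"
    by (intro sum.cong refl arg_cong2[where f = "(*)"] red ws(2)) auto
  also have "\<dots> = (\<Sum>p\<leftarrow>rotation_terms a ks ws. of_int (fst p) * coef \<Psi> (snd p))"
    unfolding rotation_terms_def
    using ws(1) by (simp add: sum_list_sum_nth atLeast0LessThan case_prod_unfold Let_def mult.assoc)
  also have "\<dots> = (\<Sum>(c, r)\<leftarrow>zip cs reps. of_int c * coef \<Psi> r)"
    unfolding cs[symmetric]
  proof (rule sum_list_rep_coefs)
    fix p assume p: "p \<in> set (rotation_terms a ks ws)" "snd p \<notin> set reps"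
    then obtain i w where "snd p = snd (reduce w (ks[i := snd (rot_act a (ks ! i))]))"
      by (auto simp: rotation_terms_def Let_def)
    then have "length (snd p) = 8"
      using ks(1) mset_eq_length[OF mset_reduce[of w "ks[i := snd (rot_act a (ks ! i))]"]] by simp
    then show "coef \<Psi> (snd p) = 0"
      using reps p alt_form_coef_distinct[OF alt] by blast
  qed
  finally show ?thesis by simp
qed

text \<open>Each list has 5 or 7 indices of \<open>y\<close>: a rotation moves one index to the
  other block, and only coefficients with an even number of them survive
  \<open>neg2\<close>.\<close>

lemma relations:
  "relation_ok 0 [1,8,10,11,12,13,14,15] [[],[],[10,9],[9,8],[3,8],[8,10],[2,9],[2,10]] [-1,7,0,0,0,0,0,0,0]"
  "relation_ok 1 [1,9,10,11,12,13,14,15] [[],[],[3,8],[1,9,10],[3,9,10,9],[9,8,10,8],[8,10],[2,9,10,8]] [1,-1,6,0,0,0,0,0,0]"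
  "relation_ok 0 [0,1,2,8,9,11,12,15] [[],[],[3,8,10,8],[],[],[],[],[3,8,9,10,9,8]] [0,0,-1,0,0,1,0,0,-2]"
  "relation_ok 1 [1,4,6,10,11,12,13,14] [[10],[],[],[],[10],[8,9,8],[],[2,10,9,10,8]] [0,0,1,0,0,1,0,0,2]"
  "relation_ok 1 [0,1,2,8,9,10,11,15] [[],[],[3,8,10,8],[],[],[],[4,9,10,8],[]] [0,0,-1,0,0,1,-2,0,0]"
  "relation_ok 1 [0,4,5,9,11,12,14,15] [[],[4,9],[],[],[9],[2],[],[6,10,8,10]] [0,-1,0,0,0,-1,0,1,1]"
  "relation_ok 0 [0,1,2,11,12,13,14,15] [[10,9],[6,8],[],[],[],[1,9,8,10,8],[7,8],[4,9,10,8]] [0,3,0,0,1,0,0,-4,0]"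
  "relation_ok 1 [4,5,7,8,9,12,13,15] [[9,10,9],[2,9,8,10,8],[9,10,8],[4,10,8],[9],[3,8,10,8,9],[9],[2,9,8]] [0,0,3,1,0,0,1,0,3]"
  by code_simp+

text \<open>The solution of the eight relations in nine unknowns, scaled so that the entry for
  \<open>[0,1,2,3,8,9,10,11]\<close> is 1.\<close>

definition rep_values :: "int list" where
  "rep_values = [14, 2, -2, 2, -2, 0, 1, 1, 1]"

lemma spin9_rep_values:
  assumes "\<Psi> \<in> spin9_invariant_forms 8"
  shows "\<exists>c. list_all2 (\<lambda>r x. coef \<Psi> r = c * of_int x) reps rep_values"
proof -
  define x where "x i = coef \<Psi> (reps ! i)" for i
  have sum: "(\<Sum>(c, r)\<leftarrow>zip [c0, c1, c2, c3, c4, c5, c6, c7, c8] reps. of_int c * coef \<Psi> r) =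
      of_int c0 * x 0 + of_int c1 * x 1 + of_int c2 * x 2 + of_int c3 * x 3 + of_int c4 * x 4 +
      of_int c5 * x 5 + of_int c6 * x 6 + of_int c7 * x 7 + of_int c8 * x 8"
    for c0 c1 c2 c3 c4 c5 c6 c7 c8 :: int
    by (simp add: x_def reps_def)
  note rel = relations[THEN relation_okD[OF _ assms], unfolded sum]
  have lin: "- x 0 + 7 * x 1 = 0" "x 0 - x 1 + 6 * x 2 = 0" "- x 2 + x 5 - 2 * x 8 = 0" "x 2 + x 5 + 2 * x 8 = 0"
    "- x 2 + x 5 - 2 * x 6 = 0" "- x 1 - x 5 + x 7 + x 8 = 0" "3 * x 1 + x 4 - 4 * x 7 = 0"
    "3 * x 2 + x 3 + x 6 + 3 * x 8 = 0"
    using rel by simp_all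
  have "list_all2 (\<lambda>r y. coef \<Psi> r = c * of_int y) reps rep_values \<longleftrightarrow>
      x 0 = c * 14 \<and> x 1 = c * 2 \<and> x 2 = c * - 2 \<and> x 3 = c * 2 \<and> x 4 = c * - 2 \<and> x 5 = 0 \<and>
      x 6 = c \<and> x 7 = c \<and> x 8 = c" for c
    by (simp add: x_def reps_def rep_values_def)
  moreover have "x 0 = x 6 * 14 \<and> x 1 = x 6 * 2 \<and> x 2 = x 6 * - 2 \<and> x 3 = x 6 * 2 \<and> x 4 = x 6 * - 2 \<and> x 5 = 0 \<and>
      x 7 = x 6 \<and> x 8 = x 6"
    using lin by (intro conjI; linarith)
  ultimately show ?thesis by blast
qed

section \<open>The coefficients of the explicit form\<close>

text \<open>Octonions with integer coordinates are kept as formal sums of signed basis elements, so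
  that all evaluation takes place in the integers.\<close>

definition oct_val :: "(int \<times> nat) list \<Rightarrow> octonion" where
  "oct_val l = (\<Sum>p\<leftarrow>l. signed_e p)"

lemma oct_val_simps [simp]:
  "oct_val [] = 0" "oct_val (p # l) = signed_e p + oct_val l" "oct_val (l @ l') = oct_val l + oct_val l'"
  by (simp_all add: oct_val_def)

definition oct_indices :: "(int \<times> nat) list \<Rightarrow> bool" where
  "oct_indices l \<longleftrightarrow> (\<forall>p\<in>set l. snd p < 8)"

definition list_mult :: "(int \<times> nat) list \<Rightarrow> (int \<times> nat) list \<Rightarrow> (int \<times> nat) list" where
  "list_mult l l' = concat (map (\<lambda>p. map (\<lambda>q. let r = sperm (snd q) (snd p)
     in (fst p * fst q * fst r, snd r)) l') l)"

definition list_scale :: "int \<Rightarrow> (int \<times> nat) list \<Rightarrow> (int \<times> nat) list" where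
  "list_scale s l = map (\<lambda>p. (s * fst p, snd p)) l"

definition list_cnj :: "(int \<times> nat) list \<Rightarrow> (int \<times> nat) list" where
  "list_cnj l = map (\<lambda>p. (if snd p = 0 then fst p else - fst p, snd p)) l"

fun list_add :: "int \<times> nat \<Rightarrow> (int \<times> nat) list \<Rightarrow> (int \<times> nat) list" where
  "list_add p [] = [p]"
| "list_add p (q # l) = (if snd p = snd q then (fst p + fst q, snd q) # l else q # list_add p l)"

definition list_collect :: "(int \<times> nat) list \<Rightarrow> (int \<times> nat) list" where
  "list_collect l = filter (\<lambda>p. fst p \<noteq> 0) (foldr list_add l [])"

definition list_inner :: "(int \<times> nat) list \<Rightarrow> (int \<times> nat) list \<Rightarrow> int" where
  "list_inner l l' = sum_list (map (\<lambda>p. sum_list (map (\<lambda>q. if snd p = snd q then fst p * fst q else 0) l')) l)"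

lemma list_inner_Nil [simp]: "list_inner [] l = 0"
  by (simp add: list_inner_def)

lemma oct_indices_list_mult: "oct_indices l \<Longrightarrow> oct_indices l' \<Longrightarrow> oct_indices (list_mult l l')"
  using snd_sperms by (fastforce simp: oct_indices_def list_mult_def Let_def)

lemma oct_val_mult:
  assumes "oct_indices l" "oct_indices l'"
  shows "oct_val (list_mult l l') = oct_val l \<odot> oct_val l'"
proof -
  have 1: "signed_e p \<odot> signed_e q = signed_e (let r = sperm (snd q) (snd p) in (fst p * fst q * fst r, snd r))"
    if "snd p < 8" "snd q < 8" for p q
    using signed_e_mult[OF that] by (simp add: signed_e_def oct_scale_right Let_def mult.commute)
  have 2: "oct_val (map (\<lambda>q. let r = sperm (snd q) (snd p) in (fst p * fst q * fst r, snd r)) l') = signed_e p \<odot> oct_val l'"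
    if "snd p < 8" for p
    using assms(2) by (induction l') (simp_all add: oct_indices_def oct_mult_0 oct_add_right 1 that)
  show ?thesis
    using assms(1) unfolding list_mult_def
    by (induction l) (simp_all add: oct_indices_def oct_mult_0 oct_add_left 2)
qed

lemma oct_val_scale: "oct_val (list_scale s l) = of_int s *\<^sub>R oct_val l"
  by (induction l) (simp_all add: list_scale_def signed_e_def scaleR_right_distrib)

lemma oct_val_cnj: "oct_indices l \<Longrightarrow> oct_val (list_cnj l) = oct_cnj (oct_val l)"
  by (induction l)
    (auto simp: list_cnj_def oct_indices_def linear_0[OF linear_oct_cnj] linear_add[OF linear_oct_cnj] signed_e_def
      linear_scale[OF linear_oct_cnj] oct_cnj_oct_e)

lemma oct_indices_cnj: "oct_indices (list_cnj l) \<longleftrightarrow> oct_indices l"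
  by (simp add: oct_indices_def list_cnj_def)

lemma oct_val_list_add: "oct_val (list_add p m) = signed_e p + oct_val m"
proof (induction m)
  case (Cons q m)
  then show ?case
    by (cases "snd p = snd q") (simp_all add: signed_e_def scaleR_left_distrib add.assoc add.left_commute)
qed simp

lemma oct_val_collect: "oct_val (list_collect l) = oct_val l"
proof -
  have "oct_val (filter (\<lambda>p. fst p \<noteq> 0) m) = oct_val m" for m
    by (induction m) (auto simp: signed_e_def)
  moreover have "oct_val (foldr list_add l []) = oct_val l"
    by (induction l) (simp_all add: oct_val_list_add)
  ultimately show ?thesis by (simp add: list_collect_def)
qed

lemma oct_indices_simps [simp]:
  "oct_indices []" "oct_indices (p # l) \<longleftrightarrow> snd p < 8 \<and> oct_indices l"
  by (simp_all add: oct_indices_def)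

lemma oct_indices_list_add: "snd p < 8 \<Longrightarrow> oct_indices m \<Longrightarrow> oct_indices (list_add p m)"
  by (induction m) auto

lemma oct_indices_collect:
  assumes "oct_indices l"
  shows "oct_indices (list_collect l)"
proof -
  have "oct_indices (foldr list_add l [])"
    using assms by (induction l) (simp_all add: oct_indices_list_add)
  then show ?thesis by (simp add: list_collect_def oct_indices_def)
qed

lemma oct_val_inner:
  assumes "oct_indices l" "oct_indices l'"
  shows "oct_val l \<bullet> oct_val l' = of_int (list_inner l l')"
proof -
  have "oct_e i \<bullet> oct_e j = (if i = j then 1 else 0)" if "i < 8" "j < 8" for i j
  proof -
    show ?thesis
      using less_8_cases[OF that(1)] less_8_cases[OF that(2)]
      unfolding oct_e_def inner_axis_axis by (elim insertE emptyE) simp_all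
  qed
  then have 1: "signed_e p \<bullet> signed_e q = of_int (if snd p = snd q then fst p * fst q else 0)"
    if "snd p < 8" "snd q < 8" for p q
    using that by (simp add: signed_e_def)
  have 2: "signed_e p \<bullet> oct_val l' = of_int (sum_list (map (\<lambda>q. if snd p = snd q then fst p * fst q else 0) l'))"
    if "snd p < 8" for p
    using assms(2) by (induction l') (simp_all add: oct_indices_def inner_add_right 1 that)
  show ?thesis
    using assms(1) by (induction l) (simp_all add: list_inner_def oct_indices_def inner_add_left 2)
qed

section \<open>Evaluation of the forms on basis vectors\<close>

definition represents :: "nat \<Rightarrow> (nat list \<Rightarrow> (int \<times> nat) list) \<Rightarrow> ((nat \<Rightarrow> oct2) \<Rightarrow> octonion) \<Rightarrow> bool" where
  "represents n F \<phi> \<longleftrightarrow> alt_form n \<phi> \<and> (\<forall>ks. length ks = n \<longrightarrow> set ks \<subseteq> {..<16} \<longrightarrow>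
     oct_indices (F ks) \<and> coef \<phi> ks = oct_val (F ks))"

definition dx_list :: "nat list \<Rightarrow> (int \<times> nat) list" where
  "dx_list ks = (if hd ks < 8 then [(1, hd ks)] else [])"

definition dy_list :: "nat list \<Rightarrow> (int \<times> nat) list" where
  "dy_list ks = (if hd ks < 8 then [] else [(1, hd ks - 8)])"

lemma represents_dx: "represents 1 dx_list dx" and represents_dy: "represents 1 dy_list dy"
  using alt_form_dx alt_form_dy
  by (auto simp: represents_def dx_list_def dy_list_def oct_indices_def coef_def dx_def dy_def basis2_def
      signed_e_def length_Suc_conv)

lemma represents_cnj: "represents n F \<phi> \<Longrightarrow> represents n (\<lambda>ks. list_cnj (F ks)) (form_cnj \<phi>)"
  by (auto simp: represents_def alt_form_cnj oct_indices_cnj oct_val_cnj coef_def form_cnj_def)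

text \<open>The factor \<open>G\<close> is evaluated first: on basis vectors a coordinate form is
  often zero, and then the expensive \<open>F\<close> is skipped. Collecting equal indices keeps the
  lists short.\<close>

definition list_wedge where
  "list_wedge S F G ks = list_collect (concat (map (\<lambda>(s, I, J). let b = G (map ((!) ks) J) in
     if b = [] then [] else list_scale s (list_mult (F (map ((!) ks) I)) b)) S))"

lemma coef_map_nth: "alt_form n \<phi> \<Longrightarrow> length I = n \<Longrightarrow> \<phi> (\<lambda>i. basis2 (ks ! (I ! i))) = coef \<phi> (map ((!) ks) I)"
  unfolding coef_def by (rule alt_form_cong[of n]) simp_all

lemma represents_wedge:
  assumes F: "represents p F \<phi>" and G: "represents q G \<psi>" and S: "S = shuffle_signs p q"
  shows "represents (p + q) (list_wedge S F G) (owedge p q \<phi> \<psi>)"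
  unfolding represents_def
proof (intro conjI allI impI)
  have alt: "alt_form p \<phi>" "alt_form q \<psi>" using F G by (simp_all add: represents_def)
  then show "alt_form (p + q) (owedge p q \<phi> \<psi>)"
    by (rule alt_form_wedge_by[OF bilinear_oct_mult])
  fix ks :: "nat list" assume ks: "length ks = p + q" "set ks \<subseteq> {..<16}"
  have ok: "oct_indices (F (map ((!) ks) I))" "coef \<phi> (map ((!) ks) I) = oct_val (F (map ((!) ks) I))"
    "oct_indices (G (map ((!) ks) J))" "coef \<psi> (map ((!) ks) J) = oct_val (G (map ((!) ks) J))"
    "length I = p" "length J = q"
    if "(s, I, J) \<in> set S" for s I J
  proof -
    have l: "length I = p" "length J = q" "set I \<subseteq> {..<p + q}" "set J \<subseteq> {..<p + q}"
      using shuffle_signs_length that S by blast+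
    then have "set (map ((!) ks) I) \<subseteq> {..<16}" "set (map ((!) ks) J) \<subseteq> {..<16}"
      using ks by (auto dest!: subsetD intro!: subsetD[OF ks(2)])
    with l F G show "oct_indices (F (map ((!) ks) I))" "coef \<phi> (map ((!) ks) I) = oct_val (F (map ((!) ks) I))"
    "oct_indices (G (map ((!) ks) J))" "coef \<psi> (map ((!) ks) J) = oct_val (G (map ((!) ks) J))"
    "length I = p" "length J = q"
      by (simp_all add: represents_def)
  qed
  show "oct_indices (list_wedge S F G ks)"
    unfolding list_wedge_def using oct_indices_list_mult[OF ok(1,3)]
    by (intro oct_indices_collect) (fastforce simp: oct_indices_def list_scale_def Let_def)
  have "coef (owedge p q \<phi> \<psi>) ks = (\<Sum>(s, I, J)\<leftarrow>S. of_int s *\<^sub>R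
      (\<phi> (\<lambda>i. basis2 (ks ! (I ! i))) \<odot> \<psi> (\<lambda>i. basis2 (ks ! (J ! i)))))"
    unfolding coef_def S by (rule wedge_by_shuffle_signs[OF bilinear_oct_mult alt])
  also have "\<dots> = (\<Sum>(s, I, J)\<leftarrow>S. of_int s *\<^sub>R
      (oct_val (F (map ((!) ks) I)) \<odot> oct_val (G (map ((!) ks) J))))"
    by (intro arg_cong[where f = sum_list] map_cong refl)
      (auto simp: coef_map_nth[OF alt(1)] coef_map_nth[OF alt(2)] ok)
  also have "\<dots> = (\<Sum>(s, I, J)\<leftarrow>S. oct_val (let b = G (map ((!) ks) J) in
     if b = [] then [] else list_scale s (list_mult (F (map ((!) ks) I)) b)))"
    by (intro arg_cong[where f = sum_list] map_cong refl)
      (auto simp: Let_def oct_val_scale oct_val_mult ok oct_mult_0)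
  also have "\<dots> = oct_val (list_wedge S F G ks)"
    unfolding list_wedge_def oct_val_collect by (induct S) auto
  finally show "coef (owedge p q \<phi> \<psi>) ks = oct_val (list_wedge S F G ks)" .
qed

definition y_degree :: "nat list \<Rightarrow> nat" where
  "y_degree ks = length (filter (\<lambda>k. \<not> k < 8) ks)"

text \<open>The test of the degree in \<open>dy\<close> cuts off most shuffles before any product is
  formed. The shuffles are written out so that they are not recomputed for every argument.\<close>

definition list_quad where
  "list_quad n a b c d ks = (if y_degree ks = n then
     list_wedge [(1,[0,i1,i2],[i3]),(-1,[0,i1,i3],[i2]),(1,[0,i2,i3],[i1]),(-1,[i1,i2,i3],[0])]
       (list_wedge [(1,[0,i1],[i2]),(-1,[0,i2],[i1]),(1,[i1,i2],[0])]
         (list_wedge [(1,[0],[i1]),(-1,[i1],[0])] (\<lambda>ks. list_cnj (a ks)) b) (\<lambda>ks. list_cnj (c ks))) d ks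
     else [])"

lemma shuffle_signs_1:
  "[(1,[0],[i1]),(-1,[i1],[0])] = shuffle_signs 1 1"
  "[(1,[0,i1],[i2]),(-1,[0,i2],[i1]),(1,[i1,i2],[0])] = shuffle_signs 2 1"
  "[(1,[0,i1,i2],[i3]),(-1,[0,i1,i3],[i2]),(1,[0,i2,i3],[i1]),(-1,[i1,i2,i3],[0])] = shuffle_signs 3 1"
  by code_simp+

text \<open>Scaling the second summand of \<open>\<O> \<oplus> \<O>\<close> by 2 detects the degree in \<open>dy\<close>.\<close>

lemma represents_quad:
  assumes a: "represents 1 a \<alpha>" and b: "represents 1 b \<beta>" and c: "represents 1 c \<gamma>" and d: "represents 1 d \<delta>"
    and deg: "\<And>v. quad_form \<alpha> \<beta> \<gamma> \<delta> (\<lambda>i. map_prod id ((*\<^sub>R) 2) (v i)) = 2 ^ n *\<^sub>R quad_form \<alpha> \<beta> \<gamma> \<delta> v"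
  shows "represents 4 (list_quad n a b c d) (quad_form \<alpha> \<beta> \<gamma> \<delta>)"
proof -
  let ?L = "list_wedge [(1,[0,i1,i2],[i3]),(-1,[0,i1,i3],[i2]),(1,[0,i2,i3],[i1]),(-1,[i1,i2,i3],[0])]
       (list_wedge [(1,[0,i1],[i2]),(-1,[0,i2],[i1]),(1,[i1,i2],[0])]
         (list_wedge [(1,[0],[i1]),(-1,[i1],[0])] (\<lambda>ks. list_cnj (a ks)) b) (\<lambda>ks. list_cnj (c ks))) d"
  have e: "(2::nat) + 1 = 3" "(3::nat) + 1 = 4" by simp_all
  note 1 = represents_wedge[OF represents_cnj[OF a] b shuffle_signs_1(1), unfolded one_add_one]
  note 2 = represents_wedge[OF 1 represents_cnj[OF c] shuffle_signs_1(2), unfolded e]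
  have L: "represents 4 ?L (quad_form \<alpha> \<beta> \<gamma> \<delta>)"
    unfolding quad_form_def by (rule represents_wedge[OF 2 d shuffle_signs_1(3), unfolded e])
  then have alt: "alt_form 4 (quad_form \<alpha> \<beta> \<gamma> \<delta>)" by (simp add: represents_def)
  have 0: "coef (quad_form \<alpha> \<beta> \<gamma> \<delta>) ks = 0" if ks: "length ks = 4" "y_degree ks \<noteq> n" for ks
  proof -
    define f :: "nat \<Rightarrow> int \<times> nat" where "f k = (if k < 8 then 1 else 2, k)" for k
    have "2 ^ n *\<^sub>R coef (quad_form \<alpha> \<beta> \<gamma> \<delta>) ks =
        quad_form \<alpha> \<beta> \<gamma> \<delta> (\<lambda>i. map_prod id ((*\<^sub>R) 2) (basis2 (ks ! i)))"
      unfolding coef_def by (rule deg[symmetric])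
    also have "\<dots> = of_int (prod_list (map fst (map f ks))) *\<^sub>R coef (quad_form \<alpha> \<beta> \<gamma> \<delta>) (map snd (map f ks))"
      by (rule alt_form_coef_scaleR[OF alt ks(1)]) (auto simp: f_def basis2_def)
    also have "map snd (map f ks) = ks" by (simp add: f_def o_def)
    also have "prod_list (map fst (map f ks)) = 2 ^ y_degree ks"
      by (induction ks) (auto simp: f_def y_degree_def)
    finally show ?thesis using ks(2) by simp
  qed
  show ?thesis
    unfolding represents_def
  proof (intro conjI allI impI alt)
    fix ks :: "nat list" assume ks: "length ks = 4" "set ks \<subseteq> {..<16}"
    have L': "oct_indices (?L ks)" "coef (quad_form \<alpha> \<beta> \<gamma> \<delta>) ks = oct_val (?L ks)"
      using L ks unfolding represents_def by blast+
    have c: "list_quad n a b c d ks = (if y_degree ks = n then ?L ks else [])"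
      by (simp only: list_quad_def)
    show "oct_indices (list_quad n a b c d ks)"
      using L'(1) unfolding c by (simp add: oct_indices_def)
    show "coef (quad_form \<alpha> \<beta> \<gamma> \<delta>) ks = oct_val (list_quad n a b c d ks)"
      unfolding c using 0[OF ks(1)] L'(2) by (cases "y_degree ks = n") simp_all
  qed
qed

lemma represents_Psi:
  "represents 4 (list_quad 0 dx_list dx_list dx_list dx_list) Psi40"
  "represents 4 (list_quad 1 dy_list dx_list dx_list dx_list) Psi31"
  "represents 4 (list_quad 3 dx_list dy_list dy_list dy_list) Psi13"
  "represents 4 (list_quad 4 dy_list dy_list dy_list dy_list) Psi04"
proof -
  let ?g = "map_prod id ((*\<^sub>R) 2) :: oct2 \<Rightarrow> oct2"
  have d: "dx (\<lambda>i. ?g (v i)) = 1 *\<^sub>R dx v" "dy (\<lambda>i. ?g (v i)) = 2 *\<^sub>R dy v" for v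
    by (simp_all add: dx_def dy_def)
  have "quad_form dx dx dx dx (\<lambda>i. ?g (v i)) = (1 * 1 * 1 * 1) *\<^sub>R quad_form dx dx dx dx v"
    "quad_form dy dx dx dx (\<lambda>i. ?g (v i)) = (2 * 1 * 1 * 1) *\<^sub>R quad_form dy dx dx dx v"
    "quad_form dx dy dy dy (\<lambda>i. ?g (v i)) = (1 * 2 * 2 * 2) *\<^sub>R quad_form dx dy dy dy v"
    "quad_form dy dy dy dy (\<lambda>i. ?g (v i)) = (2 * 2 * 2 * 2) *\<^sub>R quad_form dy dy dy dy v" for v
    by (intro quad_form_scale d)+
  then show "represents 4 (list_quad 0 dx_list dx_list dx_list dx_list) Psi40"
    "represents 4 (list_quad 1 dy_list dx_list dx_list dx_list) Psi31"
    "represents 4 (list_quad 3 dx_list dy_list dy_list dy_list) Psi13"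
    "represents 4 (list_quad 4 dy_list dy_list dy_list dy_list) Psi04"
    unfolding Psi_eq_quad_form
    by (intro represents_quad represents_dx represents_dy; simp)+
qed

definition list_wedge_inner where
  "list_wedge_inner S F G ks = sum_list (map (\<lambda>(s, I, J). let a = F (map ((!) ks) I) in
     if a = [] then 0 else s * list_inner a (G (map ((!) ks) J))) S)"

lemma of_int_sum_list: "of_int (sum_list xs) = (\<Sum>x\<leftarrow>xs. of_int x)"
  by (induction xs) simp_all

lemma coef_wedge_inner:
  assumes F: "represents 4 F \<phi>" and G: "represents 4 G \<psi>" and ks: "length ks = 8" "set ks \<subseteq> {..<16}"
  shows "coef (wedge_inner \<phi> \<psi>) ks = of_int (list_wedge_inner (shuffle_signs 4 4) F G ks)"
proof -
  have alt: "alt_form 4 \<phi>" "alt_form 4 \<psi>" using F G by (simp_all add: represents_def)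
  have ok: "oct_indices (F (map ((!) ks) I))" "coef \<phi> (map ((!) ks) I) = oct_val (F (map ((!) ks) I))"
    "oct_indices (G (map ((!) ks) J))" "coef \<psi> (map ((!) ks) J) = oct_val (G (map ((!) ks) J))"
    "length I = 4" "length J = 4"
    if "(s, I, J) \<in> set (shuffle_signs 4 4)" for s I J
  proof -
    have l: "length I = 4" "length J = 4" "set I \<subseteq> {..<4 + 4}" "set J \<subseteq> {..<4 + 4}"
      using shuffle_signs_length that by blast+
    then have "set (map ((!) ks) I) \<subseteq> {..<16}" "set (map ((!) ks) J) \<subseteq> {..<16}"
      using ks by (auto dest!: subsetD intro!: subsetD[OF ks(2)])
    with l F G show "oct_indices (F (map ((!) ks) I))" "coef \<phi> (map ((!) ks) I) = oct_val (F (map ((!) ks) I))"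
    "oct_indices (G (map ((!) ks) J))" "coef \<psi> (map ((!) ks) J) = oct_val (G (map ((!) ks) J))"
    "length I = 4" "length J = 4"
      by (simp_all add: represents_def)
  qed
  have "bilinear ((\<bullet>) :: octonion \<Rightarrow> octonion \<Rightarrow> real)"
    using bilinear_conv_bounded_bilinear bounded_bilinear_inner by auto
  then have "coef (wedge_inner \<phi> \<psi>) ks = (\<Sum>(s, I, J)\<leftarrow>shuffle_signs 4 4. of_int s *\<^sub>R
      (\<phi> (\<lambda>i. basis2 (ks ! (I ! i))) \<bullet> \<psi> (\<lambda>i. basis2 (ks ! (J ! i)))))"
    unfolding coef_def by (rule wedge_by_shuffle_signs[OF _ alt])
  also have "\<dots> = (\<Sum>(s, I, J)\<leftarrow>shuffle_signs 4 4. of_int (let a = F (map ((!) ks) I) in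
     if a = [] then 0 else s * list_inner a (G (map ((!) ks) J))))"
    by (intro arg_cong[where f = sum_list] map_cong refl)
      (auto simp: coef_map_nth[OF alt(1)] coef_map_nth[OF alt(2)] ok oct_val_inner Let_def)
  also have "\<dots> = of_int (list_wedge_inner (shuffle_signs 4 4) F G ks)"
    unfolding list_wedge_inner_def of_int_sum_list map_map o_def
    by (simp add: case_prod_unfold)
  finally show ?thesis .
qed

definition Psi8_list :: "(int \<times> nat list \<times> nat list) list \<Rightarrow> nat list \<Rightarrow> int" where
  "Psi8_list S ks =
     (let P40 = list_quad 0 dx_list dx_list dx_list dx_list; P31 = list_quad 1 dy_list dx_list dx_list dx_list;
        P13 = list_quad 3 dx_list dy_list dy_list dy_list; P04 = list_quad 4 dy_list dy_list dy_list dy_list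
      in list_wedge_inner S P40 P40 ks + 4 * list_wedge_inner S P31 P31 ks
        - 10 * list_wedge_inner S P31 (\<lambda>ks. list_cnj (P13 ks)) ks
        + 4 * list_wedge_inner S P13 P13 ks + list_wedge_inner S P04 P04 ks)"

lemma coef_Psi8_re:
  assumes "length ks = 8" "set ks \<subseteq> {..<16}"
  shows "coef Psi8_re ks = of_int (Psi8_list (shuffle_signs 4 4) ks)"
proof -
  have "coef Psi8_re ks = coef (wedge_inner Psi40 Psi40) ks + 4 * coef (wedge_inner Psi31 Psi31) ks
     - 10 * coef (wedge_inner Psi31 (form_cnj Psi13)) ks
     + 4 * coef (wedge_inner Psi13 Psi13) ks + coef (wedge_inner Psi04 Psi04) ks"
    by (simp add: coef_def Psi8_re_def)
  also have "\<dots> = of_int (Psi8_list (shuffle_signs 4 4) ks)"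
    unfolding Psi8_list_def Let_def
      coef_wedge_inner[OF represents_Psi(1) represents_Psi(1) assms]
      coef_wedge_inner[OF represents_Psi(2) represents_Psi(2) assms]
      coef_wedge_inner[OF represents_Psi(2) represents_cnj[OF represents_Psi(3)] assms]
      coef_wedge_inner[OF represents_Psi(3) represents_Psi(3) assms]
      coef_wedge_inner[OF represents_Psi(4) represents_Psi(4) assms]
    by simp
  finally show ?thesis .
qed

text \<open>Reality and the small symmetry group use only that the factors 1, 4, -5, 4, 1 are
  symmetric; their values enter here. For \<open>[8,9,10,11,12,13,14,15]\<close> only the square of
  \<open>Psi04\<close> contributes, with \<open>2880 * 14 = 8! = 70 * 24 * 24\<close>: each of the
  70 shuffles attains the maximal value of an inner product of two sums of 24 units.\<close>

lemma Psi8_reps: "map (Psi8_list (shuffle_signs 4 4)) reps = map ((*) 2880) rep_values"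
  by code_simp

lemma spin7_form_diff_scale:
  assumes "spin7_form \<phi>" "spin7_form \<psi>"
  shows "spin7_form (\<lambda>v. \<phi> v - c * \<psi> v)"
proof -
  have "alt_form 8 (\<lambda>v. \<phi> v + (- c) * \<psi> v)"
    using assms unfolding spin7_form_def by (intro alt_form_add alt_form_scale) auto
  then show ?thesis
    using assms unfolding spin7_form_def pullback_def fun_eq_iff by simp
qed

theorem theorem1p1:
  fixes \<Psi> :: "(nat \<Rightarrow> octonion \<times> octonion) \<Rightarrow> real"
  assumes "\<Psi> \<in> spin9_invariant_forms 8" and "\<Psi> \<noteq> (\<lambda>_. 0)"
  shows "\<exists>c::real. c \<noteq> 0 \<and> Psi8 = real_form (\<lambda>v. c * \<Psi> v)"
proof -
  have \<Psi>: "spin7_form \<Psi>" by (rule spin7_form_of_spin9[OF assms(1)])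
  obtain c where "list_all2 (\<lambda>r x. coef \<Psi> r = c * of_int x) reps rep_values"
    using spin9_rep_values[OF assms(1)] by blast
  then have c: "coef \<Psi> (reps ! i) = c * of_int (rep_values ! i)" if "i < length reps" for i
    using that by (simp add: list_all2_conv_all_nth)
  have len: "length rep_values = length reps" by (simp add: rep_values_def reps_def)
  \<comment> \<open>Otherwise \<open>\<Psi>\<close> would vanish on all representatives and hence be
    zero.\<close>
  have "c \<noteq> 0"
  proof
    assume "c = 0"
    then have "\<Psi> v = 0" for v
      using c by (intro spin7_form_eq_0I[OF \<Psi>]) (auto simp: in_set_conv_nth)
    then show False using assms(2) by auto
  qed
  \<comment> \<open>The difference has the small symmetry group and vanishes on the representatives;
    invariance of \<open>Psi8\<close> under the rotations is a consequence.\<close>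
  have "Psi8_re v - 2880 / c * \<Psi> v = 0" for v
  proof (rule spin7_form_eq_0I[OF spin7_form_diff_scale[OF spin7_form_Psi8_re \<Psi>]])
    fix ks assume "ks \<in> set reps"
    then obtain i where i: "i < length reps" "ks = reps ! i" by (auto simp: in_set_conv_nth)
    have "length ks = 8" "set ks \<subseteq> {..<16}" using \<open>ks \<in> set reps\<close> by (auto simp: reps_def)
    then have "coef Psi8_re ks = of_int (map (Psi8_list (shuffle_signs 4 4)) reps ! i)"
      using i by (simp add: coef_Psi8_re)
    also have "\<dots> = 2880 * of_int (rep_values ! i)"
      unfolding Psi8_reps using i(1) len by simp
    finally show "coef (\<lambda>v. Psi8_re v - 2880 / c * \<Psi> v) ks = 0"
      using c[OF i(1)] i(2) \<open>c \<noteq> 0\<close> by (simp add: coef_def)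
  qed
  then have "Psi8_re = (\<lambda>v. 2880 / c * \<Psi> v)" by (simp add: fun_eq_iff)
  then have "Psi8 = real_form (\<lambda>v. 2880 / c * \<Psi> v)" by (simp add: Psi8_eq_real_form)
  with \<open>c \<noteq> 0\<close> show ?thesis by (intro exI[of _ "2880 / c"]) simp
qed

end
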